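(* Let $(Y_i, f_i, f_{ij})_{i \leqslant j}$ (indices in $J$) be a projective system of separable Fréchet spaces and let $X$ be its projective limit, with topology $\tau$, $\sigma$-algebra $\mathcal{F}$ and topological dual $X^*$. Let $\sigma = (\sigma(z))_{z\in\mathbb{Z}^d}$ be a random field with values in $\big(X^{\mathbb{Z}^d}, \mathcal{F}^{\otimes \mathbb{Z}^d}\big)$, and $\ell\geqslant 1$ an integer, such that for every $i \in J$ the field $f_i(\sigma)=(f_i(\sigma(z)))_{z}$ is c.a.d.i., c.l. and $R_\ell$-invariant. Then for every $x \in X$, $$ s(\sigma ; x) = - p^*(\sigma ; x), $$ where $s(\sigma;\cdot)$ is the entropy of $\sigma$ and $p^*(\sigma;\cdot)$ is the Fenchel–Legendre transform of the pressure $p(\sigma;\cdot)$ of $\sigma$.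
   Context: Fix $d\geqslant 1$. Boxes: $\Lambda(z;n)=z+([0,n[^d\cap\mathbb{Z}^d)$ for $n\geqslant 1$, $\Lambda(n)=\Lambda(0;n)$; $\mathrm{dist}$ is the distance associated with $|\cdot|_\infty$. For a field $\xi$ and finite $S\subset\mathbb{Z}^d$, $\xi_S=(\xi(z))_{z\in S}$; $\mathfrak{m}_\Lambda\xi=\frac1{|\Lambda|}\sum_{z\in\Lambda}\xi(z)$. Let $Y$ be a separable Fréchet space with Borel $\sigma$-algebra $\mathcal{B}$; $\mathcal{C}(Y^S)$ is the set of convex open subsets of $Y^S$ (product topology); $\mathcal{C}_0(Y)$ is a fixed base of convex open neighbourhoods of $0$ in $Y$. Let $\eta$ be a random field with values in $(Y^{\mathbb{Z}^d},\mathcal{B}^{\otimes\mathbb{Z}^d})$. c.a.d.i.: $\eta$ is c.a.d.i. if there are $g,c:\mathbb{N}^*\to[0,+\infty[$ with $g(n)/n\to0$, $c(n)/|\Lambda(n)|\to0$ such that for all $z\in\mathbb{Z}^d$, $n\in\mathbb{N}^*$, finite $S\subset\mathbb{Z}^d$, $C\in\mathcal{C}(Y^{\Lambda(z;n)})$, $D\in\mathcal{C}(Y^S)$: if $\mathrm{dist}(S,\Lambda(z;n))>g(n)$ then $\mathbb{P}(\eta_{\Lambda(z;n)}\in C,\ \eta_S\in D)\geqslant e^{-c(n)}\,\mathbb{P}(\eta_{\Lambda(z;n)}\in C)\,\mathbb{P}(\eta_S\in D)$. c.l.: $\eta$ is c.l. if there are $t:\mathcal{C}_0(Y)\to]0,+\infty[$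 and $\alpha:\mathcal{C}_0(Y)\to]0,1]$ such that for all $V\in\mathcal{C}_0(Y)$, $z\in\mathbb{Z}^d$, finite $S\subset\mathbb{Z}^d\setminus\{z\}$, $D\in\mathcal{C}(Y^S)$: $\mathbb{P}(\eta(z)\in t(V)V,\ \eta_S\in D)\geqslant\alpha(V)\,\mathbb{P}(\eta_S\in D)$. $R_\ell$-invariant: the law of $\eta$ is invariant under the translations of $R_\ell=(\ell\mathbb{Z})^d$. Projective system: $X$ is a real vector space; $(J,\leqslant)$ is a preordered set directed upwards; each $Y_i$ is a separable Fréchet space; $f_i:X\to Y_i$ is linear; for $i\leqslant j$, $f_{ij}:Y_j\to Y_i$ is continuous linear; $f_{ii}=\mathrm{id}$, and for $i\leqslant j\leqslant k$, $f_i=f_{ij}\circ f_j$, $f_{ik}=f_{ij}\circ f_{jk}$. Put $\mathcal{C}_0(X)=\{f_i^{-1}(t_iC_i): i\in J,\ t_i>0,\ C_i\in\mathcal{C}_0(Y_i)\}$ and let $\mathcal{C}$ be the set of translates $x+U$ ($x\in X$, $U\in\mathcal{C}_0(X)$). $X$ is given the topology $\tau$ and the $\sigma$-algebra $\mathcal{F}$ generated by $\mathcal{C}$, and is called the projective limit of the system. Entropy: $s(\sigma;x)=\inf_{A\in\mathcal{C},\,A\ni x}\ \liminf_{n\to\infty}\frac1{|\Lambda(n)|}\log\mathbb{P}(\mathfrak{m}_{\Lambda(n)}\sigma\in A)$ (with $\log 0=-\infty$). Pressure: for $\lambda\in X^*$, $p_\Lambda(\sigma;\lambda)=\frac1{|\Lambda|}\log\mathbb{E}\big[\exp\langle\lambda|\sum_{z\in\Lambda}\sigma(z)\rangle\big]$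 and $p(\sigma;\lambda)=\lim_{n\to\infty}p_{\Lambda(n)}(\sigma;\lambda)\in[-\infty,+\infty]$ (this limit exists under the hypotheses). $p^*(\sigma;x)=\sup_{\lambda\in X^*}(\langle\lambda|x\rangle-p(\sigma;\lambda))$. *)

theory Defs
  imports "HOL-Probability.Probability"
begin

text \<open>The lattice \<open>\<int>\<^sup>d\<close> is \<^typ>\<open>int ^ 'd\<close> with \<open>d = CARD('d) \<ge> 1\<close>.\<close>

definition sup_norm :: "int ^ 'd \<Rightarrow> int" where
  "sup_norm z = Max (range (\<lambda>k. \<bar>z $ k\<bar>))"

text \<open>With values in \<^typ>\<open>ereal\<close>, so that the distance from the empty set is \<open>\<infinity>\<close>.\<close>

definition lattice_dist :: "(int ^ 'd) set \<Rightarrow> (int ^ 'd) set \<Rightarrow> ereal" where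
  "lattice_dist S L = (INF s\<in>S. INF w\<in>L. ereal (real_of_int (sup_norm (s - w))))"

definition lattice_box :: "int ^ 'd \<Rightarrow> nat \<Rightarrow> (int ^ 'd) set" where
  "lattice_box z n = (+) z ` {v. \<forall>k. 0 \<le> v $ k \<and> v $ k < int n}"

definition box_mean :: "(int ^ 'd) set \<Rightarrow> (int ^ 'd \<Rightarrow> 'x::real_vector) \<Rightarrow> 'x" where
  "box_mean L \<xi> = (1 / real (card L)) *\<^sub>R (\<Sum>z\<in>L. \<xi> z)"


text \<open>
  A topological vector space is given by a topology whose underlying set \<^term>\<open>topspace T\<close> is a
  linear subspace of an ambient real vector space. The ambient space only supplies the vector
  operations and carries no topology. This makes it possible to speak about a family of
  topological vector spaces with different underlying sets: every such family embeds
  algebraically in one real vector space, for instance the direct sum of its members.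
\<close>

definition frechet_space :: "'y::real_vector topology \<Rightarrow> bool" where
  "frechet_space T \<longleftrightarrow>
     subspace (topspace T) \<and>
     continuous_map (prod_topology T T) T (\<lambda>(x, y). x + y) \<and>
     continuous_map (prod_topology euclideanreal T) T (\<lambda>(a, x). a *\<^sub>R x) \<and>
     (\<forall>U. openin T U \<and> 0 \<in> U \<longrightarrow> (\<exists>V. openin T V \<and> convex V \<and> 0 \<in> V \<and> V \<subseteq> U)) \<and>
     (\<exists>\<rho>. Metric_space (topspace T) \<rho> \<and>
          Metric_space.mcomplete (topspace T) \<rho> \<and>
          Metric_space.mtopology (topspace T) \<rho> = T \<and>
          (\<forall>x\<in>topspace T. \<forall>y\<in>topspace T. \<forall>z\<in>topspace T. \<rho> (x + z) (y + z) = \<rho> x y))"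

definition convex_zero_base :: "'y::real_vector topology \<Rightarrow> 'y set set \<Rightarrow> bool" where
  "convex_zero_base T B \<longleftrightarrow>
     (\<forall>V\<in>B. openin T V \<and> convex V \<and> 0 \<in> V) \<and>
     (\<forall>U. openin T U \<and> 0 \<in> U \<longrightarrow> (\<exists>V\<in>B. V \<subseteq> U))"

definition borel_of :: "'y topology \<Rightarrow> 'y measure" where
  "borel_of T = sigma (topspace T) {U. openin T U}"

definition dilate :: "real \<Rightarrow> 'y::real_vector set \<Rightarrow> 'y set" where
  "dilate t V = (\<lambda>y. t *\<^sub>R y) ` V"

text \<open>
  The convex open subsets of \<open>Y\<^sup>S\<close>. Elements of \<open>Y\<^sup>S\<close> are functions that are \<^term>\<open>undefined\<close>
  outside \<open>S\<close>, hence the restriction in the convex combination.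
\<close>

definition convex_open_power ::
    "'y::real_vector topology \<Rightarrow> 's set \<Rightarrow> ('s \<Rightarrow> 'y) set set" where
  "convex_open_power T S =
     {C. openin (product_topology (\<lambda>_. T) S) C \<and>
         (\<forall>u\<in>C. \<forall>v\<in>C. \<forall>a\<in>{0..1}. (\<lambda>z\<in>S. (1 - a) *\<^sub>R u z + a *\<^sub>R v z) \<in> C)}"


text \<open>Random fields are maps \<open>\<eta>\<close> from the sample space of \<open>M\<close> to configurations on \<^typ>\<open>int ^ 'd\<close>.\<close>

definition cadi ::
    "'w measure \<Rightarrow> 'y::real_vector topology \<Rightarrow> ('w \<Rightarrow> int ^ 'd \<Rightarrow> 'y) \<Rightarrow> bool" where
  "cadi M T \<eta> \<longleftrightarrow>
     (\<exists>g c :: nat \<Rightarrow> real.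
        (\<forall>n\<ge>1. 0 \<le> g n \<and> 0 \<le> c n) \<and>
        (\<lambda>n. g n / real n) \<longlonglongrightarrow> 0 \<and>
        (\<lambda>n. c n / real (card (lattice_box (0 :: int ^ 'd) n))) \<longlonglongrightarrow> 0 \<and>
        (\<forall>z. \<forall>n\<ge>1. \<forall>S. finite S \<longrightarrow>
          (\<forall>C \<in> convex_open_power T (lattice_box z n). \<forall>D \<in> convex_open_power T S.
             lattice_dist S (lattice_box z n) > ereal (g n) \<longrightarrow>
             measure M {\<omega>\<in>space M. restrict (\<eta> \<omega>) (lattice_box z n) \<in> C \<and> restrict (\<eta> \<omega>) S \<in> D}
               \<ge> exp (- c n)
                 * measure M {\<omega>\<in>space M. restrict (\<eta> \<omega>) (lattice_box z n) \<in> C}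
                 * measure M {\<omega>\<in>space M. restrict (\<eta> \<omega>) S \<in> D})))"

definition cl ::
    "'w measure \<Rightarrow> 'y::real_vector topology \<Rightarrow> 'y set set \<Rightarrow> ('w \<Rightarrow> int ^ 'd \<Rightarrow> 'y) \<Rightarrow> bool" where
  "cl M T B \<eta> \<longleftrightarrow>
     (\<exists>t \<alpha> :: 'y set \<Rightarrow> real.
        (\<forall>V\<in>B. 0 < t V \<and> 0 < \<alpha> V \<and> \<alpha> V \<le> 1) \<and>
        (\<forall>V\<in>B. \<forall>z S. finite S \<and> z \<notin> S \<longrightarrow>
          (\<forall>D \<in> convex_open_power T S.
             measure M {\<omega>\<in>space M. \<eta> \<omega> z \<in> dilate (t V) V \<and> restrict (\<eta> \<omega>) S \<in> D}
               \<ge> \<alpha> V * measure M {\<omega>\<in>space M. restrict (\<eta> \<omega>) S \<in> D})))"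

definition translation_invariant ::
    "nat \<Rightarrow> 'w measure \<Rightarrow> 'y measure \<Rightarrow> ('w \<Rightarrow> int ^ 'd \<Rightarrow> 'y) \<Rightarrow> bool" where
  "translation_invariant l M N \<eta> \<longleftrightarrow>
     (\<forall>a :: int ^ 'd. (\<forall>k. int l dvd a $ k) \<longrightarrow>
        distr M (PiM UNIV (\<lambda>_. N)) (\<lambda>\<omega> z. \<eta> \<omega> (z + a)) = distr M (PiM UNIV (\<lambda>_. N)) \<eta>)"


definition linear_between ::
    "'a::real_vector set \<Rightarrow> 'b::real_vector set \<Rightarrow> ('a \<Rightarrow> 'b) \<Rightarrow> bool" where
  "linear_between E F h \<longleftrightarrow>
     h ` E \<subseteq> F \<and>
     (\<forall>x\<in>E. \<forall>y\<in>E. h (x + y) = h x + h y) \<and>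
     (\<forall>a. \<forall>x\<in>E. h (a *\<^sub>R x) = a *\<^sub>R h x)"

text \<open>
  \<open>T i\<close> is the topology of \<open>Y\<^sub>i\<close>, \<open>B i\<close> the fixed base \<open>\<C>\<^sub>0(Y\<^sub>i)\<close>, and \<open>h i j\<close> the connecting map
  \<open>Y\<^sub>j \<rightarrow> Y\<^sub>i\<close>. As usual, a directed set is nonempty.
\<close>

locale projective_system =
  fixes J :: "'i set" and le :: "'i \<Rightarrow> 'i \<Rightarrow> bool"
    and T :: "'i \<Rightarrow> 'y::real_vector topology" and B :: "'i \<Rightarrow> 'y set set"
    and f :: "'i \<Rightarrow> 'x::real_vector \<Rightarrow> 'y" and h :: "'i \<Rightarrow> 'i \<Rightarrow> 'y \<Rightarrow> 'y"
  assumes nonempty: "J \<noteq> {}"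
    and reflexive: "reflp_on J le"
    and transitive: "transp_on J le"
    and directed: "\<And>i j. i \<in> J \<Longrightarrow> j \<in> J \<Longrightarrow> \<exists>k\<in>J. le i k \<and> le j k"
    and frechet: "\<And>i. i \<in> J \<Longrightarrow> frechet_space (T i)"
    and separable: "\<And>i. i \<in> J \<Longrightarrow> separable_space (T i)"
    and zero_base: "\<And>i. i \<in> J \<Longrightarrow> convex_zero_base (T i) (B i)"
    and f_linear: "\<And>i. i \<in> J \<Longrightarrow> linear_between UNIV (topspace (T i)) (f i)"
    and h_linear: "\<And>i j. i \<in> J \<Longrightarrow> j \<in> J \<Longrightarrow> le i j \<Longrightarrow>
                     linear_between (topspace (T j)) (topspace (T i)) (h i j)"
    and h_continuous: "\<And>i j. i \<in> J \<Longrightarrow> j \<in> J \<Longrightarrow> le i j \<Longrightarrow> continuous_map (T j) (T i) (h i j)"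
    and h_refl: "\<And>i y. i \<in> J \<Longrightarrow> y \<in> topspace (T i) \<Longrightarrow> h i i y = y"
    and f_comp: "\<And>i j x. i \<in> J \<Longrightarrow> j \<in> J \<Longrightarrow> le i j \<Longrightarrow> f i x = h i j (f j x)"
    and h_comp: "\<And>i j k y. i \<in> J \<Longrightarrow> j \<in> J \<Longrightarrow> k \<in> J \<Longrightarrow> le i j \<Longrightarrow> le j k \<Longrightarrow>
                   y \<in> topspace (T k) \<Longrightarrow> h i k y = h i j (h j k y)"

definition proj_zero_base ::
    "'i set \<Rightarrow> ('i \<Rightarrow> 'y::real_vector set set) \<Rightarrow> ('i \<Rightarrow> 'x \<Rightarrow> 'y) \<Rightarrow> 'x set set" where
  "proj_zero_base J B f = {f i -` dilate t C | i t C. i \<in> J \<and> 0 < t \<and> C \<in> B i}"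

definition proj_base ::
    "'i set \<Rightarrow> ('i \<Rightarrow> 'y::real_vector set set) \<Rightarrow> ('i \<Rightarrow> 'x::real_vector \<Rightarrow> 'y) \<Rightarrow> 'x set set" where
  "proj_base J B f = {(+) x ` U | x U. U \<in> proj_zero_base J B f}"

definition proj_topology ::
    "'i set \<Rightarrow> ('i \<Rightarrow> 'y::real_vector set set) \<Rightarrow> ('i \<Rightarrow> 'x::real_vector \<Rightarrow> 'y) \<Rightarrow> 'x topology" where
  "proj_topology J B f = topology_generated_by (proj_base J B f)"

definition proj_sigma ::
    "'i set \<Rightarrow> ('i \<Rightarrow> 'y::real_vector set set) \<Rightarrow> ('i \<Rightarrow> 'x::real_vector \<Rightarrow> 'y) \<Rightarrow> 'x measure" where
  "proj_sigma J B f = sigma UNIV (proj_base J B f)"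

definition topological_dual :: "'x::real_vector topology \<Rightarrow> ('x \<Rightarrow> real) set" where
  "topological_dual \<tau> = {u. linear u \<and> continuous_map \<tau> euclideanreal u}"


definition elog :: "ennreal \<Rightarrow> ereal" where
  "elog p = (if p = 0 then -\<infinity> else if p = \<infinity> then \<infinity> else ereal (ln (enn2real p)))"

definition field_entropy ::
    "'w measure \<Rightarrow> 'x::real_vector set set \<Rightarrow> ('w \<Rightarrow> int ^ 'd \<Rightarrow> 'x) \<Rightarrow> 'x \<Rightarrow> ereal" where
  "field_entropy M \<A> \<sigma> x =
     (INF A\<in>{A\<in>\<A>. x \<in> A}.
        liminf (\<lambda>n. elog (emeasure M {\<omega>\<in>space M. box_mean (lattice_box 0 n) (\<sigma> \<omega>) \<in> A})
                      / ereal (real (card (lattice_box (0 :: int ^ 'd) n)))))"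

definition box_pressure ::
    "'w measure \<Rightarrow> ('w \<Rightarrow> int ^ 'd \<Rightarrow> 'x::real_vector) \<Rightarrow> (int ^ 'd) set \<Rightarrow> ('x \<Rightarrow> real) \<Rightarrow> ereal" where
  "box_pressure M \<sigma> L u =
     elog (\<integral>\<^sup>+ \<omega>. ennreal (exp (u (\<Sum>z\<in>L. \<sigma> \<omega> z))) \<partial>M) / ereal (real (card L))"

definition pressure ::
    "'w measure \<Rightarrow> ('w \<Rightarrow> int ^ 'd \<Rightarrow> 'x::real_vector) \<Rightarrow> ('x \<Rightarrow> real) \<Rightarrow> ereal" where
  "pressure M \<sigma> u = lim (\<lambda>n. box_pressure M \<sigma> (lattice_box 0 n) u)"

definition fenchel_legendre ::
    "('x \<Rightarrow> real) set \<Rightarrow> (('x \<Rightarrow> real) \<Rightarrow> ereal) \<Rightarrow> 'x \<Rightarrow> ereal" where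
  "fenchel_legendre X' p x = (SUP u\<in>X'. ereal (u x) - p u)"

end

theory Submission
  imports Defs
begin

text \<open>
  Fix \<open>i\<close> and put \<open>\<eta> = f\<^sub>i(\<sigma>)\<close>. Cut \<open>\<Lambda>(n)\<close> into translates of \<open>\<Lambda>(m)\<close> with gaps: c.a.d.i. decouples the
  tiles, and c.l. controls the sites in the gaps, whose proportion vanishes as \<open>m\<close> grows. The functions
  \<open>exp \<langle>u | \<Sum> \<eta>\<rangle> 1\<^sub>C\<close> with \<open>C\<close> convex open have convex open superlevel sets, so the layer-cake
  formula extends the decoupling from probabilities to the restricted exponential moments
  \<open>E[exp \<langle>u | \<Sum> \<eta>\<rangle>; mean \<in> A]\<close>. Their logarithms are therefore almost superadditive, which makes the
  pressure converge and the entropy concave.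

  The Chernoff bound gives \<open>s \<le> - p\<^sup>*\<close>. For the converse, the exponential growth rate \<open>p(u)\<close> is
  concentrated at a point: a neighbourhood that carries a rate close to \<open>p(u)\<close> contains smaller ones that lose
  arbitrarily little, and completeness provides a limit \<open>z\<close> with \<open>u(z) + s(z)\<close> close to \<open>p(u)\<close>.
  No tightness is needed. If \<open>s(y) < a\<close>, the Hahn--Banach theorem separates the concave function \<open>s \<le> 0\<close>
  from the level \<open>a\<close> near \<open>y\<close> by some \<open>u\<close>, and concentration turns this into \<open>p(u) \<le> u(y) + a\<close>.
\<close>

text \<open>Restricted exponential moments can vanish and full ones can be infinite. The estimates
  are therefore comparisons of \<open>Z u n A\<close> with \<open>exp (b * n ^ d)\<close> for real
  \<open>b\<close>, and logarithms appear only at the end. One index i is enough at a time: a basic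
  neighbourhood in X comes from a single \<open>f i\<close> by definition, and a continuous
  functional does so by directedness and Hahn-Banach. The limit z, however, is found in Y_i and may
  lie outside the range of \<open>f i\<close>. So the entropy is studied on all of Y_i, and only the
  separated point y comes from X. The hypotheses speak of convex open events only, so a set cannot
  be cut into arbitrary small pieces. This shapes the mixing estimate: it starts from two convex
  open sets at one box size and ends, for all large sizes, with any set that contains the resulting
  averages. The weights in these averages add up to slightly less than 1 because of the gaps, and
  every target set has to absorb this deficit.\<close>

section \<open>Dilates of convex sets\<close>

lemma mem_dilate: "y \<in> dilate t V \<longleftrightarrow> (\<exists>v\<in>V. y = t *\<^sub>R v)"
  by (auto simp: dilate_def)

lemma dilate_one [simp]: "dilate 1 V = V"
  by (simp add: dilate_def)

lemma zero_mem_dilate: "0 \<in> V \<Longrightarrow> 0 \<in> dilate t V"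
  by (auto simp: mem_dilate intro!: bexI[of _ 0])

lemma convex_dilate: "convex V \<Longrightarrow> convex (dilate t V)"
  unfolding dilate_def by (rule convex_scaling)

text \<open>Convexity alone makes dilates add, after normalising the weights r and s; this replaces
  the triangle inequality of a norm. The case \<open>r + s = 0\<close> is split off because nothing
  can be normalised there.\<close>

lemma dilate_add:
  assumes "convex V" "0 \<le> r" "0 \<le> s" "x \<in> dilate r V" "y \<in> dilate s V"
  shows "x + y \<in> dilate (r + s) V"
proof (cases "r + s = 0")
  case True
  then have "r = 0" "s = 0" using assms by auto
  then show ?thesis using assms by (auto simp: mem_dilate)
next
  case False
  then have p: "r + s > 0" using assms by auto
  obtain v w where vw: "v \<in> V" "w \<in> V" "x = r *\<^sub>R v" "y = s *\<^sub>R w"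
    using assms by (auto simp: mem_dilate)
  have "(r / (r + s)) *\<^sub>R v + (s / (r + s)) *\<^sub>R w \<in> V"
    using vw assms p by (intro convexD) (auto simp: add_divide_distrib[symmetric])
  moreover have "x + y = (r + s) *\<^sub>R ((r / (r + s)) *\<^sub>R v + (s / (r + s)) *\<^sub>R w)"
    using p by (simp add: vw scaleR_right_distrib)
  ultimately show ?thesis unfolding mem_dilate by blast
qed

lemma dilate_mono:
  assumes "convex V" "0 \<in> V" "0 \<le> r" "r \<le> s" "x \<in> dilate r V"
  shows "x \<in> dilate s V"
  using dilate_add[OF assms(1,3) _ assms(5) zero_mem_dilate[OF assms(2)], of "s - r"] assms(4) by simp

lemma scaleR_mem_dilate: "x \<in> dilate r V \<Longrightarrow> a *\<^sub>R x \<in> dilate (a * r) V"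
  by (auto simp: mem_dilate)

lemma dilate_uminus:
  assumes "\<And>v. v \<in> V \<Longrightarrow> - v \<in> V" "x \<in> dilate r V" shows "- x \<in> dilate r V"
  using assms by (force simp: mem_dilate)

text \<open>\<open>V\<close> may lie away from 0. With all \<open>r i = 1\<close> the sum of
  \<open>card I\<close> points of a convex set is \<open>card I\<close> times one point of it, which
  is how tile averages are merged. Nonemptiness serves the empty sum.\<close>

lemma convex_sum_mem_dilate:
  assumes "finite I" "convex V" "V \<noteq> {}" "\<And>i. i \<in> I \<Longrightarrow> 0 \<le> r i"
    "\<And>i. i \<in> I \<Longrightarrow> x i \<in> V"
  shows "(\<Sum>i\<in>I. r i *\<^sub>R x i) \<in> dilate (sum r I) V"
  using assms
proof (induction I rule: finite_induct)
  case empty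
  then show ?case by (auto simp: mem_dilate)
next
  case (insert i I)
  have "r i *\<^sub>R x i \<in> dilate (r i) V" using insert.prems by (auto simp: mem_dilate)
  then have "r i *\<^sub>R x i + (\<Sum>i\<in>I. r i *\<^sub>R x i) \<in> dilate (r i + sum r I) V"
    using insert by (intro dilate_add) (simp_all add: sum_nonneg)
  then show ?case using insert by simp
qed


section \<open>A Hahn--Banach theorem\<close>

definition sublinear_on :: "'y::real_vector set \<Rightarrow> ('y \<Rightarrow> real) \<Rightarrow> bool" where
  "sublinear_on E p \<longleftrightarrow>
     (\<forall>x\<in>E. \<forall>y\<in>E. p (x + y) \<le> p x + p y) \<and> (\<forall>t>0. \<forall>x\<in>E. p (t *\<^sub>R x) \<le> t * p x)"

lemma sublinear_on_add: "sublinear_on E p \<Longrightarrow> x \<in> E \<Longrightarrow> y \<in> E \<Longrightarrow> p (x + y) \<le> p x + p y"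
  by (simp add: sublinear_on_def)

lemma sublinear_on_scale:
  assumes "sublinear_on E p" "subspace E" "t > 0" "x \<in> E"
  shows "p (t *\<^sub>R x) = t * p x"
proof (rule antisym)
  show "p (t *\<^sub>R x) \<le> t * p x" using assms by (simp add: sublinear_on_def)
  have "p (inverse t *\<^sub>R (t *\<^sub>R x)) \<le> inverse t * p (t *\<^sub>R x)"
    using assms subspace_scale[of E x t] unfolding sublinear_on_def by (meson positive_imp_inverse_positive)
  then show "t * p x \<le> p (t *\<^sub>R x)" using assms by (simp add: field_simps)
qed

lemma sublinear_on_zero:
  assumes "sublinear_on E p" "subspace E" shows "p 0 = 0"
  using sublinear_on_scale[OF assms, of 2 0] subspace_0[OF assms(2)] by simp

lemma sublinear_on_lower:
  assumes "sublinear_on E p" "subspace E" "x \<in> E" shows "- p (- x) \<le> p x"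
  using sublinear_on_add[OF assms(1,3), of "- x"] sublinear_on_zero[OF assms(1,2)]
    subspace_neg[OF assms(2,3)] by simp

text \<open>Zorn's lemma for the pointwise order. The bound of a chain is its pointwise infimum,
  which is finite because \<open>- q (- x) \<le> - p (- x) \<le> p x\<close> for every sublinear
  \<open>p\<close> below \<open>q\<close>.\<close>

lemma sublinear_minorant_minimal:
  assumes E: "subspace E" and q: "sublinear_on E q"
  obtains p where "sublinear_on E p" "\<And>x. x \<in> E \<Longrightarrow> p x \<le> q x"
    "\<And>p' x. sublinear_on E p' \<Longrightarrow> (\<And>x. x \<in> E \<Longrightarrow> p' x \<le> p x) \<Longrightarrow> x \<in> E \<Longrightarrow> p' x = p x"
proof -
  \<comment> \<open>Members vanish off \<open>E\<close>: comparing functions on the whole type,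
    which gives antisymmetry, then amounts to comparing them on \<open>E\<close>.\<close>
  define A where "A = {p. sublinear_on E p \<and> (\<forall>x\<in>E. p x \<le> q x) \<and> (\<forall>x. x \<notin> E \<longrightarrow> p x = 0)}"
  define P where "P = (\<lambda>p p' :: 'a \<Rightarrow> real. \<forall>x. p' x \<le> p x)"
  have "\<exists>m\<in>A. \<forall>a\<in>A. P m a \<longrightarrow> a = m"
  proof (rule predicate_Zorn)
    show "partial_order_on A (relation_of P A)"
      unfolding P_def
    proof (intro partial_order_on_relation_ofI)
      fix a b c :: "'a \<Rightarrow> real"
      assume "\<forall>x. b x \<le> a x" "\<forall>x. c x \<le> b x"
      then show "\<forall>x. c x \<le> a x" by (meson order_trans)
    next
      fix a b :: "'a \<Rightarrow> real"
      assume "\<forall>x. b x \<le> a x" "\<forall>x. a x \<le> b x"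
      then show "a = b" by (meson ext antisym)
    qed simp
  next
    fix C assume C: "C \<in> Chains (relation_of P A)"
    have CA: "C \<subseteq> A" using C unfolding Chains_def relation_of_def by auto
    have tot: "P p p' \<or> P p' p" if "p \<in> C" "p' \<in> C" for p p'
      using C that unfolding Chains_def relation_of_def by auto
    show "\<exists>u\<in>A. \<forall>a\<in>C. P a u"
    proof (cases "C = {}")
      case True
      have "(\<lambda>x. if x \<in> E then q x else 0) \<in> A"
        using q E unfolding A_def sublinear_on_def by (simp add: subspace_add subspace_scale)
      then show ?thesis using True by auto
    next
      case False
      define u where "u = (\<lambda>x. INF p\<in>C. p x)"
      have bdd: "bdd_below ((\<lambda>p. p x) ` C)" for x
      proof (rule bdd_belowI2[of _ "if x \<in> E then - q (- x) else 0"])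
        fix p assume "p \<in> C"
        then have p: "sublinear_on E p" "\<forall>x\<in>E. p x \<le> q x" "\<forall>x. x \<notin> E \<longrightarrow> p x = 0"
          using CA by (auto simp: A_def)
        show "(if x \<in> E then - q (- x) else 0) \<le> p x"
          using sublinear_on_lower[OF p(1) E, of x] p(2,3) subspace_neg[OF E, of x] by fastforce
      qed
      have le: "u x \<le> p x" if "p \<in> C" for p x
        unfolding u_def using bdd that by (rule cINF_lower)
      have ge: "c \<le> u x" if "\<And>p. p \<in> C \<Longrightarrow> c \<le> p x" for c x
        unfolding u_def using False that by (rule cINF_greatest)
      have sub: "u (x + y) \<le> u x + u y" if xy: "x \<in> E" "y \<in> E" for x y
      proof -
        \<comment> \<open>The chain is total, so the smaller of the two functions serves at both
          points.\<close>
        have main: "u (x + y) \<le> p x + p' y" if pp: "p \<in> C" "p' \<in> C" for p p'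
        proof -
          obtain r where r: "r \<in> C" "r x \<le> p x" "r y \<le> p' y"
            using tot[OF pp] pp unfolding P_def by (metis order_refl)
          have "u (x + y) \<le> r (x + y)" by (rule le[OF r(1)])
          also have "\<dots> \<le> r x + r y" using r(1) CA xy by (auto simp: A_def intro: sublinear_on_add)
          finally show ?thesis using r by linarith
        qed
        have *: "u (x + y) - p x \<le> p' y" if "p \<in> C" "p' \<in> C" for p p'
          using main[OF that] by simp
        have **: "u (x + y) - p x \<le> u y" if "p \<in> C" for p
          by (rule ge) (rule *[OF that])
        have "u (x + y) - u y \<le> p x" if "p \<in> C" for p
          using **[OF that] by simp
        then have "u (x + y) - u y \<le> u x" by (rule ge)
        then show ?thesis by simp
      qed
      have sc: "u (t *\<^sub>R x) \<le> t * u x" if "t > 0" "x \<in> E" for t x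
      proof -
        have "u (t *\<^sub>R x) / t \<le> u x"
        proof (rule ge)
          fix p assume p: "p \<in> C"
          then have "sublinear_on E p" using CA by (auto simp: A_def)
          then have "p (t *\<^sub>R x) \<le> t * p x" using that by (simp add: sublinear_on_def)
          then show "u (t *\<^sub>R x) / t \<le> p x"
            using le[OF p, of "t *\<^sub>R x"] that by (simp add: field_simps)
        qed
        then show ?thesis using that by (simp add: field_simps)
      qed
      obtain p0 where p0: "p0 \<in> C" using False by auto
      have "u \<in> A"
        unfolding A_def
      proof (safe)
        show "sublinear_on E u" unfolding sublinear_on_def using sub sc by auto
        fix x
        show "u x \<le> q x" if "x \<in> E"
        proof -
          have "p0 \<in> A" using p0 CA by blast
          then have "p0 x \<le> q x" using that by (simp add: A_def)
          then show ?thesis using le[OF p0, of x] by simp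
        qed
        show "u x = 0" if "x \<notin> E"
        proof -
          have "p x = 0" if "p \<in> C" for p
          proof -
            have "p \<in> A" using that CA by blast
            then show ?thesis using \<open>x \<notin> E\<close> by (simp add: A_def)
          qed
          then have "u x = (INF p\<in>C. 0)" unfolding u_def by (intro INF_cong) auto
          then show ?thesis using False by simp
        qed
      qed
      then show ?thesis using le unfolding P_def by auto
    qed
  qed
  then obtain p where p: "p \<in> A" and min: "\<And>a. a \<in> A \<Longrightarrow> P p a \<Longrightarrow> a = p" by blast
  show ?thesis
  proof (rule that)
    show pe: "sublinear_on E p" "\<And>x. x \<in> E \<Longrightarrow> p x \<le> q x" using p by (auto simp: A_def)
    fix p' x
    assume p': "sublinear_on E p'" "\<And>x. x \<in> E \<Longrightarrow> p' x \<le> p x" and x: "x \<in> E"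
    define r where "r = (\<lambda>x. if x \<in> E then p' x else 0)"
    have "r \<in> A"
      unfolding A_def
    proof (safe)
      show "sublinear_on E r"
        using p'(1) E unfolding r_def sublinear_on_def by (simp add: subspace_add subspace_scale)
      show "r x \<le> q x" if "x \<in> E" for x
        using that p'(2)[OF that] pe(2)[OF that] by (simp add: r_def)
    qed (simp add: r_def)
    moreover have "P p r" using p'(2) p unfolding P_def r_def A_def by simp
    ultimately have "r = p" by (rule min)
    then have "r x = p x" by simp
    then show "p' x = p x" using x by (simp add: r_def)
  qed
qed

text \<open>A minimal sublinear functional is linear. For fixed x, the infimum over t \<ge> 0 of
  \<open>p (v + t *\<^sub>R x) - t * p x\<close> is sublinear in v and at most \<open>p v\<close>,
  hence equal to it, and its value at t = 1 gives superadditivity.\<close>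

lemma sublinear_linear_minorant:
  assumes E: "subspace E" and q: "sublinear_on E q"
  obtains u where "linear_between E UNIV u" "\<And>x. x \<in> E \<Longrightarrow> u x \<le> q x"
proof -
  obtain p where p: "sublinear_on E p" "\<And>x. x \<in> E \<Longrightarrow> p x \<le> q x"
    and min: "\<And>p' x. sublinear_on E p' \<Longrightarrow> (\<And>x. x \<in> E \<Longrightarrow> p' x \<le> p x) \<Longrightarrow> x \<in> E \<Longrightarrow> p' x = p x"
    using sublinear_minorant_minimal[OF E q] by blast
  note p0 = sublinear_on_zero[OF p(1) E]
  have super: "p v + p x \<le> p (v + x)" if x: "x \<in> E" and v: "v \<in> E" for x v
  proof -
    define r where "r = (\<lambda>v. INF t\<in>{0..}. p (v + t *\<^sub>R x) - t * p x)"
    have mem: "v + t *\<^sub>R x \<in> E" if "v \<in> E" for v t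
      using E that x by (simp add: subspace_add subspace_scale)
    have tx: "t * p x = p (t *\<^sub>R x)" if "t \<ge> 0" for t
      using sublinear_on_scale[OF p(1) E, of t x] that x p0 by (cases "t = 0") auto
    have bdd: "bdd_below ((\<lambda>t. p (v + t *\<^sub>R x) - t * p x) ` {0..})" if v: "v \<in> E" for v
    proof (rule bdd_belowI2[of _ "- p (- v)"])
      fix t :: real assume t: "t \<in> {0..}"
      have "p ((v + t *\<^sub>R x) + (- v)) \<le> p (v + t *\<^sub>R x) + p (- v)"
        by (rule sublinear_on_add[OF p(1) mem[OF v] subspace_neg[OF E v]])
      then show "- p (- v) \<le> p (v + t *\<^sub>R x) - t * p x" using tx[of t] t by simp
    qed
    have le: "r v \<le> p (v + t *\<^sub>R x) - t * p x" if "v \<in> E" "t \<ge> 0" for v t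
      unfolding r_def using that by (intro cINF_lower[OF bdd]) auto
    have ge: "c \<le> r v" if "\<And>t. t \<ge> 0 \<Longrightarrow> c \<le> p (v + t *\<^sub>R x) - t * p x" for c v
      unfolding r_def using that by (intro cINF_greatest) auto
    have "sublinear_on E r"
      unfolding sublinear_on_def
    proof (intro conjI ballI allI impI)
      fix v w assume vw: "v \<in> E" "w \<in> E"
      have "r (v + w) \<le> (p (v + t *\<^sub>R x) - t * p x) + (p (w + s *\<^sub>R x) - s * p x)"
        if "t \<ge> 0" "s \<ge> 0" for t s
      proof -
        have "r (v + w) \<le> p ((v + w) + (t + s) *\<^sub>R x) - (t + s) * p x"
          using vw that E by (intro le) (auto simp: subspace_add)
        also have "p ((v + w) + (t + s) *\<^sub>R x) = p ((v + t *\<^sub>R x) + (w + s *\<^sub>R x))"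
          by (simp add: algebra_simps)
        also have "\<dots> \<le> p (v + t *\<^sub>R x) + p (w + s *\<^sub>R x)"
          by (rule sublinear_on_add[OF p(1) mem mem]) (use vw in auto)
        finally show ?thesis by (simp add: algebra_simps)
      qed
      then have "r (v + w) - (p (v + t *\<^sub>R x) - t * p x) \<le> r w" if "t \<ge> 0" for t
        by (intro ge) (use that in \<open>force simp: algebra_simps\<close>)
      then have "r (v + w) - r w \<le> r v" by (intro ge) (force simp: algebra_simps)
      then show "r (v + w) \<le> r v + r w" by simp
    next
      fix t :: real and v assume t: "t > 0" and v: "v \<in> E"
      have "r (t *\<^sub>R v) / t \<le> r v"
      proof (rule ge)
        fix s :: real assume s: "s \<ge> 0"
        have "r (t *\<^sub>R v) \<le> p (t *\<^sub>R v + (t * s) *\<^sub>R x) - (t * s) * p x"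
          using t s v E by (intro le) (auto simp: subspace_scale)
        also have "t *\<^sub>R v + (t * s) *\<^sub>R x = t *\<^sub>R (v + s *\<^sub>R x)" by (simp add: algebra_simps)
        also have "p \<dots> = t * p (v + s *\<^sub>R x)"
          by (rule sublinear_on_scale[OF p(1) E t mem[OF v]])
        finally show "r (t *\<^sub>R v) / t \<le> p (v + s *\<^sub>R x) - s * p x"
          using t by (simp add: field_simps)
      qed
      then show "r (t *\<^sub>R v) \<le> t * r v" using t by (simp add: field_simps)
    qed
    moreover have "r w \<le> p w" if "w \<in> E" for w using le[OF that, of 0] by simp
    ultimately have "r v = p v" using v by (rule min)
    then show ?thesis using le[OF v, of 1] by simp
  qed
  have add: "p (v + x) = p v + p x" if "v \<in> E" "x \<in> E" for v x
    using super[OF that(2,1)] sublinear_on_add[OF p(1) that] by simp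
  have neg: "p (- x) = - p x" if "x \<in> E" for x
    using add[OF that subspace_neg[OF E that]] p0 by simp
  have "p (a *\<^sub>R x) = a *\<^sub>R p x" if x: "x \<in> E" for a x
  proof -
    consider "a = 0" | "a > 0" | "- a > 0" by linarith
    then show ?thesis
    proof cases
      case 3
      then have "p ((- a) *\<^sub>R x) = (- a) * p x" by (rule sublinear_on_scale[OF p(1) E _ x])
      then show ?thesis using neg[OF subspace_scale[OF E x, of a]] by simp
    qed (use p0 sublinear_on_scale[OF p(1) E _ x] in auto)
  qed
  then have "linear_between E UNIV p" unfolding linear_between_def using add by auto
  then show ?thesis using p(2) that by blast
qed

text \<open>
  A Mazur--Orlicz form of the theorem: \<open>H\<close> is a convex cone of constraints \<open>u z \<le> c\<close>, and
  the gauge of \<open>V\<close> is used without being named.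
\<close>

lemma Hahn_Banach_cone:
  fixes E V :: "'y::real_vector set" and H :: "('y \<times> real) set"
  assumes E: "subspace E" and V: "convex V" "0 \<in> V" "\<And>v. v \<in> V \<Longrightarrow> - v \<in> V"
    and absorbing: "\<And>x. x \<in> E \<Longrightarrow> \<exists>r\<ge>0. x \<in> dilate r V"
    and k: "k \<ge> 0"
    and H: "\<And>z c. (z, c) \<in> H \<Longrightarrow> z \<in> E" "(0, 0) \<in> H"
      "\<And>z c z' c'. (z, c) \<in> H \<Longrightarrow> (z', c') \<in> H \<Longrightarrow> (z + z', c + c') \<in> H"
      "\<And>z c t. (z, c) \<in> H \<Longrightarrow> t > 0 \<Longrightarrow> (t *\<^sub>R z, t * c) \<in> H"
    and compat: "\<And>z c r. (z, c) \<in> H \<Longrightarrow> r \<ge> 0 \<Longrightarrow> z \<in> dilate r V \<Longrightarrow> - (k * r) \<le> c"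
  obtains u where "linear_between E UNIV u" "\<And>v. v \<in> V \<Longrightarrow> v \<in> E \<Longrightarrow> \<bar>u v\<bar> \<le> k"
    "\<And>z c. (z, c) \<in> H \<Longrightarrow> u z \<le> c"
proof -
  \<comment> \<open>The infimum of \<open>Q v\<close> is the infimal convolution of the constraints
    in \<open>H\<close> with k times the gauge of \<open>V\<close>. A linear minorant obeys both
    kinds of bound: r = 0 yields the constraints, z = 0 the bound on \<open>V\<close>.\<close>
  define Q where "Q = (\<lambda>v. {c + k * r | z c r. (z, c) \<in> H \<and> 0 \<le> r \<and> v - z \<in> dilate r V})"
  define q where "q = (\<lambda>v. Inf (Q v))"
  have ne: "Q v \<noteq> {}" if v: "v \<in> E" for v
  proof -
    obtain r where "r \<ge> 0" "v \<in> dilate r V" using absorbing[OF v] by blast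
    then show ?thesis using H(2) unfolding Q_def by force
  qed
  have bdd: "bdd_below (Q v)" if v: "v \<in> E" for v
  proof -
    obtain r0 where r0: "r0 \<ge> 0" "v \<in> dilate r0 V" using absorbing[OF v] by blast
    show ?thesis
    proof (rule bdd_belowI[of _ "- (k * r0)"])
      fix a assume "a \<in> Q v"
      then obtain z c r where a: "a = c + k * r" "(z, c) \<in> H" "0 \<le> r" "v - z \<in> dilate r V"
        unfolding Q_def by blast
      \<comment> \<open>This sum is z itself, so \<open>compat\<close> bounds c from below,
        uniformly over all decompositions of v. Symmetry of \<open>V\<close> enters here.\<close>
      have "v + - (v - z) \<in> dilate (r0 + r) V"
        using r0 a V(1) dilate_uminus[OF V(3) a(4)] by (intro dilate_add) auto
      then have "- (k * (r0 + r)) \<le> c" using a r0 by (intro compat[of z]) auto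
      then show "- (k * r0) \<le> a" using a by (simp add: algebra_simps)
    qed
  qed
  have le: "q v \<le> a" if "v \<in> E" "a \<in> Q v" for v a
    unfolding q_def using bdd that by (intro cInf_lower) auto
  have ge: "b \<le> q v" if "v \<in> E" "\<And>a. a \<in> Q v \<Longrightarrow> b \<le> a" for v b
    unfolding q_def using ne that by (intro cInf_greatest) auto
  have Qadd: "a + b \<in> Q (v + w)" if ab: "a \<in> Q v" "b \<in> Q w" for a b v w
  proof -
    obtain z c r where a: "a = c + k * r" "(z, c) \<in> H" "0 \<le> r" "v - z \<in> dilate r V"
      using ab unfolding Q_def by blast
    obtain z' c' r' where b: "b = c' + k * r'" "(z', c') \<in> H" "0 \<le> r'" "w - z' \<in> dilate r' V"
      using ab unfolding Q_def by blast
    have "(v - z) + (w - z') \<in> dilate (r + r') V" using a b V by (intro dilate_add) auto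
    then have "(v + w) - (z + z') \<in> dilate (r + r') V" by (simp add: algebra_simps)
    moreover have "a + b = (c + c') + k * (r + r')" using a b by (simp add: algebra_simps)
    moreover have "0 \<le> r + r'" using a b by simp
    ultimately show ?thesis unfolding Q_def using H(3)[OF a(2) b(2)] by blast
  qed
  have Qsc: "t * a \<in> Q (t *\<^sub>R v)" if t: "t > 0" and a: "a \<in> Q v" for t a v
  proof -
    obtain z c r where a: "a = c + k * r" "(z, c) \<in> H" "0 \<le> r" "v - z \<in> dilate r V"
      using a unfolding Q_def by blast
    have "t *\<^sub>R v - t *\<^sub>R z \<in> dilate (t * r) V"
      using scaleR_mem_dilate[OF a(4), of t] by (simp add: scaleR_diff_right)
    moreover have "t * a = t * c + k * (t * r)" using a by (simp add: algebra_simps)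
    moreover have "0 \<le> t * r" using a t by simp
    ultimately show ?thesis unfolding Q_def using H(4)[OF a(2) t] by blast
  qed
  have "sublinear_on E q"
    unfolding sublinear_on_def
  proof (intro conjI ballI allI impI)
    fix v w assume vw: "v \<in> E" "w \<in> E"
    have "q (v + w) \<le> a + b" if "a \<in> Q v" "b \<in> Q w" for a b
      using le[OF subspace_add[OF E vw]] Qadd[OF that] by blast
    then have "q (v + w) - a \<le> q w" if "a \<in> Q v" for a
      by (intro ge[OF vw(2)]) (use that in \<open>force simp: algebra_simps\<close>)
    then have "q (v + w) - q w \<le> q v" by (intro ge[OF vw(1)]) (force simp: algebra_simps)
    then show "q (v + w) \<le> q v + q w" by simp
  next
    fix t :: real and v assume t: "t > 0" and v: "v \<in> E"
    have "q (t *\<^sub>R v) / t \<le> q v"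
    proof (rule ge[OF v])
      fix a assume "a \<in> Q v"
      then have "q (t *\<^sub>R v) \<le> t * a" using le[OF subspace_scale[OF E v]] Qsc[OF t] by blast
      then show "q (t *\<^sub>R v) / t \<le> a" using t by (simp add: field_simps)
    qed
    then show "q (t *\<^sub>R v) \<le> t * q v" using t by (simp add: field_simps)
  qed
  then obtain u where u: "linear_between E UNIV u" "\<And>x. x \<in> E \<Longrightarrow> u x \<le> q x"
    using sublinear_linear_minorant[OF E] by blast
  show ?thesis
  proof (rule that[OF u(1)])
    fix z c assume zc: "(z, c) \<in> H"
    have "c \<in> Q z" unfolding Q_def using zc V(2) by (force simp: zero_mem_dilate)
    then show "u z \<le> c" using u(2) le H(1)[OF zc] by force
  next
    fix v assume v: "v \<in> V" "v \<in> E"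
    have up: "u w \<le> k" if "w \<in> V" "w \<in> E" for w
    proof -
      have "k \<in> Q w" unfolding Q_def using H(2) that by force
      then show ?thesis using u(2) le that by force
    qed
    have "u ((-1) *\<^sub>R v) = (-1) *\<^sub>R u v" using u(1) v unfolding linear_between_def by blast
    then show "\<bar>u v\<bar> \<le> k" using up[OF v] up[of "- v"] V(3) v E by (auto simp: subspace_neg)
  qed
qed

section \<open>Frechet topologies\<close>

locale frechet_topology =
  fixes T :: "'y::real_vector topology"
  assumes frechet_space: "frechet_space T"
begin

lemma subspace_topspace: "subspace (topspace T)"
  using frechet_space by (simp add: frechet_space_def)

lemmas zero_in = subspace_0[OF subspace_topspace]
lemmas add_in = subspace_add[OF subspace_topspace]
lemmas scale_in = subspace_scale[OF subspace_topspace]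
lemmas diff_in = subspace_diff[OF subspace_topspace]
lemmas neg_in = subspace_neg[OF subspace_topspace]
lemmas sum_in = subspace_sum[OF subspace_topspace]

lemma add_continuous:
  assumes "continuous_map X T f" "continuous_map X T g"
  shows "continuous_map X T (\<lambda>x. f x + g x)"
proof -
  have "continuous_map X (prod_topology T T) (\<lambda>x. (f x, g x))"
    using assms by (simp add: continuous_map_paired)
  moreover have "continuous_map (prod_topology T T) T (\<lambda>(x, y). x + y)"
    using frechet_space by (simp add: frechet_space_def)
  ultimately have "continuous_map X T ((\<lambda>(x, y). x + y) \<circ> (\<lambda>x. (f x, g x)))"
    by (rule continuous_map_compose)
  then show ?thesis by (simp add: o_def)
qed

lemma scale_continuous:
  assumes "continuous_map X euclideanreal a" "continuous_map X T f"
  shows "continuous_map X T (\<lambda>x. a x *\<^sub>R f x)"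
proof -
  have "continuous_map X (prod_topology euclideanreal T) (\<lambda>x. (a x, f x))"
    using assms by (simp add: continuous_map_paired)
  moreover have "continuous_map (prod_topology euclideanreal T) T (\<lambda>(a, x). a *\<^sub>R x)"
    using frechet_space by (simp add: frechet_space_def)
  ultimately have "continuous_map X T ((\<lambda>(a, x). a *\<^sub>R x) \<circ> (\<lambda>x. (a x, f x)))"
    by (rule continuous_map_compose)
  then show ?thesis by (simp add: o_def)
qed

lemma sum_continuous:
  assumes "finite I" "\<And>i. i \<in> I \<Longrightarrow> continuous_map X T (f i)"
  shows "continuous_map X T (\<lambda>x. \<Sum>i\<in>I. f i x)"
  using assms
  by (induction I rule: finite_induct) (auto intro!: add_continuous simp: zero_in)

lemma openin_affine_preimage:
  assumes "openin T U" "b \<in> topspace T"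
  shows "openin T {y \<in> topspace T. a *\<^sub>R y + b \<in> U}"
proof -
  have "continuous_map T T (\<lambda>y. a *\<^sub>R y + b)"
    using assms by (intro add_continuous scale_continuous) auto
  then show ?thesis using assms(1) by (rule openin_continuous_map_preimage)
qed

lemma openin_translation_eq:
  assumes "U \<subseteq> topspace T" "x \<in> topspace T"
  shows "(+) x ` U = {y \<in> topspace T. y - x \<in> U}"
proof (safe)
  fix y assume "y \<in> topspace T" "y - x \<in> U"
  then show "y \<in> (+) x ` U" by (intro image_eqI[of _ _ "y - x"]) auto
qed (use assms in \<open>auto intro: add_in\<close>)

lemma openin_translation:
  assumes "openin T U" "x \<in> topspace T"
  shows "openin T ((+) x ` U)"
  using openin_affine_preimage[OF assms(1), of "- x" 1] assms openin_subset[OF assms(1)]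
  by (simp add: openin_translation_eq neg_in)

lemma openin_dilate:
  assumes U: "openin T U" and t: "t \<noteq> 0"
  shows "openin T (dilate t U)"
proof -
  have "dilate t U = {y \<in> topspace T. (1 / t) *\<^sub>R y + 0 \<in> U}"
  proof (safe)
    fix y assume "y \<in> dilate t U"
    then obtain v where v: "v \<in> U" "y = t *\<^sub>R v" by (auto simp: mem_dilate)
    then show "y \<in> topspace T" using openin_subset[OF U] scale_in by blast
    show "(1 / t) *\<^sub>R y + 0 \<in> U" using v t by simp
  next
    fix y assume "(1 / t) *\<^sub>R y + 0 \<in> U"
    then show "y \<in> dilate t U" using t by (auto simp: mem_dilate intro!: bexI[of _ "(1/t) *\<^sub>R y"])
  qed
  then show ?thesis using openin_affine_preimage[OF U zero_in, of "1 / t"] by simp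
qed

lemma small_multiple:
  assumes U: "openin T U" "0 \<in> U" and x: "x \<in> topspace T"
  obtains e where "e > 0" "\<And>a. \<bar>a\<bar> \<le> e \<Longrightarrow> a *\<^sub>R x \<in> U"
proof -
  have "continuous_map euclideanreal T (\<lambda>a. a *\<^sub>R x)"
    by (intro scale_continuous) (use x in auto)
  then have "openin euclideanreal {a \<in> topspace euclideanreal. a *\<^sub>R x \<in> U}"
    using U(1) by (rule openin_continuous_map_preimage)
  then have "open {a. a *\<^sub>R x \<in> U}" by simp
  moreover have "0 \<in> {a. a *\<^sub>R x \<in> U}" using U by simp
  ultimately obtain e where e: "e > 0" "ball 0 e \<subseteq> {a. a *\<^sub>R x \<in> U}"
    using openE by blast
  have "a *\<^sub>R x \<in> U" if "\<bar>a\<bar> \<le> e / 2" for a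
  proof -
    have "a \<in> ball 0 e" using that e(1) by (simp add: dist_real_def)
    then show ?thesis using e(2) by blast
  qed
  then show ?thesis using that[of "e / 2"] e(1) by auto
qed

lemma absorbing:
  assumes U: "openin T U" "0 \<in> U" and x: "x \<in> topspace T"
  shows "\<exists>r\<ge>0. x \<in> dilate r U"
proof -
  obtain e where e: "e > 0" "\<And>a. \<bar>a\<bar> \<le> e \<Longrightarrow> a *\<^sub>R x \<in> U" using small_multiple[OF assms] by blast
  have "x = (1 / e) *\<^sub>R (e *\<^sub>R x)" using e(1) by simp
  moreover have "e *\<^sub>R x \<in> U" using e by simp
  ultimately have "x \<in> dilate (1 / e) U" unfolding mem_dilate by blast
  then show ?thesis using e(1) by (intro exI[of _ "1 / e"]) auto
qed

lemma symmetric_nbhd: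
  assumes U: "openin T U" "x \<in> U"
  obtains V where "openin T V" "convex V" "0 \<in> V" "\<And>v. v \<in> V \<Longrightarrow> - v \<in> V"
    "\<And>v. v \<in> V \<Longrightarrow> x + v \<in> U"
proof -
  have x: "x \<in> topspace T" using openin_subset[OF U(1)] U(2) by auto
  have "openin T {y \<in> topspace T. 1 *\<^sub>R y + x \<in> U}" using U(1) x by (rule openin_affine_preimage)
  moreover have "0 \<in> {y \<in> topspace T. 1 *\<^sub>R y + x \<in> U}" using U zero_in by simp
  ultimately obtain V where V: "openin T V" "convex V" "0 \<in> V" "V \<subseteq> {y \<in> topspace T. 1 *\<^sub>R y + x \<in> U}"
    using frechet_space unfolding frechet_space_def by blast
  have "openin T (dilate (-1) V)" by (rule openin_dilate[OF V(1)]) simp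
  moreover have "convex (dilate (-1) V)" by (rule convex_dilate[OF V(2)])
  ultimately show ?thesis
    using V by (intro that[of "V \<inter> dilate (-1) V"])
      (auto intro: openin_Int convex_Int zero_mem_dilate simp: mem_dilate add.commute)
qed

lemma complete_metric:
  obtains \<rho> where "Metric_space (topspace T) \<rho>" "Metric_space.mcomplete (topspace T) \<rho>"
    "Metric_space.mtopology (topspace T) \<rho> = T"
    "\<And>x y z. x \<in> topspace T \<Longrightarrow> y \<in> topspace T \<Longrightarrow> z \<in> topspace T \<Longrightarrow> \<rho> (x + z) (y + z) = \<rho> x y"
  using frechet_space unfolding frechet_space_def by blast

text \<open>Completeness in a form from which the metric has disappeared. The link, a common point
  of \<open>z k + 2 W k\<close> and \<open>z (Suc k) + W (Suc k)\<close>, is what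
  \<open>concentration_step\<close> delivers. Whole neighbourhoods, and not only their centres,
  shrink to the limit.\<close>

lemma shrinking_nbhds:
  obtains W :: "nat \<Rightarrow> 'y set" where
    "\<And>k. openin T (W k)" "\<And>k. convex (W k)" "\<And>k. 0 \<in> W k" "\<And>k v. v \<in> W k \<Longrightarrow> - v \<in> W k"
    "\<forall>z. (\<forall>k. z k \<in> topspace T) \<longrightarrow>
       (\<forall>k. \<exists>y. y - z k \<in> dilate 2 (W k) \<and> y - z (Suc k) \<in> W (Suc k)) \<longrightarrow>
       (\<exists>x\<in>topspace T. \<forall>U. openin T U \<and> x \<in> U \<longrightarrow> (\<exists>k0. \<forall>k\<ge>k0. (+) (z k) ` W k \<subseteq> U))"
proof -
  obtain \<rho> where ms: "Metric_space (topspace T) \<rho>"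
    and complete: "Metric_space.mcomplete (topspace T) \<rho>"
    and top: "Metric_space.mtopology (topspace T) \<rho> = T"
    and inv: "\<And>x y z. x \<in> topspace T \<Longrightarrow> y \<in> topspace T \<Longrightarrow> z \<in> topspace T \<Longrightarrow> \<rho> (x + z) (y + z) = \<rho> x y"
    using complete_metric by blast
  interpret Metric_space "topspace T" \<rho> by (rule ms)
  have inv': "\<rho> x y = \<rho> (x - y) 0" if "x \<in> topspace T" "y \<in> topspace T" for x y
    using inv[of "x - y" 0 y] that by (simp add: diff_in zero_in)
  have "\<exists>V. openin T V \<and> convex V \<and> 0 \<in> V \<and> (\<forall>v\<in>V. - v \<in> V) \<and> (\<forall>v\<in>V. \<rho> v 0 < (1/2)^k)" for k
  proof -
    have o: "openin T (mball 0 ((1/2)^k))" using openin_mball[of 0 "(1/2)^k"] by (simp add: top)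
    have z: "0 \<in> mball 0 ((1/2)^k)" using zero_in by simp
    obtain V where "openin T V" "convex V" "0 \<in> V" "\<And>v. v \<in> V \<Longrightarrow> - v \<in> V"
      "\<And>v. v \<in> V \<Longrightarrow> 0 + v \<in> mball 0 ((1/2)^k)" using symmetric_nbhd[OF o z] by blast
    then show ?thesis by (intro exI[of _ V]) (auto simp: commute)
  qed
  then obtain W where W: "\<And>k. openin T (W k)" "\<And>k. convex (W k)" "\<And>k. 0 \<in> W k"
    "\<And>k v. v \<in> W k \<Longrightarrow> - v \<in> W k" "\<And>k v. v \<in> W k \<Longrightarrow> \<rho> v 0 < (1/2)^k" by metis
  have Wt: "v \<in> topspace T" if "v \<in> W k" for v k using openin_subset[OF W(1)] that by blast
  have conv: "\<exists>x\<in>topspace T. \<forall>U. openin T U \<and> x \<in> U \<longrightarrow> (\<exists>k0. \<forall>k\<ge>k0. (+) (z k) ` W k \<subseteq> U)"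
    if z: "\<And>k. z k \<in> topspace T"
      and link: "\<And>k. \<exists>y. y - z k \<in> dilate 2 (W k) \<and> y - z (Suc k) \<in> W (Suc k)" for z
  proof -
    \<comment> \<open>Two parts of the constant 3 come from the dilation by 2, and one from
      \<open>W (Suc k)\<close>.\<close>
    have step: "\<rho> (z k) (z (Suc k)) \<le> 3 * (1/2)^k" for k
    proof -
      obtain y where y: "y - z k \<in> dilate 2 (W k)" "y - z (Suc k) \<in> W (Suc k)" using link by blast
      obtain w where w: "w \<in> W k" "y - z k = 2 *\<^sub>R w" using y(1) by (auto simp: mem_dilate)
      have yt: "y \<in> topspace T"
        using add_in[OF Wt[OF y(2)] z[of "Suc k"]] by simp
      \<comment> \<open>The metric need not be homogeneous, but translation invariance still implies
        that doubling w at most doubles its distance to 0.\<close>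
      have "\<rho> (2 *\<^sub>R w) 0 \<le> \<rho> (2 *\<^sub>R w) w + \<rho> w 0"
        using Wt[OF w(1)] by (intro triangle) (auto simp: zero_in scale_in)
      also have "\<rho> (2 *\<^sub>R w) w = \<rho> w 0"
        using inv'[OF scale_in[OF Wt[OF w(1)], of 2] Wt[OF w(1)]] by (simp add: scaleR_2)
      finally have "\<rho> y (z k) \<le> 2 * (1/2)^k" using W(5)[OF w(1)] inv'[OF yt z] w by simp
      moreover have "\<rho> y (z (Suc k)) \<le> (1/2)^k"
      proof -
        have "\<rho> y (z (Suc k)) \<le> (1/2)^Suc k"
          using W(5)[OF y(2)] inv'[OF yt z[of "Suc k"]] by simp
        also have "\<dots> \<le> (1/2)^k" by simp
        finally show ?thesis .
      qed
      moreover have "\<rho> (z k) (z (Suc k)) \<le> \<rho> y (z k) + \<rho> y (z (Suc k))"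
        using triangle''[OF z yt z] by simp
      ultimately show ?thesis by simp
    qed
    \<comment> \<open>The sum of the steps \<open>3 * (1/2) ^ i\<close> in closed form, with the
      subtracted term kept so that the induction closes.\<close>
    have tele: "\<rho> (z k) (z (k + j)) \<le> 6 * ((1/2)^k - (1/2)^(k+j))" for k j
    proof (induction j)
      case 0
      then show ?case using z by simp
    next
      case (Suc j)
      have "\<rho> (z k) (z (k + Suc j)) \<le> \<rho> (z k) (z (k + j)) + \<rho> (z (k + j)) (z (Suc (k + j)))"
        using triangle[OF z z z] by simp
      then show ?case using Suc step[of "k + j"] by (simp add: algebra_simps)
    qed
    have "MCauchy z"
      unfolding MCauchy_def
    proof (intro conjI allI impI)
      show "range z \<subseteq> topspace T" using z by auto
      fix \<epsilon> :: real assume e: "\<epsilon> > 0"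
      obtain N where N: "(1/2::real)^N < \<epsilon> / 6"
        using real_arch_pow_inv[of "\<epsilon> / 6" "1/2"] e by auto
      have le: "\<rho> (z n) (z n') < \<epsilon>" if "N \<le> n" "n \<le> n'" for n n'
      proof -
        have "\<rho> (z n) (z n') \<le> 6 * (1/2)^n"
        proof -
          have "\<rho> (z n) (z n') \<le> 6 * ((1/2)^n - (1/2)^n')" using tele[of n "n' - n"] that by simp
          moreover have "(0::real) \<le> (1/2)^n'" by (rule zero_le_power) simp
          moreover have "\<And>x a b :: real. x \<le> 6 * (a - b) \<Longrightarrow> 0 \<le> b \<Longrightarrow> x \<le> 6 * a" by simp
          ultimately show ?thesis by blast
        qed
        also have "(1/2::real)^n \<le> (1/2)^N" using that by (intro power_decreasing) auto
        finally show ?thesis using N by simp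
      qed
      show "\<exists>N. \<forall>n n'. N \<le> n \<longrightarrow> N \<le> n' \<longrightarrow> \<rho> (z n) (z n') < \<epsilon>"
        using le by (intro exI[of _ N]) (metis commute nle_le)
    qed
    then obtain x where "limitin T z x sequentially"
      using complete unfolding mcomplete_def top by blast
    then have x: "x \<in> topspace T" "\<And>e. e > 0 \<Longrightarrow> eventually (\<lambda>k. \<rho> (z k) x < e) sequentially"
      using limitin_metric[of z x sequentially] unfolding top by (auto elim: eventually_mono)
    show ?thesis
    proof (intro bexI[OF _ x(1)] allI impI)
      fix U assume U: "openin T U \<and> x \<in> U"
      then have "openin mtopology U" by (simp add: top)
      then obtain r where r: "r > 0" "mball x r \<subseteq> U" using U unfolding openin_mtopology by blast
      have "eventually (\<lambda>k. (1/2::real)^k < r / 2) sequentially"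
        using r(1) by (intro order_tendstoD[OF LIMSEQ_realpow_zero]) auto
      moreover have "eventually (\<lambda>k. \<rho> (z k) x < r / 2) sequentially" using r(1) by (intro x(2)) simp
      ultimately have "eventually (\<lambda>k. (+) (z k) ` W k \<subseteq> U) sequentially"
      proof (eventually_elim)
        case e: (elim k)
        show ?case
        proof
          fix y assume "y \<in> (+) (z k) ` W k"
          then obtain w where w: "w \<in> W k" "y = z k + w" by auto
          have yt: "y \<in> topspace T" using w z Wt add_in by blast
          have "\<rho> x y \<le> \<rho> (z k) x + \<rho> y (z k)" using triangle[OF x(1) z[of k] yt] by (simp add: commute)
          also have "\<rho> y (z k) < r / 2" using inv'[OF yt z[of k]] W(5)[OF w(1)] w e by simp
          also have "\<rho> (z k) x < r / 2" using e by simp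
          finally have "y \<in> mball x r" using yt x(1) by simp
          then show "y \<in> U" using r by blast
        qed
      qed
      then show "\<exists>k0. \<forall>k\<ge>k0. (+) (z k) ` W k \<subseteq> U" by (simp add: eventually_sequentially)
    qed
  qed
  show ?thesis
    by (rule that[of W]; (intro allI impI)?) (simp_all add: W conv)
qed

lemma continuous_linear_functionalI:
  assumes u: "linear_between (topspace T) UNIV u"
    and V: "openin T V" "0 \<in> V" "\<And>v. v \<in> V \<Longrightarrow> \<bar>u v\<bar> \<le> k"
  shows "continuous_map T euclideanreal u"
  unfolding continuous_map_def
proof (intro conjI allI impI)
  show "u \<in> topspace T \<rightarrow> topspace euclideanreal" by simp
  fix U :: "real set" assume "openin euclideanreal U"
  then have U: "open U" by simp
  show "openin T {x \<in> topspace T. u x \<in> U}"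
  proof (subst openin_subopen, intro ballI)
    fix x assume x: "x \<in> {x \<in> topspace T. u x \<in> U}"
    then obtain e where e: "e > 0" "ball (u x) e \<subseteq> U" using U openE by blast
    define t where "t = e / (\<bar>k\<bar> + 1)"
    have t: "t > 0" using e(1) by (simp add: t_def)
    have tk: "t * \<bar>k\<bar> < e" using e(1) by (simp add: t_def field_simps)
    show "\<exists>N. openin T N \<and> x \<in> N \<and> N \<subseteq> {x \<in> topspace T. u x \<in> U}"
    proof (intro exI conjI)
      show "openin T ((+) x ` dilate t V)"
        using x t by (intro openin_translation openin_dilate V(1)) auto
      show "x \<in> (+) x ` dilate t V"
        using zero_mem_dilate[OF V(2), of t] by (intro image_eqI[of _ _ 0]) auto
      show "(+) x ` dilate t V \<subseteq> {x \<in> topspace T. u x \<in> U}"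
      proof
        fix y assume "y \<in> (+) x ` dilate t V"
        then obtain v where v: "v \<in> V" "y = x + t *\<^sub>R v" by (auto simp: mem_dilate)
        have vt: "v \<in> topspace T" using v(1) openin_subset[OF V(1)] by auto
        have "u y = u x + t * u v"
          using u x vt scale_in[OF vt] unfolding linear_between_def v(2) by simp
        moreover have "\<bar>t * u v\<bar> \<le> t * \<bar>k\<bar>"
          using V(3)[OF v(1)] t by (simp add: abs_mult)
        ultimately have "u y \<in> ball (u x) e" using tk by (simp add: dist_real_def)
        then show "y \<in> {x \<in> topspace T. u x \<in> U}"
          using e(2) x vt v(2) by (auto intro: add_in scale_in)
      qed
    qed
  qed
qed

end

section \<open>Second countability and measurability of open events\<close>

lemma (in Metric_space) separable_imp_second_countable:
  assumes "separable_space mtopology" shows "second_countable mtopology"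
proof -
  obtain D where D: "countable D" "D \<subseteq> M" "mtopology closure_of D = M"
    using assms unfolding separable_space_def topspace_mtopology by blast
  define \<B> where "\<B> = (\<lambda>(d, n). mball d (1 / real (Suc n))) ` (D \<times> (UNIV :: nat set))"
  have base: "\<exists>V\<in>\<B>. x \<in> V \<and> V \<subseteq> U" if U: "openin mtopology U" and x: "x \<in> U" for U x
  proof -
    obtain r where r: "r > 0" "mball x r \<subseteq> U" using U x unfolding openin_mtopology by meson
    obtain n where n: "1 / real (Suc n) < r / 2" by (rule nat_approx_posE[of "r/2"]) (use r(1) in auto)
    have xM: "x \<in> M" using openin_subset[OF U] x by auto
    then have "x \<in> mtopology closure_of D" using D by simp
    moreover have "x \<in> mball x (1 / real (Suc n))" using xM by simp
    ultimately have "\<exists>w. w \<in> D \<and> w \<in> mball x (1 / real (Suc n))"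
      using openin_mball[of x "1 / real (Suc n)"] unfolding in_closure_of by fast
    then obtain w where d: "w \<in> D" "w \<in> mball x (1 / real (Suc n))" by fast
    have dx: "d w x < 1 / real (Suc n)" "w \<in> M" using d(2) by (simp_all add: commute)
    then have "d w x + 1 / real (Suc n) \<le> r" using n by linarith
    then have "mball w (1 / real (Suc n)) \<subseteq> mball x r" using xM by (rule mball_subset)
    then have "mball w (1 / real (Suc n)) \<subseteq> U" using r(2) by (rule subset_trans)
    moreover have "x \<in> mball w (1 / real (Suc n))" using dx xM by simp
    moreover have "mball w (1 / real (Suc n)) \<in> \<B>"
      unfolding \<B>_def using d(1) by (intro image_eqI[of _ _ "(w, n)"]) auto
    ultimately show ?thesis by blast
  qed
  moreover have "countable \<B>" unfolding \<B>_def using D(1) by auto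
  moreover have "\<forall>V\<in>\<B>. openin mtopology V" unfolding \<B>_def by auto
  ultimately show ?thesis
    unfolding second_countable_def using base by (intro exI[of _ \<B>]) simp
qed

lemma (in frechet_topology) second_countable:
  assumes "separable_space T" shows "second_countable T"
  by (metis assms complete_metric Metric_space.separable_imp_second_countable)

lemma space_borel_of [simp]: "space (borel_of T) = topspace T"
  by (simp add: borel_of_def space_measure_of_conv)

lemma sets_borel_of: "sets (borel_of T) = sigma_sets (topspace T) {U. openin T U}"
  unfolding borel_of_def by (rule sets_measure_of) (auto dest: openin_subset)

lemma openin_imp_sets_borel_of: "openin T U \<Longrightarrow> U \<in> sets (borel_of T)"
  by (auto simp: sets_borel_of)

text \<open>Measurability is known coordinate by coordinate, whereas the events of interest are open
  in a product topology. A countable base of \<open>T\<close> makes such an open set a countable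
  union of open boxes, because a finite power of a countable base is countable.\<close>

lemma open_product_measurable:
  fixes T :: "'y topology"
  assumes T: "second_countable T" and S: "finite S"
    and \<eta>: "\<And>z. z \<in> S \<Longrightarrow> (\<lambda>\<omega>. \<eta> \<omega> z) \<in> measurable M (borel_of T)"
    and C: "openin (product_topology (\<lambda>_. T) S) C"
  shows "{\<omega>\<in>space M. restrict (\<eta> \<omega>) S \<in> C} \<in> sets M"
proof -
  obtain \<B> where \<B>: "countable \<B>" "\<And>V. V \<in> \<B> \<Longrightarrow> openin T V"
    and base: "\<And>U x. openin T U \<Longrightarrow> x \<in> U \<Longrightarrow> \<exists>V\<in>\<B>. x \<in> V \<and> V \<subseteq> U"
    using T unfolding second_countable_def by metis
  define R where "R = {V \<in> S \<rightarrow>\<^sub>E \<B>. Pi\<^sub>E S V \<subseteq> C}"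
  have "countable (S \<rightarrow>\<^sub>E \<B>)" by (rule countable_PiE[OF S \<B>(1)])
  moreover have "R \<subseteq> S \<rightarrow>\<^sub>E \<B>" unfolding R_def by (rule Collect_subset)
  ultimately have R: "countable R" by (rule countable_subset[rotated])
  have "\<exists>V\<in>R. \<xi> \<in> Pi\<^sub>E S V" if \<xi>: "\<xi> \<in> C" for \<xi>
  proof -
    obtain U where U: "\<And>z. z \<in> S \<Longrightarrow> openin T (U z)" "\<xi> \<in> Pi\<^sub>E S U" "Pi\<^sub>E S U \<subseteq> C"
      using C \<xi> unfolding openin_product_topology_alt by meson
    have "\<exists>V\<in>\<B>. \<xi> z \<in> V \<and> V \<subseteq> U z" if "z \<in> S" for z
      by (rule base[OF U(1)[OF that]]) (use U(2) that in \<open>simp add: PiE_iff\<close>)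
    then obtain V where V: "\<And>z. z \<in> S \<Longrightarrow> V z \<in> \<B> \<and> \<xi> z \<in> V z \<and> V z \<subseteq> U z" by metis
    have "Pi\<^sub>E S (restrict V S) \<subseteq> Pi\<^sub>E S U" using V by (intro PiE_mono) simp
    then have "Pi\<^sub>E S (restrict V S) \<subseteq> C" using U(3) by (rule subset_trans)
    moreover have "restrict V S \<in> S \<rightarrow>\<^sub>E \<B>" using V by simp
    ultimately have "restrict V S \<in> R" unfolding R_def by simp
    moreover have "\<xi> \<in> Pi\<^sub>E S (restrict V S)" using V U(2) by (simp add: PiE_iff)
    ultimately show ?thesis by blast
  qed
  then have CR: "\<xi> \<in> C \<longleftrightarrow> (\<exists>V\<in>R. \<xi> \<in> Pi\<^sub>E S V)" for \<xi> unfolding R_def by blast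
  have "restrict (\<eta> \<omega>) S \<in> Pi\<^sub>E S V \<longleftrightarrow> (\<forall>z\<in>S. \<eta> \<omega> z \<in> V z)" for \<omega> V
    by (simp add: PiE_iff)
  then have "{\<omega>\<in>space M. restrict (\<eta> \<omega>) S \<in> C} = (\<Union>V\<in>R. {\<omega>\<in>space M. \<forall>z\<in>S. \<eta> \<omega> z \<in> V z})"
    unfolding CR by blast
  also have "\<dots> \<in> sets M"
  proof (rule sets.countable_UN''[OF R])
    fix V assume V: "V \<in> R"
    have "{\<omega> \<in> space M. \<eta> \<omega> z \<in> V z} \<in> sets M" if z: "z \<in> S" for z
    proof -
      have "V z \<in> sets (borel_of T)"
        using \<B>(2) V z by (intro openin_imp_sets_borel_of) (auto simp: R_def PiE_iff)
      then show ?thesis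
        using measurable_sets[OF \<eta>[OF z]] by (simp add: vimage_def Int_def conj_commute)
    qed
    then show "{\<omega> \<in> space M. \<forall>z\<in>S. \<eta> \<omega> z \<in> V z} \<in> sets M"
      by (rule sets.sets_Collect_finite_All[OF _ S])
  qed
  finally show ?thesis .
qed


section \<open>Convex open sets of finite configurations\<close>

context frechet_topology
begin

lemma convex_open_power_subset:
  assumes "C \<in> convex_open_power T S" "\<xi> \<in> C" shows "\<xi> \<in> S \<rightarrow>\<^sub>E topspace T"
  using assms openin_subset unfolding convex_open_power_def by fastforce

lemma convex_open_power_Int:
  assumes "C \<in> convex_open_power T S" "D \<in> convex_open_power T S"
  shows "C \<inter> D \<in> convex_open_power T S"
  using assms by (auto simp: convex_open_power_def)

lemma openin_power_sum:
  assumes A: "openin T A" and S: "finite S" "S' \<subseteq> S"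
  shows "openin (product_topology (\<lambda>_. T) S) {\<xi> \<in> S \<rightarrow>\<^sub>E topspace T. r *\<^sub>R (\<Sum>z\<in>S'. \<xi> z) \<in> A}"
proof -
  have S': "finite S'" using S finite_subset by blast
  have "continuous_map (product_topology (\<lambda>_. T) S) T (\<lambda>\<xi>. r *\<^sub>R (\<Sum>z\<in>S'. \<xi> z))"
    using S S' by (intro scale_continuous sum_continuous continuous_map_product_projection) auto
  then have "openin (product_topology (\<lambda>_. T) S)
      {\<xi> \<in> topspace (product_topology (\<lambda>_. T) S). r *\<^sub>R (\<Sum>z\<in>S'. \<xi> z) \<in> A}"
    using A by (rule openin_continuous_map_preimage)
  then show ?thesis by simp
qed

lemma convex_open_power_sum:
  assumes A: "openin T A" "convex A" and S: "finite S" "S' \<subseteq> S"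
  shows "{\<xi> \<in> S \<rightarrow>\<^sub>E topspace T. r *\<^sub>R (\<Sum>z\<in>S'. \<xi> z) \<in> A} \<in> convex_open_power T S"
proof -
  have "openin (product_topology (\<lambda>_. T) S) {\<xi> \<in> S \<rightarrow>\<^sub>E topspace T. r *\<^sub>R (\<Sum>z\<in>S'. \<xi> z) \<in> A}"
    by (rule openin_power_sum[OF A(1) S])
  moreover have "r *\<^sub>R (\<Sum>z\<in>S'. (\<lambda>z\<in>S. (1 - a) *\<^sub>R \<xi> z + a *\<^sub>R \<zeta> z) z) \<in> A"
    if a: "a \<in> {0..1}" and x: "r *\<^sub>R (\<Sum>z\<in>S'. \<xi> z) \<in> A" "r *\<^sub>R (\<Sum>z\<in>S'. \<zeta> z) \<in> A" for a \<xi> \<zeta>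
  proof -
    have "(\<Sum>z\<in>S'. (\<lambda>z\<in>S. (1 - a) *\<^sub>R \<xi> z + a *\<^sub>R \<zeta> z) z)
        = (1 - a) *\<^sub>R (\<Sum>z\<in>S'. \<xi> z) + a *\<^sub>R (\<Sum>z\<in>S'. \<zeta> z)"
    proof -
      have "(\<Sum>z\<in>S'. (\<lambda>z\<in>S. (1 - a) *\<^sub>R \<xi> z + a *\<^sub>R \<zeta> z) z) = (\<Sum>z\<in>S'. (1 - a) *\<^sub>R \<xi> z + a *\<^sub>R \<zeta> z)"
        using S(2) by (intro sum.cong) auto
      then show ?thesis by (simp add: sum.distrib scaleR_sum_right)
    qed
    then have "r *\<^sub>R (\<Sum>z\<in>S'. (\<lambda>z\<in>S. (1 - a) *\<^sub>R \<xi> z + a *\<^sub>R \<zeta> z) z)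
        = (1 - a) *\<^sub>R (r *\<^sub>R (\<Sum>z\<in>S'. \<xi> z)) + a *\<^sub>R (r *\<^sub>R (\<Sum>z\<in>S'. \<zeta> z))"
      by (simp add: scaleR_right_distrib mult.commute)
    moreover have "\<dots> \<in> A" using a by (intro convexD[OF A(2) x]) auto
    ultimately show ?thesis by simp
  qed
  moreover have "(\<lambda>z\<in>S. (1 - a) *\<^sub>R \<xi> z + a *\<^sub>R \<zeta> z) \<in> S \<rightarrow>\<^sub>E topspace T"
    if "\<xi> \<in> S \<rightarrow>\<^sub>E topspace T" "\<zeta> \<in> S \<rightarrow>\<^sub>E topspace T" for a \<xi> \<zeta>
  proof -
    have "(1 - a) *\<^sub>R \<xi> z + a *\<^sub>R \<zeta> z \<in> topspace T" if "z \<in> S" for z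
      using \<open>\<xi> \<in> _\<close> \<open>\<zeta> \<in> _\<close> that by (intro add_in scale_in) (auto simp: PiE_iff)
    then show ?thesis by auto
  qed
  ultimately show ?thesis unfolding convex_open_power_def by simp
qed

lemma convex_open_power_full: "finite S \<Longrightarrow> (S \<rightarrow>\<^sub>E topspace T) \<in> convex_open_power T S"
  using convex_open_power_sum[OF openin_topspace subspace_imp_convex[OF subspace_topspace], of S "{}" 0]
  by (simp add: zero_in)

lemma convex_open_power_restrict:
  assumes D: "D \<in> convex_open_power T S'" and S: "S' \<subseteq> S"
  shows "{\<xi> \<in> S \<rightarrow>\<^sub>E topspace T. restrict \<xi> S' \<in> D} \<in> convex_open_power T S"
proof -
  have "continuous_map (product_topology (\<lambda>_. T) S) (product_topology (\<lambda>_. T) S') (\<lambda>\<xi>. restrict \<xi> S')"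
    using S by (auto simp: continuous_map_componentwise intro: continuous_map_product_projection)
  then have "openin (product_topology (\<lambda>_. T) S)
      {\<xi> \<in> topspace (product_topology (\<lambda>_. T) S). restrict \<xi> S' \<in> D}"
    using D unfolding convex_open_power_def by (intro openin_continuous_map_preimage) auto
  moreover have "restrict (\<lambda>z\<in>S. (1 - a) *\<^sub>R \<xi> z + a *\<^sub>R \<zeta> z) S' \<in> D"
    if "a \<in> {0..1}" "restrict \<xi> S' \<in> D" "restrict \<zeta> S' \<in> D" for a \<xi> \<zeta>
  proof -
    have "(\<lambda>z\<in>S'. (1 - a) *\<^sub>R restrict \<xi> S' z + a *\<^sub>R restrict \<zeta> S' z) \<in> D"
      using D that unfolding convex_open_power_def by blast
    moreover have "restrict (\<lambda>z\<in>S. (1 - a) *\<^sub>R \<xi> z + a *\<^sub>R \<zeta> z) S'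
        = (\<lambda>z\<in>S'. (1 - a) *\<^sub>R restrict \<xi> S' z + a *\<^sub>R restrict \<zeta> S' z)"
      using S by (auto simp: restrict_def fun_eq_iff)
    ultimately show ?thesis by simp
  qed
  moreover have "(\<lambda>z\<in>S. (1 - a) *\<^sub>R \<xi> z + a *\<^sub>R \<zeta> z) \<in> S \<rightarrow>\<^sub>E topspace T"
    if "\<xi> \<in> S \<rightarrow>\<^sub>E topspace T" "\<zeta> \<in> S \<rightarrow>\<^sub>E topspace T" for a \<xi> \<zeta>
  proof -
    have "(1 - a) *\<^sub>R \<xi> z + a *\<^sub>R \<zeta> z \<in> topspace T" if "z \<in> S" for z
      using \<open>\<xi> \<in> _\<close> \<open>\<zeta> \<in> _\<close> that by (intro add_in scale_in) (auto simp: PiE_iff)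
    then show ?thesis by auto
  qed
  ultimately show ?thesis unfolding convex_open_power_def by simp
qed

end

lemma linear_between_sum:
  assumes "linear_between E F u" "subspace E" "finite I" "\<And>i. i \<in> I \<Longrightarrow> x i \<in> E"
  shows "u (\<Sum>i\<in>I. x i) = (\<Sum>i\<in>I. u (x i))"
  using assms(3,4)
proof (induction I rule: finite_induct)
  case empty
  have "u (0 *\<^sub>R 0) = 0 *\<^sub>R u 0"
    using assms(1) subspace_0[OF assms(2)] unfolding linear_between_def by blast
  then show ?case by simp
next
  case (insert i I)
  then have "u (x i + sum x I) = u (x i) + u (sum x I)"
    using assms(1) subspace_sum[OF assms(2), of I x] unfolding linear_between_def by blast
  then show ?case using insert by simp
qed

definition continuous_functional :: "'y::real_vector topology \<Rightarrow> ('y \<Rightarrow> real) \<Rightarrow> bool" where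
  "continuous_functional T u \<longleftrightarrow>
     linear_between (topspace T) UNIV u \<and> continuous_map T euclideanreal u"

lemma continuous_functional_zero [simp]: "continuous_functional T (\<lambda>_. 0)"
  by (simp add: continuous_functional_def linear_between_def)

context frechet_topology
begin

lemma functional_add:
  "continuous_functional T u \<Longrightarrow> x \<in> topspace T \<Longrightarrow> y \<in> topspace T \<Longrightarrow> u (x + y) = u x + u y"
  unfolding continuous_functional_def linear_between_def by blast

lemma functional_scale:
  "continuous_functional T u \<Longrightarrow> x \<in> topspace T \<Longrightarrow> u (a *\<^sub>R x) = a * u x"
  unfolding continuous_functional_def linear_between_def by simp

lemma functional_diff:
  assumes "continuous_functional T u" "x \<in> topspace T" "y \<in> topspace T"
  shows "u (x - y) = u x - u y"
  using functional_add[OF assms(1) diff_in[OF assms(2,3)] assms(3)] by simp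

lemma halfspace:
  assumes u: "continuous_functional T u"
  shows "openin T {y \<in> topspace T. b < u y}" "convex {y \<in> topspace T. b < u y}"
proof -
  have "openin T {y \<in> topspace T. u y \<in> {b<..}}"
    using u unfolding continuous_functional_def by (intro openin_continuous_map_preimage) auto
  then show "openin T {y \<in> topspace T. b < u y}" by simp
  show "convex {y \<in> topspace T. b < u y}"
  proof (rule convexI)
    fix x y and r s :: real
    assume *: "x \<in> {y \<in> topspace T. b < u y}" "y \<in> {y \<in> topspace T. b < u y}" "0 \<le> r" "0 \<le> s" "r + s = 1"
    have "u (r *\<^sub>R x + s *\<^sub>R y) = r * u x + s * u y"
      using * by (simp add: functional_add[OF u] functional_scale[OF u] scale_in)
    moreover have "b < r * u x + s * u y"
      using convexD[of "{b<..}" "u x" "u y" r s] * by simp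
    ultimately show "r *\<^sub>R x + s *\<^sub>R y \<in> {y \<in> topspace T. b < u y}"
      using * by (simp add: add_in scale_in)
  qed
qed

text \<open>For \<open>b > 0\<close> the logarithm turns the condition into an open half-space, and
  for \<open>b = 0\<close> it is vacuous. Superlevel sets of exponential weights are thus events to
  which c.a.d.i. and c.l. apply; this ties the linear functional to hypotheses about convex
  sets.\<close>

lemma convex_open_power_weight:
  assumes D: "D \<in> convex_open_power T S" and u: "continuous_functional T u"
    and S: "finite S" "S' \<subseteq> S" and b: "0 \<le> b"
  shows "{\<xi> \<in> D. b < exp (u (\<Sum>z\<in>S'. \<xi> z))} \<in> convex_open_power T S"
proof (cases "b = 0")
  case True
  then show ?thesis using D by simp
next
  case False
  then have b: "0 < b" using b by simp
  have "{\<xi> \<in> D. b < exp (u (\<Sum>z\<in>S'. \<xi> z))}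
      = D \<inter> {\<xi> \<in> S \<rightarrow>\<^sub>E topspace T. 1 *\<^sub>R (\<Sum>z\<in>S'. \<xi> z) \<in> {y \<in> topspace T. ln b < u y}}"
  proof -
    have "b < exp (u (\<Sum>z\<in>S'. \<xi> z)) \<longleftrightarrow> ln b < u (1 *\<^sub>R (\<Sum>z\<in>S'. \<xi> z))" for \<xi>
      using b by (metis exp_less_cancel_iff exp_ln scaleR_one)
    moreover have "\<xi> \<in> S \<rightarrow>\<^sub>E topspace T \<and> 1 *\<^sub>R (\<Sum>z\<in>S'. \<xi> z) \<in> topspace T" if xi: "\<xi> \<in> D" for \<xi>
    proof -
      have "\<xi> \<in> S \<rightarrow>\<^sub>E topspace T" by (rule convex_open_power_subset[OF D xi])
      then show ?thesis using S(2) by (intro conjI scale_in sum_in) (auto simp: PiE_iff)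
    qed
    ultimately show ?thesis by blast
  qed
  also have "\<dots> \<in> convex_open_power T S"
    by (intro convex_open_power_Int D convex_open_power_sum halfspace u S)
  finally show ?thesis .
qed

end


section \<open>Layer-cake inequalities\<close>

text \<open>Tonelli, after writing F as the integral of the indicators of \<open>a < F\<close> over
  a \<ge> 0. Negative values of F are truncated to 0 by \<open>ennreal\<close>, in agreement with
  their empty range of levels.\<close>

lemma nn_integral_layer_cake:
  fixes F :: "'w \<Rightarrow> real"
  assumes "sigma_finite_measure M"
    and F[measurable]: "F \<in> borel_measurable M" and G[measurable]: "G \<in> borel_measurable M"
  shows "(\<integral>\<^sup>+\<omega>. ennreal (F \<omega>) * G \<omega> \<partial>M)
      = (\<integral>\<^sup>+a. indicator {0..} a * (\<integral>\<^sup>+\<omega>. indicator {\<omega>. a < F \<omega>} \<omega> * G \<omega> \<partial>M) \<partial>lborel)"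
proof -
  interpret sigma_finite_measure M by fact
  interpret pair_sigma_finite M lborel ..
  have "ennreal (F \<omega>) = (\<integral>\<^sup>+a. indicator {0..} a * indicator {\<omega>. a < F \<omega>} \<omega> \<partial>lborel)" for \<omega>
  proof -
    have "(\<integral>\<^sup>+a. indicator {0..} a * indicator {\<omega>. a < F \<omega>} \<omega> \<partial>lborel)
        = (\<integral>\<^sup>+a. indicator {0..<F \<omega>} a \<partial>lborel)"
      by (intro nn_integral_cong) (auto split: split_indicator)
    also have "\<dots> = ennreal (F \<omega>)" by (cases "0 \<le> F \<omega>") (auto simp: ennreal_neg)
    finally show ?thesis by simp
  qed
  then have "(\<integral>\<^sup>+\<omega>. ennreal (F \<omega>) * G \<omega> \<partial>M)
      = (\<integral>\<^sup>+\<omega>. (\<integral>\<^sup>+a. (indicator {0..} a * indicator {\<omega>. a < F \<omega>} \<omega>) * G \<omega> \<partial>lborel) \<partial>M)"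
    by (simp add: nn_integral_multc)
  also have "\<dots> = (\<integral>\<^sup>+a. (\<integral>\<^sup>+\<omega>. (indicator {0..} a * indicator {\<omega>. a < F \<omega>} \<omega>) * G \<omega> \<partial>M) \<partial>lborel)"
    by (rule Fubini'[symmetric]) measurable
  also have "\<dots> = (\<integral>\<^sup>+a. indicator {0..} a * (\<integral>\<^sup>+\<omega>. indicator {\<omega>. a < F \<omega>} \<omega> * G \<omega> \<partial>M) \<partial>lborel)"
    by (simp add: nn_integral_cmult mult.assoc)
  finally show ?thesis .
qed

lemma nn_integral_layer_cake_emeasure:
  fixes F :: "'w \<Rightarrow> real"
  assumes "sigma_finite_measure M" and F[measurable]: "F \<in> borel_measurable M"
    and E[measurable]: "E \<in> sets M"
  shows "(\<integral>\<^sup>+\<omega>. ennreal (F \<omega>) * indicator E \<omega> \<partial>M)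
      = (\<integral>\<^sup>+a. indicator {0..} a * emeasure M {\<omega>\<in>space M. \<omega> \<in> E \<and> a < F \<omega>} \<partial>lborel)"
proof -
  have "(\<integral>\<^sup>+\<omega>. indicator {\<omega>. a < F \<omega>} \<omega> * indicator E \<omega> \<partial>M)
      = emeasure M {\<omega>\<in>space M. \<omega> \<in> E \<and> a < F \<omega>}" for a
  proof -
    have "(\<integral>\<^sup>+\<omega>. indicator {\<omega>. a < F \<omega>} \<omega> * indicator E \<omega> \<partial>M)
        = (\<integral>\<^sup>+\<omega>. indicator {\<omega>\<in>space M. \<omega> \<in> E \<and> a < F \<omega>} \<omega> \<partial>M)"
      by (intro nn_integral_cong) (auto split: split_indicator)
    then show ?thesis by simp
  qed
  then show ?thesis by (simp add: nn_integral_layer_cake[OF assms(1,2)])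
qed

text \<open>The layer-cake formula is used twice: over the levels of G with the level of F fixed,
  then over the levels of F. Every pair of levels is handled by \<open>dec\<close>, so the constant
  passes through unchanged.\<close>

lemma emeasure_decoupling_imp_nn_integral:
  fixes F G :: "'w \<Rightarrow> real"
  assumes M: "sigma_finite_measure M"
    and F[measurable]: "F \<in> borel_measurable M" and G[measurable]: "G \<in> borel_measurable M"
    and dec: "\<And>a b. 0 \<le> a \<Longrightarrow> 0 \<le> b \<Longrightarrow>
      \<kappa> * emeasure M {\<omega>\<in>space M. a < F \<omega>} * emeasure M {\<omega>\<in>space M. b < G \<omega>}
        \<le> emeasure M {\<omega>\<in>space M. a < F \<omega> \<and> b < G \<omega>}"
  shows "\<kappa> * (\<integral>\<^sup>+\<omega>. ennreal (F \<omega>) \<partial>M) * (\<integral>\<^sup>+\<omega>. ennreal (G \<omega>) \<partial>M)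
      \<le> (\<integral>\<^sup>+\<omega>. ennreal (F \<omega>) * ennreal (G \<omega>) \<partial>M)"
proof -
  interpret sigma_finite_measure M by fact
  have lay: "(\<integral>\<^sup>+\<omega>. ennreal (H \<omega>) \<partial>M) = (\<integral>\<^sup>+a. indicator {0..} a * emeasure M {\<omega>\<in>space M. a < H \<omega>} \<partial>lborel)"
    if [measurable]: "H \<in> borel_measurable M" for H :: "'w \<Rightarrow> real"
  proof -
    have "(\<integral>\<^sup>+\<omega>. ennreal (H \<omega>) \<partial>M) = (\<integral>\<^sup>+\<omega>. ennreal (H \<omega>) * indicator (space M) \<omega> \<partial>M)"
      by (intro nn_integral_cong) auto
    then show ?thesis
      using nn_integral_layer_cake_emeasure[OF M that sets.top] by (simp cong: conj_cong)
  qed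
  have inner: "\<kappa> * emeasure M {\<omega>\<in>space M. a < F \<omega>} * (\<integral>\<^sup>+\<omega>. ennreal (G \<omega>) \<partial>M)
      \<le> (\<integral>\<^sup>+\<omega>. indicator {\<omega>. a < F \<omega>} \<omega> * ennreal (G \<omega>) \<partial>M)" if a: "0 \<le> a" for a
  proof -
    have meas: "(\<lambda>b. emeasure M {\<omega>\<in>space M. b < G \<omega>}) \<in> borel_measurable lborel"
      by measurable
    have "\<kappa> * emeasure M {\<omega>\<in>space M. a < F \<omega>} * (\<integral>\<^sup>+\<omega>. ennreal (G \<omega>) \<partial>M)
        = (\<integral>\<^sup>+b. \<kappa> * emeasure M {\<omega>\<in>space M. a < F \<omega>} *
            (indicator {0..} b * emeasure M {\<omega>\<in>space M. b < G \<omega>}) \<partial>lborel)"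
      using meas by (subst lay[OF G], subst nn_integral_cmult) auto
    also have "\<dots> \<le> (\<integral>\<^sup>+b. indicator {0..} b *
        emeasure M {\<omega>\<in>space M. \<omega> \<in> {\<omega>\<in>space M. a < F \<omega>} \<and> b < G \<omega>} \<partial>lborel)"
      using dec[OF a] by (intro nn_integral_mono) (auto split: split_indicator cong: conj_cong)
    also have "\<dots> = (\<integral>\<^sup>+\<omega>. ennreal (G \<omega>) * indicator {\<omega>\<in>space M. a < F \<omega>} \<omega> \<partial>M)"
      by (rule nn_integral_layer_cake_emeasure[OF M, symmetric]) measurable
    also have "\<dots> = (\<integral>\<^sup>+\<omega>. indicator {\<omega>. a < F \<omega>} \<omega> * ennreal (G \<omega>) \<partial>M)"
      by (intro nn_integral_cong) (auto split: split_indicator)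
    finally show ?thesis .
  qed
  have meas: "(\<lambda>b. emeasure M {\<omega>\<in>space M. b < F \<omega>}) \<in> borel_measurable lborel"
    by measurable
  have "\<kappa> * (\<integral>\<^sup>+\<omega>. ennreal (F \<omega>) \<partial>M) * (\<integral>\<^sup>+\<omega>. ennreal (G \<omega>) \<partial>M)
      = (\<integral>\<^sup>+a. (\<kappa> * (\<integral>\<^sup>+\<omega>. ennreal (G \<omega>) \<partial>M)) *
          (indicator {0..} a * emeasure M {\<omega>\<in>space M. a < F \<omega>}) \<partial>lborel)"
    using meas by (subst lay[OF F], subst nn_integral_cmult) (auto simp: mult_ac)
  also have "\<dots> \<le> (\<integral>\<^sup>+a. indicator {0..} a *
      (\<integral>\<^sup>+\<omega>. indicator {\<omega>. a < F \<omega>} \<omega> * ennreal (G \<omega>) \<partial>M) \<partial>lborel)"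
    using inner by (intro nn_integral_mono) (auto split: split_indicator simp: mult_ac)
  also have "\<dots> = (\<integral>\<^sup>+\<omega>. ennreal (F \<omega>) * ennreal (G \<omega>) \<partial>M)"
    by (rule nn_integral_layer_cake[OF M F, symmetric]) measurable
  finally show ?thesis .
qed

text \<open>The variant in which one factor is a single event, as c.l. provides it.\<close>

lemma emeasure_conditioning_imp_nn_integral:
  fixes G :: "'w \<Rightarrow> real"
  assumes M: "sigma_finite_measure M"
    and G[measurable]: "G \<in> borel_measurable M" and E: "E \<in> sets M"
    and dec: "\<And>b. 0 \<le> b \<Longrightarrow>
      \<kappa> * emeasure M {\<omega>\<in>space M. b < G \<omega>} \<le> emeasure M {\<omega>\<in>space M. \<omega> \<in> E \<and> b < G \<omega>}"
  shows "\<kappa> * (\<integral>\<^sup>+\<omega>. ennreal (G \<omega>) \<partial>M) \<le> (\<integral>\<^sup>+\<omega>. ennreal (G \<omega>) * indicator E \<omega> \<partial>M)"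
proof -
  interpret sigma_finite_measure M by fact
  have meas: "(\<lambda>b. emeasure M {\<omega>\<in>space M. b < G \<omega>}) \<in> borel_measurable lborel"
    by measurable
  have "(\<integral>\<^sup>+\<omega>. ennreal (G \<omega>) \<partial>M) = (\<integral>\<^sup>+\<omega>. ennreal (G \<omega>) * indicator (space M) \<omega> \<partial>M)"
    by (intro nn_integral_cong) auto
  also have "\<dots> = (\<integral>\<^sup>+b. indicator {0..} b * emeasure M {\<omega>\<in>space M. b < G \<omega>} \<partial>lborel)"
    using nn_integral_layer_cake_emeasure[OF M G sets.top] by (simp cong: conj_cong)
  finally have "\<kappa> * (\<integral>\<^sup>+\<omega>. ennreal (G \<omega>) \<partial>M)
      = (\<integral>\<^sup>+b. \<kappa> * (indicator {0..} b * emeasure M {\<omega>\<in>space M. b < G \<omega>}) \<partial>lborel)"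
    using meas by (subst nn_integral_cmult) auto
  also have "\<dots> \<le> (\<integral>\<^sup>+b. indicator {0..} b * emeasure M {\<omega>\<in>space M. \<omega> \<in> E \<and> b < G \<omega>} \<partial>lborel)"
    using dec by (intro nn_integral_mono) (auto split: split_indicator)
  also have "\<dots> = (\<integral>\<^sup>+\<omega>. ennreal (G \<omega>) * indicator E \<omega> \<partial>M)"
    by (rule nn_integral_layer_cake_emeasure[OF M G E, symmetric])
  finally show ?thesis .
qed

section \<open>Tilings of lattice boxes\<close>

lemma mem_lattice_box: "w \<in> lattice_box z n \<longleftrightarrow> (\<forall>k. z $ k \<le> w $ k \<and> w $ k < z $ k + int n)"
proof
  assume "\<forall>k. z $ k \<le> w $ k \<and> w $ k < z $ k + int n"
  then have "w - z \<in> {v. \<forall>k. 0 \<le> v $ k \<and> v $ k < int n}" by (simp add: algebra_simps)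
  moreover have "w = z + (w - z)" by simp
  ultimately show "w \<in> lattice_box z n" unfolding lattice_box_def by (rule rev_image_eqI)
qed (auto simp: lattice_box_def)

lemma lattice_box_translate: "lattice_box (z + a) n = (\<lambda>w. w + a) ` lattice_box z n"
  unfolding lattice_box_def by (auto simp: image_image algebra_simps)

lemma
  shows finite_lattice_box [simp]: "finite (lattice_box z n)"
    and card_lattice_box [simp]: "card (lattice_box (z :: int ^ 'd) n) = n ^ CARD('d)"
proof -
  let ?P = "(UNIV :: 'd set) \<rightarrow>\<^sub>E {0..<int n}"
  have img: "{v :: int ^ 'd. \<forall>k. 0 \<le> v $ k \<and> v $ k < int n} = vec_lambda ` ?P"
  proof (intro equalityI subsetI)
    fix v :: "int ^ 'd" assume "v \<in> {v. \<forall>k. 0 \<le> v $ k \<and> v $ k < int n}"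
    then show "v \<in> vec_lambda ` ?P" by (intro image_eqI[of _ _ "vec_nth v"]) auto
  qed auto
  have inj: "inj_on vec_lambda ?P" by (auto intro!: inj_onI simp: vec_lambda_inject)
  have fin: "finite ?P" by (intro finite_PiE) auto
  show "finite (lattice_box z n)" unfolding lattice_box_def img using fin by simp
  have "card (lattice_box z n) = card ?P"
    unfolding lattice_box_def img using inj by (simp add: card_image)
  also have "\<dots> = n ^ CARD('d)" by (simp add: card_PiE)
  finally show "card (lattice_box z n) = n ^ CARD('d)" .
qed

text \<open>A coarse grid of mesh q with K points in each direction. Tiles of side m \<le> q at
  these points leave gaps between neighbours.\<close>

definition tile_origins :: "nat \<Rightarrow> nat \<Rightarrow> (int ^ 'd) set" where
  "tile_origins q K = (\<lambda>v. \<chi> k. int q * v $ k) ` lattice_box 0 K"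

lemma finite_tile_origins [simp]: "finite (tile_origins q K)"
  by (simp add: tile_origins_def)

lemma card_tile_origins:
  assumes "q > 0" shows "card (tile_origins q K :: (int ^ 'd) set) = K ^ CARD('d)"
proof -
  have "inj_on (\<lambda>v :: int ^ 'd. \<chi> k. int q * v $ k) (lattice_box 0 K)"
    using assms by (auto intro!: inj_onI simp: vec_eq_iff)
  then show ?thesis unfolding tile_origins_def by (simp add: card_image)
qed

lemma tile_origins_dvd: "a \<in> tile_origins q K \<Longrightarrow> l dvd q \<Longrightarrow> int l dvd a $ k"
  by (auto simp: tile_origins_def)

lemma tile_subset:
  assumes a: "a \<in> tile_origins q K" and "m \<le> q" "q * K \<le> n"
  shows "lattice_box a m \<subseteq> lattice_box 0 n"
proof
  fix w assume w: "w \<in> lattice_box a m"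
  obtain v where v: "v \<in> lattice_box 0 K" "a = (\<chi> k. int q * v $ k)"
    using a by (auto simp: tile_origins_def)
  have "0 \<le> w $ k \<and> w $ k < int n" for k
  proof -
    have vk: "0 \<le> v $ k" "v $ k + 1 \<le> int K" using v(1) by (simp_all add: mem_lattice_box zless_imp_add1_zle)
    have wk: "int q * v $ k \<le> w $ k" "w $ k < int q * v $ k + int m"
      using w v(2) by (auto simp: mem_lattice_box)
    have "int q * (v $ k + 1) \<le> int q * int K" using vk by (intro mult_left_mono) auto
    also have "\<dots> \<le> int n" using assms(3) by (metis of_nat_le_iff of_nat_mult)
    finally have "int q * v $ k + int q \<le> int n" by (simp add: algebra_simps)
    moreover have "0 \<le> int q * v $ k" using vk by simp
    ultimately show ?thesis using wk assms(2) by linarith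
  qed
  then show "w \<in> lattice_box 0 n" by (simp add: mem_lattice_box)
qed

lemma sup_norm_ge: "\<bar>z $ k\<bar> \<le> sup_norm z"
  unfolding sup_norm_def by (intro Max_ge) auto

text \<open>In some coordinate the origins differ by at least q, and within that coordinate each
  point exceeds its origin by at most m - 1. This is the source of the bound q - m + 1.\<close>

lemma tile_separation:
  assumes a: "a \<in> tile_origins q K" and b: "b \<in> tile_origins q K" and ne: "a \<noteq> b"
    and s: "s \<in> lattice_box a m" and w: "w \<in> lattice_box b m"
  shows "int q - int m + 1 \<le> sup_norm (s - w)"
proof -
  obtain v where v: "a = (\<chi> k. int q * v $ k)" using a by (auto simp: tile_origins_def)
  obtain v' where v': "b = (\<chi> k. int q * v' $ k)" using b by (auto simp: tile_origins_def)
  obtain k where k: "a $ k \<noteq> b $ k" using ne by (auto simp: vec_eq_iff)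
  then have "v $ k \<noteq> v' $ k" using v v' by auto
  then have "1 \<le> \<bar>v $ k - v' $ k\<bar>" by linarith
  then have "int q * 1 \<le> int q * \<bar>v $ k - v' $ k\<bar>" by (intro mult_left_mono) auto
  also have "\<dots> = \<bar>a $ k - b $ k\<bar>" by (simp add: v v' abs_mult flip: right_diff_distrib)
  finally have "int q \<le> \<bar>a $ k - b $ k\<bar>" by simp
  moreover have "a $ k \<le> s $ k" "s $ k < a $ k + int m" "b $ k \<le> w $ k" "w $ k < b $ k + int m"
    using s w by (auto simp: mem_lattice_box)
  ultimately have "int q - int m + 1 \<le> \<bar>(s - w) $ k\<bar>" by (simp add: abs_if split: if_splits)
  then show ?thesis using sup_norm_ge[of "s - w" k] by linarith
qed

text \<open>Covers \<open>S = {}\<close> as well, where the infimum is infinite; that case occurs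
  when the first tile is added in \<open>weight_tiles\<close>.\<close>

lemma lattice_dist_greater:
  assumes "\<And>s w. s \<in> S \<Longrightarrow> w \<in> L \<Longrightarrow> N \<le> sup_norm (s - w)" and "r < real_of_int N"
  shows "ereal r < lattice_dist S L"
proof -
  have "ereal (real_of_int N) \<le> lattice_dist S L"
    unfolding lattice_dist_def using assms(1) by (intro INF_greatest) auto
  then show ?thesis using assms(2) by (metis ereal_less(2) less_ereal.simps(1) order_less_le_trans)
qed

text \<open>Since g(m) is small compared with m, a mesh q just above m + g(m) satisfies q / m -> 1.
  Tiles then fill a proportion of the box that tends, for large n, to \<open>(m / q) ^ d\<close>,
  which is close to 1. Divisibility by l keeps the tile origins in the lattice of
  invariance.\<close>

lemma tiling_density:
  fixes g :: "nat \<Rightarrow> real"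
  assumes l: "l \<ge> 1" and g: "\<And>n. n \<ge> 1 \<Longrightarrow> 0 \<le> g n" "(\<lambda>n. g n / real n) \<longlonglongrightarrow> 0" and e: "e > 0"
  obtains m0 where "m0 \<ge> 1" "\<And>m. m \<ge> m0 \<Longrightarrow> \<exists>q\<ge>m. l dvd q \<and> g m < real q - real m + 1 \<and>
      eventually (\<lambda>n. 1 - e \<le> (real (n div q * m) / real n) ^ d) sequentially"
proof -
  \<comment> \<open>A multiple of l above m + g(m), which overshoots by at most 1 for the ceiling
    and l for the divisibility.\<close>
  define q where "q = (\<lambda>m. l * (nat \<lceil>real m + g m\<rceil> div l + 1))"
  have lower: "real m + g m \<le> real (q m)" if "m \<ge> 1" for m
  proof -
    have "nat \<lceil>real m + g m\<rceil> \<le> q m"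
    proof -
      have "nat \<lceil>real m + g m\<rceil> = l * (nat \<lceil>real m + g m\<rceil> div l) + nat \<lceil>real m + g m\<rceil> mod l" by simp
      also have "\<dots> \<le> l * (nat \<lceil>real m + g m\<rceil> div l) + l"
        using l by (intro add_left_mono less_imp_le mod_less_divisor) simp
      finally show ?thesis unfolding q_def by (simp only: distrib_left mult_1_right)
    qed
    then show ?thesis by linarith
  qed
  have upper: "real (q m) \<le> real m + g m + 1 + real l" if "m \<ge> 1" for m
  proof -
    have "l * (nat \<lceil>real m + g m\<rceil> div l) \<le> nat \<lceil>real m + g m\<rceil>" by (rule times_div_less_eq_dividend)
    then have "real (q m) \<le> real (nat \<lceil>real m + g m\<rceil>) + real l"
      unfolding q_def by (metis add_mono_thms_linordered_semiring(3) distrib_left mult_1_right of_nat_add of_nat_le_iff)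
    also have "real (nat \<lceil>real m + g m\<rceil>) \<le> real m + g m + 1" using g(1)[OF that] by linarith
    finally show ?thesis by simp
  qed
  have "(\<lambda>m. real (q m) / real m) \<longlonglongrightarrow> 1"
  proof (rule tendsto_sandwich)
    show "eventually (\<lambda>m. 1 \<le> real (q m) / real m) sequentially"
      using eventually_ge_at_top[of 1]
    proof eventually_elim
      case (elim m)
      then show ?case using lower[of m] g(1)[of m] by (simp add: field_simps)
    qed
    show "eventually (\<lambda>m. real (q m) / real m \<le> 1 + g m / real m + (1 + real l) / real m) sequentially"
      using eventually_ge_at_top[of 1]
    proof eventually_elim
      case (elim m)
      then have "real (q m) / real m \<le> (real m + g m + 1 + real l) / real m"
        using upper[of m] by (intro divide_right_mono) auto
      then show ?case using elim by (simp add: add_divide_distrib)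
    qed
    have "(\<lambda>m. (1 + real l) / real m) \<longlonglongrightarrow> 0"
      by (intro tendsto_divide_0[OF tendsto_const] filterlim_compose[OF filterlim_real_sequentially]
          filterlim_at_top_imp_at_infinity filterlim_real_sequentially)
    then have "(\<lambda>m. 1 + g m / real m + (1 + real l) / real m) \<longlonglongrightarrow> 1 + 0 + 0"
      by (intro tendsto_add tendsto_const g(2))
    then show "(\<lambda>m. 1 + g m / real m + (1 + real l) / real m) \<longlonglongrightarrow> 1" by simp
  qed simp
  then have "(\<lambda>m. (inverse (real (q m) / real m)) ^ d) \<longlonglongrightarrow> (inverse 1) ^ d"
    by (intro tendsto_power tendsto_inverse) auto
  then have "eventually (\<lambda>m. 1 - e < (inverse (real (q m) / real m)) ^ d) sequentially"
    using e by (intro order_tendstoD) auto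
  then obtain m1 where m1: "\<And>m. m \<ge> m1 \<Longrightarrow> 1 - e < (inverse (real (q m) / real m)) ^ d"
    by (auto simp: eventually_sequentially)
  show ?thesis
  proof (rule that[of "max 1 m1"])
    fix m assume m: "max 1 m1 \<le> m"
    have m': "m \<ge> 1" using m by simp
    have qp: "q m > 0" using l by (simp add: q_def)
    \<comment> \<open>Rounding n down to a multiple of the mesh loses less than one mesh length,
      which is negligible relative to n.\<close>
    have lim: "(\<lambda>n. real (n div q m) / real n) \<longlonglongrightarrow> 1 / real (q m)"
    proof (rule tendsto_sandwich)
      show "eventually (\<lambda>n. 1 / real (q m) - 1 / real n \<le> real (n div q m) / real n) sequentially"
        using eventually_gt_at_top[of 0]
      proof eventually_elim
        case (elim n)
        have "real n / real (q m) < real (n div q m) + 1"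
          using qp by (simp add: divide_less_eq) (metis dividend_less_div_times distrib_right mult_1 of_nat_1 of_nat_add of_nat_less_iff of_nat_mult add.commute)
        then have "(real n / real (q m) - 1) / real n \<le> real (n div q m) / real n"
          using elim by (intro divide_right_mono) auto
        then show ?case using elim by (simp add: diff_divide_distrib)
      qed
      show "eventually (\<lambda>n. real (n div q m) / real n \<le> 1 / real (q m)) sequentially"
        using eventually_gt_at_top[of 0]
      proof eventually_elim
        case (elim n)
        have "real (n div q m) \<le> real n / real (q m)"
          using qp by (simp add: le_divide_eq flip: of_nat_mult)
        then show ?case using elim qp by (simp add: field_simps)
      qed
      have "(\<lambda>n. 1 / real (q m) - 1 / real n) \<longlonglongrightarrow> 1 / real (q m) - 0"
        by (intro tendsto_diff tendsto_const lim_1_over_n)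
      then show "(\<lambda>n. 1 / real (q m) - 1 / real n) \<longlonglongrightarrow> 1 / real (q m)" by simp
    qed simp
    then have "(\<lambda>n. (real (n div q m) / real n * real m) ^ d) \<longlonglongrightarrow> (1 / real (q m) * real m) ^ d"
      by (intro tendsto_power tendsto_mult tendsto_const)
    moreover have "1 - e < (1 / real (q m) * real m) ^ d" using m1[of m] m by simp
    ultimately have "eventually (\<lambda>n. 1 - e < (real (n div q m) / real n * real m) ^ d) sequentially"
      by (rule order_tendstoD)
    then have "eventually (\<lambda>n. 1 - e \<le> (real (n div q m * m) / real n) ^ d) sequentially"
      by eventually_elim simp
    moreover have "q m \<ge> m" "g m < real (q m) - real m + 1"
      using lower[OF m'] g(1)[OF m'] by linarith+
    moreover have "l dvd q m" by (simp add: q_def)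
    ultimately show "\<exists>q\<ge>m. l dvd q \<and> g m < real q - real m + 1 \<and>
      eventually (\<lambda>n. 1 - e \<le> (real (n div q * m) / real n) ^ d) sequentially" by blast
  qed simp
qed

section \<open>Decoupled fields\<close>

lemma borel_of_measurableI:
  assumes "\<And>\<omega>. \<omega> \<in> space N \<Longrightarrow> F \<omega> \<in> topspace T"
    and "\<And>U. openin T U \<Longrightarrow> {\<omega>\<in>space N. F \<omega> \<in> U} \<in> sets N"
  shows "F \<in> measurable N (borel_of T)"
  unfolding borel_of_def
proof (rule measurable_measure_of)
  show "{U. openin T U} \<subseteq> Pow (topspace T)" by (auto dest: openin_subset)
  show "F \<in> space N \<rightarrow> topspace T" using assms(1) by auto
  fix U assume "U \<in> {U. openin T U}"
  then show "F -` U \<inter> space N \<in> sets N"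
    using assms(2)[of U] by (simp add: vimage_def Int_def conj_commute)
qed

lemma continuous_map_borel_measurable:
  assumes "continuous_map T euclideanreal u" shows "u \<in> borel_measurable (borel_of T)"
proof (rule borel_measurableI)
  fix U :: "real set" assume "open U"
  then have "openin T {x \<in> topspace T. u x \<in> U}"
    using assms by (intro openin_continuous_map_preimage) auto
  then show "u -` U \<inter> space (borel_of T) \<in> sets (borel_of T)"
    using openin_imp_sets_borel_of by (simp add: vimage_def Int_def conj_commute)
qed

context frechet_topology
begin

lemma sum_borel_measurable:
  assumes sep: "separable_space T" and S: "finite S"
    and \<eta>: "\<And>z. z \<in> S \<Longrightarrow> (\<lambda>\<omega>. \<eta> \<omega> z) \<in> measurable N (borel_of T)"
  shows "(\<lambda>\<omega>. r *\<^sub>R (\<Sum>z\<in>S. \<eta> \<omega> z)) \<in> measurable N (borel_of T)"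
proof (rule borel_of_measurableI)
  have in_T: "\<eta> \<omega> z \<in> topspace T" if "\<omega> \<in> space N" "z \<in> S" for \<omega> z
    using measurable_space[OF \<eta>[OF that(2)] that(1)] by simp
  show "r *\<^sub>R (\<Sum>z\<in>S. \<eta> \<omega> z) \<in> topspace T" if "\<omega> \<in> space N" for \<omega>
    using in_T[OF that] by (intro scale_in sum_in)
  fix U assume U: "openin T U"
  have "{\<omega>\<in>space N. restrict (\<eta> \<omega>) S \<in> {\<xi> \<in> S \<rightarrow>\<^sub>E topspace T. r *\<^sub>R (\<Sum>z\<in>S. \<xi> z) \<in> U}} \<in> sets N"
    by (rule open_product_measurable[OF second_countable[OF sep] S \<eta> openin_power_sum[OF U S]]) auto
  also have "{\<omega>\<in>space N. restrict (\<eta> \<omega>) S \<in> {\<xi> \<in> S \<rightarrow>\<^sub>E topspace T. r *\<^sub>R (\<Sum>z\<in>S. \<xi> z) \<in> U}}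
      = {\<omega>\<in>space N. r *\<^sub>R (\<Sum>z\<in>S. \<eta> \<omega> z) \<in> U}"
  proof -
    have "restrict (\<eta> \<omega>) S \<in> S \<rightarrow>\<^sub>E topspace T" if "\<omega> \<in> space N" for \<omega>
      using in_T[OF that] by simp
    then show ?thesis by (auto cong: sum.cong)
  qed
  finally show "{\<omega>\<in>space N. r *\<^sub>R (\<Sum>z\<in>S. \<eta> \<omega> z) \<in> U} \<in> sets N" .
qed

end

text \<open>The witnesses g, c of c.a.d.i. and t, \<alpha> of c.l. are parameters, so that the
  choice of scales can refer to them.\<close>

locale decoupled_field = frechet_topology T + prob_space M
  for T :: "'y::real_vector topology" and M :: "'w measure" +
  fixes B :: "'y set set" and \<eta> :: "'w \<Rightarrow> int ^ 'd \<Rightarrow> 'y" and l :: nat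
    and g c :: "nat \<Rightarrow> real" and t \<alpha> :: "'y set \<Rightarrow> real"
  assumes separable: "separable_space T"
    and zero_base: "convex_zero_base T B"
    and measurable_field: "\<And>z. (\<lambda>\<omega>. \<eta> \<omega> z) \<in> measurable M (borel_of T)"
    and l: "l \<ge> 1"
    and gc: "\<And>n. n \<ge> 1 \<Longrightarrow> 0 \<le> g n \<and> 0 \<le> c n"
    and g_lim: "(\<lambda>n. g n / real n) \<longlonglongrightarrow> 0"
    and c_lim: "(\<lambda>n. c n / real (card (lattice_box (0 :: int ^ 'd) n))) \<longlonglongrightarrow> 0"
    and decoupling: "\<And>z n S C D. n \<ge> 1 \<Longrightarrow> finite S \<Longrightarrow>
      C \<in> convex_open_power T (lattice_box z n) \<Longrightarrow> D \<in> convex_open_power T S \<Longrightarrow>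
      lattice_dist S (lattice_box z n) > ereal (g n) \<Longrightarrow>
      exp (- c n) * measure M {\<omega>\<in>space M. restrict (\<eta> \<omega>) (lattice_box z n) \<in> C}
          * measure M {\<omega>\<in>space M. restrict (\<eta> \<omega>) S \<in> D}
        \<le> measure M {\<omega>\<in>space M. restrict (\<eta> \<omega>) (lattice_box z n) \<in> C \<and> restrict (\<eta> \<omega>) S \<in> D}"
    and t\<alpha>: "\<And>V. V \<in> B \<Longrightarrow> 0 < t V \<and> 0 < \<alpha> V \<and> \<alpha> V \<le> 1"
    and conditioning: "\<And>V z S D. V \<in> B \<Longrightarrow> finite S \<Longrightarrow> z \<notin> S \<Longrightarrow> D \<in> convex_open_power T S \<Longrightarrow>
      \<alpha> V * measure M {\<omega>\<in>space M. restrict (\<eta> \<omega>) S \<in> D}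
        \<le> measure M {\<omega>\<in>space M. \<eta> \<omega> z \<in> dilate (t V) V \<and> restrict (\<eta> \<omega>) S \<in> D}"
    and invariance: "translation_invariant l M (borel_of T) \<eta>"
begin

lemma field_in: "\<omega> \<in> space M \<Longrightarrow> \<eta> \<omega> z \<in> topspace T"
  using measurable_space[OF measurable_field] by simp

lemma field_restrict_in: "\<omega> \<in> space M \<Longrightarrow> restrict (\<eta> \<omega>) S \<in> S \<rightarrow>\<^sub>E topspace T"
  by (simp add: field_in)

lemma base_open: "V \<in> B \<Longrightarrow> openin T V" and base_convex: "V \<in> B \<Longrightarrow> convex V"
  and base_zero: "V \<in> B \<Longrightarrow> 0 \<in> V"
  using zero_base unfolding convex_zero_base_def by auto

lemma base_refine:
  assumes "openin T U" "0 \<in> U" obtains V where "V \<in> B" "V \<subseteq> U"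
  using assms zero_base unfolding convex_zero_base_def by auto

lemma sets_restrict:
  assumes "finite S" "C \<in> convex_open_power T S"
  shows "{\<omega>\<in>space M. restrict (\<eta> \<omega>) S \<in> C} \<in> sets M"
  using assms measurable_field
  by (intro open_product_measurable[OF second_countable[OF separable]])
     (auto simp: convex_open_power_def)

section \<open>Exponential weights on convex events\<close>

text \<open>The summed sites \<open>S'\<close> are separate from the constrained sites
  \<open>S\<close>: in the gaps the field is confined to a small set but not yet summed, since its
  contribution to the exponent is bounded afterwards.\<close>

definition weight :: "('y \<Rightarrow> real) \<Rightarrow> (int ^ 'd) set \<Rightarrow> (int ^ 'd) set \<Rightarrow> (int ^ 'd \<Rightarrow> 'y) set \<Rightarrow> 'w \<Rightarrow> real" where
  "weight u S' S D \<omega> = exp (u (\<Sum>z\<in>S'. \<eta> \<omega> z)) * indicator D (restrict (\<eta> \<omega>) S)"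

lemma weight_nonneg [simp]: "0 \<le> weight u S' S D \<omega>"
  by (simp add: weight_def)

lemma weight_superlevel:
  assumes "S' \<subseteq> S" "0 \<le> b"
  shows "b < weight u S' S D \<omega> \<longleftrightarrow> restrict (\<eta> \<omega>) S \<in> {\<xi> \<in> D. b < exp (u (\<Sum>z\<in>S'. \<xi> z))}"
proof -
  have "(\<Sum>z\<in>S'. restrict (\<eta> \<omega>) S z) = (\<Sum>z\<in>S'. \<eta> \<omega> z)"
    using assms(1) by (intro sum.cong) auto
  then show ?thesis using assms(2) by (auto simp: weight_def indicator_def)
qed

lemma weight_measurable:
  assumes D: "D \<in> convex_open_power T S" and u: "continuous_functional T u"
    and S: "finite S" "S' \<subseteq> S"
  shows "weight u S' S D \<in> borel_measurable M"
  unfolding borel_measurable_iff_greater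
proof
  fix b :: real
  show "{\<omega>\<in>space M. b < weight u S' S D \<omega>} \<in> sets M"
  proof (cases "0 \<le> b")
    case True
    then show ?thesis
      using sets_restrict[OF S(1) convex_open_power_weight[OF D u S True]]
      by (simp add: weight_superlevel[OF S(2) True])
  next
    case False
    then have "b < weight u S' S D \<omega>" for \<omega>
      using weight_nonneg[of u S' S D \<omega>] by linarith
    then show ?thesis by simp
  qed
qed

lemma weight_decoupling:
  fixes z n
  defines "L \<equiv> lattice_box z n"
  assumes n: "n \<ge> 1" and S: "finite S" and C: "C \<in> convex_open_power T L"
    and D: "D \<in> convex_open_power T S" and u: "continuous_functional T u"
    and dist: "lattice_dist S L > ereal (g n)"
  shows "ennreal (exp (- c n)) * (\<integral>\<^sup>+\<omega>. weight u L L C \<omega> \<partial>M) * (\<integral>\<^sup>+\<omega>. weight u S S D \<omega> \<partial>M)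
      \<le> (\<integral>\<^sup>+\<omega>. ennreal (weight u L L C \<omega>) * ennreal (weight u S S D \<omega>) \<partial>M)"
proof (rule emeasure_decoupling_imp_nn_integral)
  show "sigma_finite_measure M" by unfold_locales
  have L: "finite L" by (simp add: L_def)
  show "weight u L L C \<in> borel_measurable M" "weight u S S D \<in> borel_measurable M"
    using weight_measurable[OF C u L] weight_measurable[OF D u S] by auto
  fix a b :: real assume ab: "0 \<le> a" "0 \<le> b"
  define C' where "C' = {\<xi> \<in> C. a < exp (u (\<Sum>z\<in>L. \<xi> z))}"
  define D' where "D' = {\<xi> \<in> D. b < exp (u (\<Sum>z\<in>S. \<xi> z))}"
  have C': "C' \<in> convex_open_power T L" unfolding C'_def
    by (rule convex_open_power_weight[OF C u L subset_refl ab(1)])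
  have D': "D' \<in> convex_open_power T S" unfolding D'_def
    by (rule convex_open_power_weight[OF D u S subset_refl ab(2)])
  have aw: "a < weight u L L C \<omega> \<longleftrightarrow> restrict (\<eta> \<omega>) L \<in> C'" for \<omega>
    unfolding C'_def by (rule weight_superlevel[OF subset_refl ab(1)])
  have bw: "b < weight u S S D \<omega> \<longleftrightarrow> restrict (\<eta> \<omega>) S \<in> D'" for \<omega>
    unfolding D'_def by (rule weight_superlevel[OF subset_refl ab(2)])
  have "exp (- c n) * measure M {\<omega>\<in>space M. restrict (\<eta> \<omega>) L \<in> C'}
          * measure M {\<omega>\<in>space M. restrict (\<eta> \<omega>) S \<in> D'}
        \<le> measure M {\<omega>\<in>space M. restrict (\<eta> \<omega>) L \<in> C' \<and> restrict (\<eta> \<omega>) S \<in> D'}"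
    using decoupling[OF n S C'[unfolded L_def] D' dist[unfolded L_def]] by (simp add: L_def)
  then have "ennreal (exp (- c n) * measure M {\<omega>\<in>space M. restrict (\<eta> \<omega>) L \<in> C'}
          * measure M {\<omega>\<in>space M. restrict (\<eta> \<omega>) S \<in> D'})
        \<le> ennreal (measure M {\<omega>\<in>space M. restrict (\<eta> \<omega>) L \<in> C' \<and> restrict (\<eta> \<omega>) S \<in> D'})"
    by (rule ennreal_leI)
  then show "ennreal (exp (- c n)) * emeasure M {\<omega>\<in>space M. a < weight u L L C \<omega>}
        * emeasure M {\<omega>\<in>space M. b < weight u S S D \<omega>}
      \<le> emeasure M {\<omega>\<in>space M. a < weight u L L C \<omega> \<and> b < weight u S S D \<omega>}"
    unfolding aw bw by (simp add: emeasure_eq_measure ennreal_mult)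
qed

lemma weight_conditioning:
  assumes V: "V \<in> B" and S: "finite S" "S' \<subseteq> S" and z: "z \<notin> S"
    and D: "D \<in> convex_open_power T S" and u: "continuous_functional T u"
  shows "ennreal (\<alpha> V) * (\<integral>\<^sup>+\<omega>. weight u S' S D \<omega> \<partial>M)
      \<le> (\<integral>\<^sup>+\<omega>. ennreal (weight u S' S D \<omega>) * indicator {\<omega>\<in>space M. \<eta> \<omega> z \<in> dilate (t V) V} \<omega> \<partial>M)"
proof (rule emeasure_conditioning_imp_nn_integral)
  show "sigma_finite_measure M" by unfold_locales
  show "weight u S' S D \<in> borel_measurable M" by (rule weight_measurable[OF D u S])
  have "openin T (dilate (t V) V)"
    using t\<alpha>[OF V] by (intro openin_dilate base_open V) auto
  then show "{\<omega>\<in>space M. \<eta> \<omega> z \<in> dilate (t V) V} \<in> sets M"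
    using measurable_sets[OF measurable_field openin_imp_sets_borel_of]
    by (simp add: vimage_def Int_def conj_commute)
  fix b :: real assume b: "0 \<le> b"
  define D' where "D' = {\<xi> \<in> D. b < exp (u (\<Sum>z\<in>S'. \<xi> z))}"
  have D': "D' \<in> convex_open_power T S" unfolding D'_def
    by (rule convex_open_power_weight[OF D u S b])
  have bw: "b < weight u S' S D \<omega> \<longleftrightarrow> restrict (\<eta> \<omega>) S \<in> D'" for \<omega>
    unfolding D'_def by (rule weight_superlevel[OF S(2) b])
  have "ennreal (\<alpha> V * measure M {\<omega>\<in>space M. restrict (\<eta> \<omega>) S \<in> D'})
      \<le> ennreal (measure M {\<omega>\<in>space M. \<eta> \<omega> z \<in> dilate (t V) V \<and> restrict (\<eta> \<omega>) S \<in> D'})"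
    using conditioning[OF V S(1) z D'] by (rule ennreal_leI)
  then show "ennreal (\<alpha> V) * emeasure M {\<omega>\<in>space M. b < weight u S' S D \<omega>}
      \<le> emeasure M {\<omega>\<in>space M. \<omega> \<in> {\<omega>\<in>space M. \<eta> \<omega> z \<in> dilate (t V) V} \<and> b < weight u S' S D \<omega>}"
    unfolding bw using t\<alpha>[OF V] by (simp add: emeasure_eq_measure ennreal_mult cong: conj_cong)
qed

text \<open>Tiles are added one at a time, each decoupled from the union of those already present.
  c.a.d.i. admits an arbitrary finite set on the far side, so the price \<open>exp (- c m)\<close>
  per tile does not depend on how many there are.\<close>

lemma weight_tiles:
  assumes m: "m \<ge> 1" and u: "continuous_functional T u" and "finite I" and N: "g m < real_of_int N" "N \<ge> 1"
    and "\<And>a b s w. a \<in> I \<Longrightarrow> b \<in> I \<Longrightarrow> a \<noteq> b \<Longrightarrow> s \<in> lattice_box a m \<Longrightarrow> w \<in> lattice_box b m \<Longrightarrow>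
      N \<le> sup_norm (s - w)"
    and "\<And>a. a \<in> I \<Longrightarrow> D a \<in> convex_open_power T (lattice_box a m)"
  defines "E \<equiv> \<lambda>I. {\<xi> \<in> (\<Union>a\<in>I. lattice_box a m) \<rightarrow>\<^sub>E topspace T. \<forall>a\<in>I. restrict \<xi> (lattice_box a m) \<in> D a}"
  shows "E I \<in> convex_open_power T (\<Union>a\<in>I. lattice_box a m) \<and>
    (\<Prod>a\<in>I. ennreal (exp (- c m)) * (\<integral>\<^sup>+\<omega>. weight u (lattice_box a m) (lattice_box a m) (D a) \<omega> \<partial>M))
      \<le> (\<integral>\<^sup>+\<omega>. weight u (\<Union>a\<in>I. lattice_box a m) (\<Union>a\<in>I. lattice_box a m) (E I) \<omega> \<partial>M)"
  using assms(3,6,7)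
proof (induction I rule: finite_induct)
  case empty
  have E: "E {} = {} \<rightarrow>\<^sub>E topspace T" by (simp add: E_def)
  have "u 0 = 0" using functional_scale[OF u zero_in, of 0] by simp
  then have "weight u {} {} (E {}) \<omega> = 1" for \<omega>
    unfolding weight_def E by (simp add: restrict_def)
  then show ?case using convex_open_power_full[of "{} :: (int^'d) set"] E
    by (simp add: emeasure_space_1)
next
  case (insert a I)
  define S where "S = (\<Union>a\<in>I. lattice_box a m)"
  define L where "L = lattice_box a m"
  have fin: "finite S" "finite L" using insert.hyps by (auto simp: S_def L_def)
  have sep: "N \<le> sup_norm (s - w)" if "s \<in> S" "w \<in> L" for s w
    using that insert.prems(1) insert.hyps unfolding S_def L_def by blast
  have dist: "lattice_dist S L > ereal (g m)" using sep N(1) by (rule lattice_dist_greater)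
  have disj: "L \<inter> S = {}"
  proof -
    have False if "s \<in> L" "s \<in> S" for s
    proof -
      \<comment> \<open>A common point would be at distance 0 from itself, against N \<ge> 1, so
        separation includes disjointness.\<close>
      have "N \<le> sup_norm (s - s)" by (rule sep[OF that(2,1)])
      then show False using N(2) by (simp add: sup_norm_def)
    qed
    then show ?thesis by blast
  qed
  have IH: "E I \<in> convex_open_power T S"
    "(\<Prod>a\<in>I. ennreal (exp (- c m)) * (\<integral>\<^sup>+\<omega>. weight u (lattice_box a m) (lattice_box a m) (D a) \<omega> \<partial>M))
      \<le> (\<integral>\<^sup>+\<omega>. weight u S S (E I) \<omega> \<partial>M)"
    using insert.IH insert.prems unfolding S_def by blast+
  have Da: "D a \<in> convex_open_power T L" using insert.prems by (simp add: L_def)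
  have un: "(\<Union>a\<in>insert a I. lattice_box a m) = L \<union> S" by (simp add: S_def L_def)
  have restr: "restrict (restrict \<xi> S) (lattice_box b m) = restrict \<xi> (lattice_box b m)" if "b \<in> I" for b \<xi>
  proof -
    have "lattice_box b m \<subseteq> S" using that by (auto simp: S_def)
    then show ?thesis by (simp add: Int_absorb1)
  qed
  have mem: "\<xi> \<in> E (insert a I) \<longleftrightarrow> \<xi> \<in> (L \<union> S) \<rightarrow>\<^sub>E topspace T \<and> restrict \<xi> L \<in> D a \<and> restrict \<xi> S \<in> E I" for \<xi>
  proof -
    have "restrict \<xi> S \<in> S \<rightarrow>\<^sub>E topspace T" if "\<xi> \<in> (L \<union> S) \<rightarrow>\<^sub>E topspace T" using that by auto
    then have "restrict \<xi> S \<in> E I \<longleftrightarrow> (\<forall>b\<in>I. restrict \<xi> (lattice_box b m) \<in> D b)"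
      if "\<xi> \<in> (L \<union> S) \<rightarrow>\<^sub>E topspace T"
      using that unfolding E_def S_def[symmetric] mem_Collect_eq by (metis restr)
    then show ?thesis unfolding E_def un L_def by blast
  qed
  have E: "E (insert a I) \<in> convex_open_power T (L \<union> S)"
  proof -
    have "E (insert a I) = {\<xi> \<in> (L \<union> S) \<rightarrow>\<^sub>E topspace T. restrict \<xi> L \<in> D a}
        \<inter> {\<xi> \<in> (L \<union> S) \<rightarrow>\<^sub>E topspace T. restrict \<xi> S \<in> E I}" using mem by blast
    then show ?thesis
      by (simp add: convex_open_power_Int convex_open_power_restrict[OF Da] convex_open_power_restrict[OF IH(1)])
  qed
  \<comment> \<open>Disjointness makes both the exponential and the indicator factorise.\<close>
  have split: "weight u (L \<union> S) (L \<union> S) (E (insert a I)) \<omega> = weight u L L (D a) \<omega> * weight u S S (E I) \<omega>"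
    if w: "\<omega> \<in> space M" for \<omega>
  proof -
    have "(\<Sum>z\<in>L \<union> S. \<eta> \<omega> z) = (\<Sum>z\<in>L. \<eta> \<omega> z) + (\<Sum>z\<in>S. \<eta> \<omega> z)"
      using fin disj by (intro sum.union_disjoint) auto
    then have "u (\<Sum>z\<in>L \<union> S. \<eta> \<omega> z) = u (\<Sum>z\<in>L. \<eta> \<omega> z) + u (\<Sum>z\<in>S. \<eta> \<omega> z)"
      by (simp add: functional_add[OF u] sum_in field_in[OF w])
    moreover have "restrict (restrict (\<eta> \<omega>) (L \<union> S)) L = restrict (\<eta> \<omega>) L"
      "restrict (restrict (\<eta> \<omega>) (L \<union> S)) S = restrict (\<eta> \<omega>) S" by (simp_all add: Int_absorb1)
    ultimately show ?thesis
      using field_restrict_in[OF w, of "L \<union> S"] by (auto simp: weight_def indicator_def mem exp_add)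
  qed
  have "(\<Prod>a\<in>insert a I. ennreal (exp (- c m)) * (\<integral>\<^sup>+\<omega>. weight u (lattice_box a m) (lattice_box a m) (D a) \<omega> \<partial>M))
      \<le> ennreal (exp (- c m)) * (\<integral>\<^sup>+\<omega>. weight u L L (D a) \<omega> \<partial>M) * (\<integral>\<^sup>+\<omega>. weight u S S (E I) \<omega> \<partial>M)"
    using insert.hyps IH(2) by (simp add: L_def[symmetric] mult_left_mono)
  also have "\<dots> \<le> (\<integral>\<^sup>+\<omega>. ennreal (weight u L L (D a) \<omega>) * ennreal (weight u S S (E I) \<omega>) \<partial>M)"
    unfolding L_def by (rule weight_decoupling[OF m fin(1) Da[unfolded L_def] IH(1) u dist[unfolded L_def]])
  also have "\<dots> = (\<integral>\<^sup>+\<omega>. weight u (L \<union> S) (L \<union> S) (E (insert a I)) \<omega> \<partial>M)"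
    by (intro nn_integral_cong) (simp add: split ennreal_mult)
  finally show ?case using E unfolding un by blast
qed

text \<open>The sites outside the tiles are added one at a time. Each is new to the constrained set,
  as c.l. requires, and costs a factor \<open>\<alpha> V\<close>.\<close>

lemma weight_leftover:
  assumes V: "V \<in> B" and u: "continuous_functional T u" and "finite R" and S: "finite S"
    and "R \<inter> S = {}" and D: "D \<in> convex_open_power T S"
  defines "E \<equiv> \<lambda>R. {\<xi> \<in> (S \<union> R) \<rightarrow>\<^sub>E topspace T. restrict \<xi> S \<in> D \<and> (\<forall>z\<in>R. \<xi> z \<in> dilate (t V) V)}"
  shows "E R \<in> convex_open_power T (S \<union> R) \<and>
    ennreal (\<alpha> V ^ card R) * (\<integral>\<^sup>+\<omega>. weight u S S D \<omega> \<partial>M) \<le> (\<integral>\<^sup>+\<omega>. weight u S (S \<union> R) (E R) \<omega> \<partial>M)"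
  using assms(3,5)
proof (induction R rule: finite_induct)
  case empty
  have "E {} = D"
  proof -
    have "restrict \<xi> S = \<xi>" if "\<xi> \<in> S \<rightarrow>\<^sub>E topspace T" for \<xi> using that by (rule PiE_restrict)
    then have "restrict \<xi> S = \<xi>" if "\<xi> \<in> D" for \<xi> using convex_open_power_subset[OF D that] by blast
    moreover have "restrict \<xi> S = \<xi>" if "\<xi> \<in> (S \<union> {}) \<rightarrow>\<^sub>E topspace T" for \<xi>
      using that by (simp add: PiE_restrict)
    ultimately show ?thesis unfolding E_def using convex_open_power_subset[OF D] by fastforce
  qed
  then show ?case using D by simp
next
  case (insert z R)
  have a: "0 < \<alpha> V" using t\<alpha>[OF V] by simp
  have z: "z \<notin> S \<union> R" using insert by auto
  have fin: "finite (S \<union> R)" using S insert by simp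
  have IH: "E R \<in> convex_open_power T (S \<union> R)"
    "ennreal (\<alpha> V ^ card R) * (\<integral>\<^sup>+\<omega>. weight u S S D \<omega> \<partial>M) \<le> (\<integral>\<^sup>+\<omega>. weight u S (S \<union> R) (E R) \<omega> \<partial>M)"
    using insert by auto
  have tV: "openin T (dilate (t V) V)" "convex (dilate (t V) V)"
    using t\<alpha>[OF V] by (intro openin_dilate convex_dilate base_open base_convex V; simp)+
  have mem: "\<xi> \<in> E (insert z R) \<longleftrightarrow> \<xi> \<in> (S \<union> insert z R) \<rightarrow>\<^sub>E topspace T \<and>
      restrict \<xi> (S \<union> R) \<in> E R \<and> \<xi> z \<in> dilate (t V) V" for \<xi>
  proof -
    have "restrict \<xi> (S \<union> R) \<in> S \<union> R \<rightarrow>\<^sub>E topspace T" if "\<xi> \<in> (S \<union> insert z R) \<rightarrow>\<^sub>E topspace T"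
      using that by auto
    moreover have "restrict (restrict \<xi> (S \<union> R)) S = restrict \<xi> S" by (simp add: Int_absorb1)
    ultimately show ?thesis unfolding E_def by auto
  qed
  have E: "E (insert z R) \<in> convex_open_power T (S \<union> insert z R)"
  proof -
    have "E (insert z R) = {\<xi> \<in> (S \<union> insert z R) \<rightarrow>\<^sub>E topspace T. restrict \<xi> (S \<union> R) \<in> E R}
        \<inter> {\<xi> \<in> (S \<union> insert z R) \<rightarrow>\<^sub>E topspace T. 1 *\<^sub>R (\<Sum>w\<in>{z}. \<xi> w) \<in> dilate (t V) V}"
      using mem by auto
    also have "\<dots> \<in> convex_open_power T (S \<union> insert z R)"
      using fin by (intro convex_open_power_Int convex_open_power_restrict[OF IH(1)]
        convex_open_power_sum[OF tV]) auto
    finally show ?thesis .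
  qed
  have "ennreal (\<alpha> V ^ card (insert z R)) * (\<integral>\<^sup>+\<omega>. weight u S S D \<omega> \<partial>M)
      = ennreal (\<alpha> V) * (ennreal (\<alpha> V ^ card R) * (\<integral>\<^sup>+\<omega>. weight u S S D \<omega> \<partial>M))"
    using insert.hyps a by (simp add: ennreal_mult mult.assoc)
  also have "\<dots> \<le> ennreal (\<alpha> V) * (\<integral>\<^sup>+\<omega>. weight u S (S \<union> R) (E R) \<omega> \<partial>M)"
    by (intro mult_left_mono IH(2)) simp
  also have "\<dots> \<le> (\<integral>\<^sup>+\<omega>. ennreal (weight u S (S \<union> R) (E R) \<omega>) *
      indicator {\<omega>\<in>space M. \<eta> \<omega> z \<in> dilate (t V) V} \<omega> \<partial>M)"
    by (rule weight_conditioning[OF V fin _ z IH(1) u]) simp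
  also have "\<dots> = (\<integral>\<^sup>+\<omega>. weight u S (S \<union> insert z R) (E (insert z R)) \<omega> \<partial>M)"
  proof (intro nn_integral_cong)
    fix \<omega> assume w: "\<omega> \<in> space M"
    have "restrict (restrict (\<eta> \<omega>) (S \<union> insert z R)) (S \<union> R) = restrict (\<eta> \<omega>) (S \<union> R)"
    proof -
      have "(S \<union> insert z R) \<inter> (S \<union> R) = S \<union> R" by auto
      then show ?thesis by simp
    qed
    then show "ennreal (weight u S (S \<union> R) (E R) \<omega>) * indicator {\<omega>\<in>space M. \<eta> \<omega> z \<in> dilate (t V) V} \<omega>
        = ennreal (weight u S (S \<union> insert z R) (E (insert z R)) \<omega>)"
      using w field_restrict_in[OF w, of "S \<union> insert z R"] by (auto simp: weight_def indicator_def mem)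
  qed
  finally show ?case using E by blast
qed

section \<open>Restricted exponential moments\<close>

text \<open>One quantity for both sides of the theorem: u = 0 gives the probability that the mean
  lies in A, whose rate is the entropy, and A the whole space gives the exponential moment, whose
  rate is the pressure.\<close>

definition Z :: "('y \<Rightarrow> real) \<Rightarrow> nat \<Rightarrow> 'y set \<Rightarrow> ennreal" where
  "Z u n A = (\<integral>\<^sup>+\<omega>. ennreal (exp (u (\<Sum>z\<in>lattice_box 0 n. \<eta> \<omega> z)))
      * indicator A (box_mean (lattice_box 0 n) (\<eta> \<omega>)) \<partial>M)"

text \<open>The rate of \<open>Z u n A\<close> at size n is at least b. Without a logarithm this
  makes sense for the values 0 and \<infinity> too.\<close>

abbreviation grows :: "('y \<Rightarrow> real) \<Rightarrow> 'y set \<Rightarrow> real \<Rightarrow> nat \<Rightarrow> bool" where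
  "grows u A b n \<equiv> ennreal (exp (b * real n ^ CARD('d))) \<le> Z u n A"

lemma box_mean_in: "\<omega> \<in> space M \<Longrightarrow> box_mean L (\<eta> \<omega>) \<in> topspace T"
  unfolding box_mean_def by (intro scale_in sum_in field_in)

lemma box_mean_measurable:
  "(\<lambda>\<omega>. box_mean (lattice_box z n) (\<eta> \<omega>)) \<in> measurable M (borel_of T)"
  unfolding box_mean_def by (intro sum_borel_measurable separable measurable_field) simp

lemma exp_sum_measurable:
  assumes "continuous_functional T u" "finite S"
    and "\<And>z. z \<in> S \<Longrightarrow> (\<lambda>\<omega>. \<xi> \<omega> z) \<in> measurable N (borel_of T)"
  shows "(\<lambda>\<omega>. ennreal (exp (u (\<Sum>z\<in>S. \<xi> \<omega> z)))) \<in> borel_measurable N"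
proof -
  have "(\<lambda>\<omega>. 1 *\<^sub>R (\<Sum>z\<in>S. \<xi> \<omega> z)) \<in> measurable N (borel_of T)"
    by (intro sum_borel_measurable separable assms)
  moreover have "u \<in> borel_measurable (borel_of T)"
    using assms(1) by (intro continuous_map_borel_measurable) (simp add: continuous_functional_def)
  ultimately have "(\<lambda>\<omega>. u (1 *\<^sub>R (\<Sum>z\<in>S. \<xi> \<omega> z))) \<in> borel_measurable N"
    by (rule measurable_compose)
  then show ?thesis by simp
qed

text \<open>Invariance concerns the law on the product space, so the integrand is first seen as a
  measurable function of the whole configuration and the moment as an integral against that
  law.\<close>

lemma Z_translate:
  assumes u: "continuous_functional T u" and A: "openin T A" and a: "\<And>k. int l dvd a $ k"
  shows "(\<integral>\<^sup>+\<omega>. ennreal (exp (u (\<Sum>z\<in>lattice_box a n. \<eta> \<omega> z)))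
      * indicator A (box_mean (lattice_box a n) (\<eta> \<omega>)) \<partial>M) = Z u n A"
proof -
  define \<Phi> :: "(int ^ 'd \<Rightarrow> 'y) \<Rightarrow> ennreal" where "\<Phi> = (\<lambda>\<xi>. ennreal (exp (u (\<Sum>z\<in>lattice_box 0 n. \<xi> z)))
      * indicator A (box_mean (lattice_box 0 n) \<xi>))"
  let ?P = "PiM (UNIV :: (int ^ 'd) set) (\<lambda>_. borel_of T)"
  have comp: "(\<lambda>\<xi>. \<xi> z) \<in> measurable ?P (borel_of T)" for z
    by (rule measurable_component_singleton) simp
  have mean: "(\<lambda>\<xi>. box_mean (lattice_box 0 n) \<xi>) \<in> measurable ?P (borel_of T)"
    unfolding box_mean_def by (intro sum_borel_measurable separable comp) simp
  have "(indicator A :: 'y \<Rightarrow> ennreal) \<in> borel_measurable (borel_of T)"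
    using openin_imp_sets_borel_of[OF A] by simp
  then have ind: "(\<lambda>\<xi>. indicator A (box_mean (lattice_box 0 n) \<xi>) :: ennreal) \<in> borel_measurable ?P"
    by (rule measurable_compose[OF mean])
  have "(\<lambda>\<xi>. ennreal (exp (u (\<Sum>z\<in>lattice_box 0 n. \<xi> z)))) \<in> borel_measurable ?P"
    by (rule exp_sum_measurable[OF u _ comp]) simp
  then have \<Phi>: "\<Phi> \<in> borel_measurable ?P"
    unfolding \<Phi>_def using ind by (rule borel_measurable_times_ennreal)
  have shift: "(\<lambda>\<omega> z. \<eta> \<omega> (z + b)) \<in> measurable M ?P" for b
    by (rule measurable_PiM_single') (auto intro: measurable_field simp: field_in)
  have eq: "(\<Sum>z\<in>lattice_box a n. \<eta> \<omega> z) = (\<Sum>z\<in>lattice_box 0 n. \<eta> \<omega> (z + a))" for \<omega>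
    using lattice_box_translate[of 0 a n] by (simp add: sum.reindex)
  have mean_eq: "box_mean (lattice_box a n) (\<eta> \<omega>) = box_mean (lattice_box 0 n) (\<lambda>z. \<eta> \<omega> (z + a))" for \<omega>
    by (simp add: box_mean_def eq)
  have "(\<integral>\<^sup>+\<omega>. ennreal (exp (u (\<Sum>z\<in>lattice_box a n. \<eta> \<omega> z)))
      * indicator A (box_mean (lattice_box a n) (\<eta> \<omega>)) \<partial>M) = (\<integral>\<^sup>+\<omega>. \<Phi> (\<lambda>z. \<eta> \<omega> (z + a)) \<partial>M)"
    unfolding \<Phi>_def eq mean_eq ..
  also have "\<dots> = (\<integral>\<^sup>+\<xi>. \<Phi> \<xi> \<partial>distr M ?P (\<lambda>\<omega> z. \<eta> \<omega> (z + a)))"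
    by (rule nn_integral_distr[symmetric]) (use shift \<Phi> in auto)
  also have "distr M ?P (\<lambda>\<omega> z. \<eta> \<omega> (z + a)) = distr M ?P \<eta>"
    using invariance a unfolding translation_invariant_def by blast
  also have "(\<integral>\<^sup>+\<xi>. \<Phi> \<xi> \<partial>distr M ?P \<eta>) = (\<integral>\<^sup>+\<omega>. \<Phi> (\<eta> \<omega>) \<partial>M)"
    by (rule nn_integral_distr) (use shift[of 0] \<Phi> in auto)
  finally show ?thesis unfolding \<Phi>_def Z_def .
qed

definition mean_set :: "(int ^ 'd) set \<Rightarrow> 'y set \<Rightarrow> (int ^ 'd \<Rightarrow> 'y) set" where
  "mean_set L A = {\<xi> \<in> L \<rightarrow>\<^sub>E topspace T. (1 / real (card L)) *\<^sub>R (\<Sum>z\<in>L. \<xi> z) \<in> A}"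

lemma mean_set_convex_open:
  "openin T A \<Longrightarrow> convex A \<Longrightarrow> finite L \<Longrightarrow> mean_set L A \<in> convex_open_power T L"
  unfolding mean_set_def by (rule convex_open_power_sum) auto

lemma restrict_mean_set:
  "\<omega> \<in> space M \<Longrightarrow> restrict (\<eta> \<omega>) L \<in> mean_set L A \<longleftrightarrow> box_mean L (\<eta> \<omega>) \<in> A"
  using field_restrict_in[of \<omega> L] by (simp add: mean_set_def box_mean_def)

lemma weight_mean_set:
  assumes u: "continuous_functional T u" and A: "openin T A" and a: "\<And>k. int l dvd a $ k"
  shows "(\<integral>\<^sup>+\<omega>. weight u (lattice_box a n) (lattice_box a n) (mean_set (lattice_box a n) A) \<omega> \<partial>M) = Z u n A"
  by (subst Z_translate[OF assms, symmetric], intro nn_integral_cong) (auto simp: weight_def indicator_def restrict_mean_set)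

end

section \<open>From one box size to all larger ones\<close>

context decoupled_field
begin

text \<open>k tiles have their mean in the first set, the other tiles in the second, and the r sites
  outside the tiles have values in \<open>t(V) V\<close>. By convexity each of the three groups
  contributes a multiple of one point to the mean of the large box, which is the combination
  required to lie in \<open>A'\<close>. As u \<ge> -1 on \<open>V\<close>, each site outside the
  tiles lowers the exponent by at most \<open>t V\<close>.\<close>

lemma tile_estimate:
  fixes m n q K k :: nat
  assumes V: "V \<in> B" and u: "continuous_functional T u" and uV: "\<And>v. v \<in> V \<Longrightarrow> - 1 \<le> u v"
    and m: "m \<ge> 1" "m \<le> q" and q: "l dvd q" "g m < real q - real m + 1"
    and K: "q * K \<le> n" and k: "k \<le> K ^ CARD('d)"
    and A: "openin T A\<^sub>1" "convex A\<^sub>1" "A\<^sub>1 \<noteq> {}" "openin T A\<^sub>2" "convex A\<^sub>2" "A\<^sub>2 \<noteq> {}"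
  defines "r \<equiv> n ^ CARD('d) - K ^ CARD('d) * m ^ CARD('d)"
  assumes A': "\<And>x\<^sub>1 x\<^sub>2 v. x\<^sub>1 \<in> A\<^sub>1 \<Longrightarrow> x\<^sub>2 \<in> A\<^sub>2 \<Longrightarrow> v \<in> V \<Longrightarrow>
      (real (k * m ^ CARD('d)) / real (n ^ CARD('d))) *\<^sub>R x\<^sub>1
      + (real ((K ^ CARD('d) - k) * m ^ CARD('d)) / real (n ^ CARD('d))) *\<^sub>R x\<^sub>2
      + (real r * t V / real (n ^ CARD('d))) *\<^sub>R v \<in> A'"
  shows "(ennreal (exp (- c m)) * Z u m A\<^sub>1) ^ k * (ennreal (exp (- c m)) * Z u m A\<^sub>2) ^ (K ^ CARD('d) - k)
      * ennreal (\<alpha> V ^ r * exp (- (t V * real r))) \<le> Z u n A'"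
proof -
  define d where "d = CARD('d)"
  have qp: "q > 0" using m by simp
  define J where "J = (tile_origins q K :: (int ^ 'd) set)"
  have J: "finite J" "card J = K ^ d" using card_tile_origins[OF qp] by (simp_all add: J_def d_def)
  obtain J\<^sub>1 where J1: "J\<^sub>1 \<subseteq> J" "card J\<^sub>1 = k" "finite J\<^sub>1"
    using obtain_subset_with_card_n[of k J] k J by (auto simp: d_def)
  define J\<^sub>2 where "J\<^sub>2 = J - J\<^sub>1"
  have J2: "card J\<^sub>2 = K ^ d - k" "finite J\<^sub>2" "J\<^sub>1 \<inter> J\<^sub>2 = {}" "J\<^sub>1 \<union> J\<^sub>2 = J"
    using J J1 by (auto simp: J\<^sub>2_def card_Diff_subset)
  define A where "A = (\<lambda>a. if a \<in> J\<^sub>1 then A\<^sub>1 else A\<^sub>2)"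
  define L where "L = (\<lambda>a :: int ^ 'd. lattice_box a m)"
  define \<Lambda> where "\<Lambda> = lattice_box (0 :: int ^ 'd) n"
  define S where "S = (\<Union>a\<in>J. L a)"
  define R where "R = \<Lambda> - S"
  have Aopen: "openin T (A a)" and Aconvex: "convex (A a)" for a using A by (auto simp: A_def)
  have D: "mean_set (L a) (A a) \<in> convex_open_power T (lattice_box a m)" for a
    unfolding L_def by (rule mean_set_convex_open[OF Aopen Aconvex]) simp
  have gN: "g m < real_of_int (int q - int m + 1)" using q(2) by simp
  have sep: "int q - int m + 1 \<le> sup_norm (s - w)"
    if "a \<in> J" "b \<in> J" "a \<noteq> b" "s \<in> lattice_box a m" "w \<in> lattice_box b m" for a b s w
    using that unfolding J_def by (rule tile_separation)
  define E where "E = {\<xi> \<in> S \<rightarrow>\<^sub>E topspace T. \<forall>a\<in>J. restrict \<xi> (lattice_box a m) \<in> mean_set (L a) (A a)}"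
  have E: "E \<in> convex_open_power T S"
    and prod_le: "(\<Prod>a\<in>J. ennreal (exp (- c m)) *
        (\<integral>\<^sup>+\<omega>. weight u (L a) (L a) (mean_set (L a) (A a)) \<omega> \<partial>M)) \<le> (\<integral>\<^sup>+\<omega>. weight u S S E \<omega> \<partial>M)"
    using weight_tiles[OF m(1) u J(1) gN _ sep D] m(2) unfolding S_def E_def L_def by auto
  have S_sub: "S \<subseteq> \<Lambda>"
    unfolding S_def \<Lambda>_def L_def J_def using tile_subset[OF _ m(2) K] by blast
  have fin: "finite \<Lambda>" "finite S" "finite R"
    using S_sub finite_subset[of S \<Lambda>] by (auto simp: \<Lambda>_def R_def)
  have disjL: "L a \<inter> L b = {}" if "a \<in> J" "b \<in> J" "a \<noteq> b" for a b
  proof -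
    have False if "s \<in> L a" "s \<in> L b" for s
      using sep[OF \<open>a \<in> J\<close> \<open>b \<in> J\<close> \<open>a \<noteq> b\<close>, of s s] that m(2) by (simp add: L_def sup_norm_def)
    then show ?thesis by blast
  qed
  have "card S = (\<Sum>a\<in>J. card (L a))"
    unfolding S_def by (rule card_UN_disjoint) (use J disjL in \<open>auto simp: L_def\<close>)
  then have cardS: "card S = K ^ d * m ^ d" using J by (simp add: L_def d_def)
  have cardR: "card R = r"
    unfolding R_def r_def using S_sub fin cardS by (simp add: card_Diff_subset \<Lambda>_def d_def)
  have SR: "S \<union> R = \<Lambda>" "R \<inter> S = {}" using S_sub by (auto simp: R_def)
  define F where "F = {\<xi> \<in> (S \<union> R) \<rightarrow>\<^sub>E topspace T. restrict \<xi> S \<in> E \<and> (\<forall>z\<in>R. \<xi> z \<in> dilate (t V) V)}"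
  have left: "ennreal (\<alpha> V ^ r) * (\<integral>\<^sup>+\<omega>. weight u S S E \<omega> \<partial>M) \<le> (\<integral>\<^sup>+\<omega>. weight u S (S \<union> R) F \<omega> \<partial>M)"
    using weight_leftover[OF V u fin(3,2) SR(2) E] unfolding F_def cardR by blast
  have tpos: "t V > 0" "\<alpha> V > 0" using t\<alpha>[OF V] by auto
  have Vt: "v \<in> topspace T" if "v \<in> V" for v using openin_subset[OF base_open[OF V]] that by blast
  \<comment> \<open>The pointwise form of the estimate: on the event \<open>F\<close> the mean of
    the large box lies in \<open>A'\<close>, and the sites of \<open>R\<close> change the exponent
    by at least \<open>- t V * r\<close>.\<close>
  have point: "exp (- (t V * real r)) * weight u S (S \<union> R) F \<omega>
      \<le> exp (u (\<Sum>z\<in>\<Lambda>. \<eta> \<omega> z)) * indicator A' (box_mean \<Lambda> (\<eta> \<omega>))" if w: "\<omega> \<in> space M" for \<omega>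
  proof (cases "restrict (\<eta> \<omega>) (S \<union> R) \<in> F")
    case False
    then show ?thesis by (simp add: weight_def)
  next
    case True
    have rS: "restrict (restrict (\<eta> \<omega>) (S \<union> R)) S = restrict (\<eta> \<omega>) S" by (simp add: Int_absorb1)
    have inE: "restrict (\<eta> \<omega>) S \<in> E" and inV: "\<And>z. z \<in> R \<Longrightarrow> \<eta> \<omega> z \<in> dilate (t V) V"
      using True rS by (auto simp: F_def)
    have "\<exists>v\<in>V. \<eta> \<omega> z = t V *\<^sub>R v" if "z \<in> R" for z using inV[OF that] by (simp add: mem_dilate)
    then obtain v where v: "\<And>z. z \<in> R \<Longrightarrow> v z \<in> V" "\<And>z. z \<in> R \<Longrightarrow> \<eta> \<omega> z = t V *\<^sub>R v z" by metis
    \<comment> \<open>Together, the sites of \<open>R\<close> contribute r t(V) times a single point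
      v' of \<open>V\<close>.\<close>
    have "V \<noteq> {}" using base_zero[OF V] by blast
    then have "(\<Sum>z\<in>R. 1 *\<^sub>R v z) \<in> dilate (\<Sum>z\<in>R. 1) V"
      by (intro convex_sum_mem_dilate fin base_convex[OF V] v) auto
    then obtain v' where v': "v' \<in> V" "(\<Sum>z\<in>R. v z) = real r *\<^sub>R v'" by (auto simp: mem_dilate cardR)
    have sumR: "(\<Sum>z\<in>R. \<eta> \<omega> z) = (real r * t V) *\<^sub>R v'"
    proof -
      have "(\<Sum>z\<in>R. \<eta> \<omega> z) = (\<Sum>z\<in>R. t V *\<^sub>R v z)" using v(2) by (intro sum.cong) auto
      also have "\<dots> = t V *\<^sub>R (\<Sum>z\<in>R. v z)" by (simp add: scaleR_sum_right)
      finally show ?thesis using v'(2) by (simp add: mult.commute)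
    qed
    have sum\<Lambda>: "(\<Sum>z\<in>\<Lambda>. \<eta> \<omega> z) = (\<Sum>z\<in>S. \<eta> \<omega> z) + (\<Sum>z\<in>R. \<eta> \<omega> z)"
      unfolding SR(1)[symmetric] using fin SR(2) by (intro sum.union_disjoint) auto
    have "u (\<Sum>z\<in>\<Lambda>. \<eta> \<omega> z) = u (\<Sum>z\<in>S. \<eta> \<omega> z) + (real r * t V) * u v'"
      unfolding sum\<Lambda> sumR using functional_add[OF u] functional_scale[OF u Vt[OF v'(1)]]
      by (simp add: sum_in field_in[OF w] scale_in Vt[OF v'(1)])
    moreover have "(real r * t V) * (- 1) \<le> (real r * t V) * u v'"
      using uV[OF v'(1)] tpos by (intro mult_left_mono) auto
    ultimately have u_le: "- (t V * real r) + u (\<Sum>z\<in>S. \<eta> \<omega> z) \<le> u (\<Sum>z\<in>\<Lambda>. \<eta> \<omega> z)"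
      by (simp add: mult.commute)
    have mean: "box_mean (L a) (\<eta> \<omega>) \<in> A a" if a: "a \<in> J" for a
    proof -
      have "L a \<subseteq> S" using a by (auto simp: S_def)
      then have "restrict (restrict (\<eta> \<omega>) S) (L a) = restrict (\<eta> \<omega>) (L a)" by (simp add: Int_absorb1)
      then have "restrict (\<eta> \<omega>) (L a) \<in> mean_set (L a) (A a)" using inE a by (auto simp: E_def L_def)
      then show ?thesis by (simp add: restrict_mean_set[OF w])
    qed
    \<comment> \<open>All tiles with the same target \<open>C\<close> have equal size, so the sum
      over them is a multiple of one point of \<open>C\<close>. An empty family is included because
      \<open>C\<close> is nonempty.\<close>
    have tile: "\<exists>x\<in>C. (\<Sum>a\<in>J'. \<Sum>z\<in>L a. \<eta> \<omega> z) = real (card J' * m ^ d) *\<^sub>R x"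
      if J': "J' \<subseteq> J" "\<And>a. a \<in> J' \<Longrightarrow> A a = C" and C: "convex C" "C \<noteq> {}" for J' C
    proof -
      have fJ: "finite J'" using J' J finite_subset by blast
      have "(\<Sum>a\<in>J'. 1 *\<^sub>R box_mean (L a) (\<eta> \<omega>)) \<in> dilate (\<Sum>a\<in>J'. 1) C"
        by (rule convex_sum_mem_dilate[OF fJ C]) (use mean J' in auto)
      then obtain x where x: "x \<in> C" "(\<Sum>a\<in>J'. box_mean (L a) (\<eta> \<omega>)) = real (card J') *\<^sub>R x"
        by (auto simp: mem_dilate)
      have "(\<Sum>z\<in>L a. \<eta> \<omega> z) = real (m ^ d) *\<^sub>R box_mean (L a) (\<eta> \<omega>)" for a
        using m by (simp add: box_mean_def L_def d_def)
      then have "(\<Sum>a\<in>J'. \<Sum>z\<in>L a. \<eta> \<omega> z) = real (m ^ d) *\<^sub>R (\<Sum>a\<in>J'. box_mean (L a) (\<eta> \<omega>))"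
        by (simp add: scaleR_sum_right)
      then show ?thesis using x by (intro bexI[of _ x]) (simp_all add: mult.commute)
    qed
    obtain x\<^sub>1 where x1: "x\<^sub>1 \<in> A\<^sub>1" "(\<Sum>a\<in>J\<^sub>1. \<Sum>z\<in>L a. \<eta> \<omega> z) = real (k * m ^ d) *\<^sub>R x\<^sub>1"
      using tile[of J\<^sub>1 A\<^sub>1] J1 A by (auto simp: A_def)
    obtain x\<^sub>2 where x2: "x\<^sub>2 \<in> A\<^sub>2" "(\<Sum>a\<in>J\<^sub>2. \<Sum>z\<in>L a. \<eta> \<omega> z) = real ((K ^ d - k) * m ^ d) *\<^sub>R x\<^sub>2"
      using tile[of J\<^sub>2 A\<^sub>2] J2 A by (auto simp: A_def J\<^sub>2_def)
    have "(\<Sum>z\<in>S. \<eta> \<omega> z) = (\<Sum>a\<in>J. \<Sum>z\<in>L a. \<eta> \<omega> z)"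
      unfolding S_def by (rule sum.UNION_disjoint) (use J disjL in \<open>auto simp: L_def\<close>)
    also have "\<dots> = (\<Sum>a\<in>J\<^sub>1. \<Sum>z\<in>L a. \<eta> \<omega> z) + (\<Sum>a\<in>J\<^sub>2. \<Sum>z\<in>L a. \<eta> \<omega> z)"
      unfolding J2(4)[symmetric] using J1 J2 by (intro sum.union_disjoint) auto
    finally have "box_mean \<Lambda> (\<eta> \<omega>) = (real (k * m ^ d) / real (n ^ d)) *\<^sub>R x\<^sub>1
        + (real ((K ^ d - k) * m ^ d) / real (n ^ d)) *\<^sub>R x\<^sub>2 + (real r * t V / real (n ^ d)) *\<^sub>R v'"
      unfolding box_mean_def sum\<Lambda> sumR x1(2) x2(2) by (simp add: \<Lambda>_def d_def scaleR_add_right)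
    then have "box_mean \<Lambda> (\<eta> \<omega>) \<in> A'"
      using A'[OF x1(1) x2(1) v'(1)] by (simp add: d_def)
    then show ?thesis using True u_le by (simp add: weight_def flip: exp_add)
  qed
  have "(\<Prod>a\<in>J. ennreal (exp (- c m)) * (\<integral>\<^sup>+\<omega>. weight u (L a) (L a) (mean_set (L a) (A a)) \<omega> \<partial>M))
      = (\<Prod>a\<in>J. ennreal (exp (- c m)) * Z u m (A a))"
  proof (rule prod.cong[OF refl])
    fix a assume "a \<in> J"
    then have "int l dvd a $ k" for k using tile_origins_dvd[OF _ q(1)] by (auto simp: J_def)
    then show "ennreal (exp (- c m)) * (\<integral>\<^sup>+\<omega>. weight u (L a) (L a) (mean_set (L a) (A a)) \<omega> \<partial>M)
        = ennreal (exp (- c m)) * Z u m (A a)"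
      unfolding L_def by (simp add: weight_mean_set[OF u Aopen])
  qed
  also have "\<dots> = (\<Prod>a\<in>J\<^sub>1. ennreal (exp (- c m)) * Z u m (A a)) * (\<Prod>a\<in>J\<^sub>2. ennreal (exp (- c m)) * Z u m (A a))"
    unfolding J2(4)[symmetric] using J1 J2 by (intro prod.union_disjoint) auto
  also have "(\<Prod>a\<in>J\<^sub>1. ennreal (exp (- c m)) * Z u m (A a)) = (ennreal (exp (- c m)) * Z u m A\<^sub>1) ^ k"
    using J1 by (simp add: A_def)
  also have "(\<Prod>a\<in>J\<^sub>2. ennreal (exp (- c m)) * Z u m (A a)) = (\<Prod>a\<in>J\<^sub>2. ennreal (exp (- c m)) * Z u m A\<^sub>2)"
    by (intro prod.cong refl) (auto simp: A_def J\<^sub>2_def)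
  finally have "(ennreal (exp (- c m)) * Z u m A\<^sub>1) ^ k * (ennreal (exp (- c m)) * Z u m A\<^sub>2) ^ (K ^ d - k)
      \<le> (\<integral>\<^sup>+\<omega>. weight u S S E \<omega> \<partial>M)" (is "?P \<le> _")
    using prod_le J2(1) by simp
  then have "?P * ennreal (\<alpha> V ^ r * exp (- (t V * real r)))
      \<le> (\<integral>\<^sup>+\<omega>. weight u S S E \<omega> \<partial>M) * ennreal (\<alpha> V ^ r * exp (- (t V * real r)))"
    by (rule mult_right_mono) simp
  also have "\<dots> = ennreal (exp (- (t V * real r))) * (ennreal (\<alpha> V ^ r) * (\<integral>\<^sup>+\<omega>. weight u S S E \<omega> \<partial>M))"
    using tpos by (simp add: ennreal_mult mult_ac)
  also have "\<dots> \<le> ennreal (exp (- (t V * real r))) * (\<integral>\<^sup>+\<omega>. weight u S (S \<union> R) F \<omega> \<partial>M)"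
    by (rule mult_left_mono[OF left]) simp
  also have "\<dots> = (\<integral>\<^sup>+\<omega>. ennreal (exp (- (t V * real r))) * weight u S (S \<union> R) F \<omega> \<partial>M)"
  proof (rule nn_integral_cmult[symmetric])
    have "F \<in> convex_open_power T (S \<union> R)"
      using weight_leftover[OF V u fin(3,2) SR(2) E] unfolding F_def by blast
    then have "weight u S (S \<union> R) F \<in> borel_measurable M"
      using fin by (intro weight_measurable u) auto
    then show "(\<lambda>\<omega>. ennreal (weight u S (S \<union> R) F \<omega>)) \<in> borel_measurable M" by simp
  qed
  also have "\<dots> \<le> Z u n A'"
    unfolding Z_def
  proof (rule nn_integral_mono)
    fix \<omega> assume w: "\<omega> \<in> space M"
    have "ennreal (exp (- (t V * real r))) * ennreal (weight u S (S \<union> R) F \<omega>)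
        = ennreal (exp (- (t V * real r)) * weight u S (S \<union> R) F \<omega>)" by (simp add: ennreal_mult)
    also have "\<dots> \<le> ennreal (exp (u (\<Sum>z\<in>\<Lambda>. \<eta> \<omega> z)) * indicator A' (box_mean \<Lambda> (\<eta> \<omega>)))"
      using point[OF w] by (rule ennreal_leI)
    also have "\<dots> = ennreal (exp (u (\<Sum>z\<in>\<Lambda>. \<eta> \<omega> z))) * indicator A' (box_mean \<Lambda> (\<eta> \<omega>))"
      by (simp add: ennreal_mult ennreal_indicator)
    finally show "ennreal (exp (- (t V * real r))) * ennreal (weight u S (S \<union> R) F \<omega>)
        \<le> ennreal (exp (u (\<Sum>z\<in>lattice_box 0 n. \<eta> \<omega> z))) * indicator A' (box_mean (lattice_box 0 n) (\<eta> \<omega>))"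
      by (simp add: \<Lambda>_def)
  qed
  finally show ?thesis by (simp add: d_def)
qed

lemma Z_empty [simp]: "Z u n {} = 0"
  by (simp add: Z_def)

text \<open>The threshold m0 precedes the sets and the rates in the order of quantifiers, and rates
  at a single m \<ge> m0 decide about all large n. This order lets \<open>concentration_step\<close>
  choose a set after m. The weights \<kappa> are the proportions of sites in the two families of
  tiles, and \<delta> v is the share of the sites outside them.\<close>

definition mixing_scale :: "('y \<Rightarrow> real) \<Rightarrow> 'y set \<Rightarrow> real \<Rightarrow> nat \<Rightarrow> bool" where
  "mixing_scale u V \<delta> m0 \<longleftrightarrow> (\<forall>m\<ge>m0. \<forall>A\<^sub>1 A\<^sub>2 A' a b\<^sub>1 b\<^sub>2.
     openin T A\<^sub>1 \<and> convex A\<^sub>1 \<and> openin T A\<^sub>2 \<and> convex A\<^sub>2 \<and> 0 \<le> a \<and> a \<le> 1 \<and>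
     grows u A\<^sub>1 b\<^sub>1 m \<and>
     grows u A\<^sub>2 b\<^sub>2 m \<and>
     (\<forall>\<kappa>\<^sub>1 \<kappa>\<^sub>2 x\<^sub>1 x\<^sub>2 v. 0 \<le> \<kappa>\<^sub>1 \<longrightarrow> 0 \<le> \<kappa>\<^sub>2 \<longrightarrow> \<kappa>\<^sub>1 + \<kappa>\<^sub>2 \<le> 1 \<longrightarrow> \<bar>\<kappa>\<^sub>1 - a\<bar> \<le> \<delta> \<longrightarrow> \<bar>\<kappa>\<^sub>2 - (1 - a)\<bar> \<le> \<delta> \<longrightarrow>
        x\<^sub>1 \<in> A\<^sub>1 \<longrightarrow> x\<^sub>2 \<in> A\<^sub>2 \<longrightarrow> v \<in> V \<longrightarrow> \<kappa>\<^sub>1 *\<^sub>R x\<^sub>1 + \<kappa>\<^sub>2 *\<^sub>R x\<^sub>2 + \<delta> *\<^sub>R v \<in> A') \<longrightarrow>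
     (\<forall>\<^sub>F n in sequentially.
        grows u A' (a * b\<^sub>1 + (1 - a) * b\<^sub>2 - \<delta> * (2 + \<bar>b\<^sub>1\<bar> + \<bar>b\<^sub>2\<bar>)) n))"

lemma mixing_scaleD:
  assumes "mixing_scale u V \<delta> m0"
  shows "m \<ge> m0 \<Longrightarrow> openin T A\<^sub>1 \<Longrightarrow> convex A\<^sub>1 \<Longrightarrow>
      openin T A\<^sub>2 \<Longrightarrow> convex A\<^sub>2 \<Longrightarrow> 0 \<le> a \<Longrightarrow> a \<le> 1 \<Longrightarrow>
      grows u A\<^sub>1 b\<^sub>1 m \<Longrightarrow>
      grows u A\<^sub>2 b\<^sub>2 m \<Longrightarrow>
      (\<And>\<kappa>\<^sub>1 \<kappa>\<^sub>2 x\<^sub>1 x\<^sub>2 v. 0 \<le> \<kappa>\<^sub>1 \<Longrightarrow> 0 \<le> \<kappa>\<^sub>2 \<Longrightarrow> \<kappa>\<^sub>1 + \<kappa>\<^sub>2 \<le> 1 \<Longrightarrow> \<bar>\<kappa>\<^sub>1 - a\<bar> \<le> \<delta> \<Longrightarrow> \<bar>\<kappa>\<^sub>2 - (1 - a)\<bar> \<le> \<delta> \<Longrightarrow>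
        x\<^sub>1 \<in> A\<^sub>1 \<Longrightarrow> x\<^sub>2 \<in> A\<^sub>2 \<Longrightarrow> v \<in> V \<Longrightarrow> \<kappa>\<^sub>1 *\<^sub>R x\<^sub>1 + \<kappa>\<^sub>2 *\<^sub>R x\<^sub>2 + \<delta> *\<^sub>R v \<in> A') \<Longrightarrow>
      \<forall>\<^sub>F n in sequentially.
        grows u A' (a * b\<^sub>1 + (1 - a) * b\<^sub>2 - \<delta> * (2 + \<bar>b\<^sub>1\<bar> + \<bar>b\<^sub>2\<bar>)) n"
  by (rule assms[unfolded mixing_scale_def, rule_format], assumption, intro conjI allI impI) simp_all

text \<open>A proportion a of the tiles is assigned to the first set and the rest to the second.
  Only two things are asked of m: \<open>c m\<close> is small relative to the volume of a tile, and
  tiles of side m can fill almost the whole box. Neither involves the sets.\<close>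

lemma mixing_estimate:
  assumes V: "V \<in> B" and u: "continuous_functional T u" and uV: "\<And>v. v \<in> V \<Longrightarrow> - 1 \<le> u v"
    and \<delta>: "\<delta> > 0"
  shows "\<exists>m0. mixing_scale u V \<delta> m0"
proof -
  define d where "d = CARD('d)"
  define \<tau> where "\<tau> = t V"
  define \<beta> where "\<beta> = ln (\<alpha> V)"
  have \<tau>: "\<tau> > 0" and \<beta>: "\<beta> \<le> 0" and \<alpha>: "\<alpha> V > 0" "\<alpha> V = exp \<beta>"
    using t\<alpha>[OF V] by (auto simp: \<tau>_def \<beta>_def)
  \<comment> \<open>\<theta> bounds the proportion of sites outside the tiles. The three bounds
    serve, in turn, the accuracy of the weights, the displacement of the mean by at most \<delta>
    times a point of \<open>V\<close>, and the cost \<tau> - \<beta> per such site.\<close>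
  define \<theta> where "\<theta> = min (\<delta> / 4) (min (\<delta> / \<tau>) (\<delta> / (\<tau> - \<beta>)))"
  have \<theta>: "\<theta> > 0" "\<theta> \<le> \<delta> / 4" "\<theta> * \<tau> \<le> \<delta>" "\<theta> * (\<tau> - \<beta>) \<le> \<delta>"
  proof -
    have p: "\<tau> - \<beta> > 0" using \<tau> \<beta> by linarith
    show "\<theta> > 0" using \<delta> \<tau> p by (simp add: \<theta>_def)
    show "\<theta> \<le> \<delta> / 4" unfolding \<theta>_def by (rule min.cobounded1)
    have "\<theta> \<le> \<delta> / \<tau>" by (simp add: \<theta>_def)
    then show "\<theta> * \<tau> \<le> \<delta>" using \<tau> by (simp add: le_divide_eq)
    have "\<theta> \<le> \<delta> / (\<tau> - \<beta>)" by (simp add: \<theta>_def)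
    then show "\<theta> * (\<tau> - \<beta>) \<le> \<delta>" using p by (simp add: le_divide_eq)
  qed
  have g0: "\<And>n. n \<ge> 1 \<Longrightarrow> 0 \<le> g n" using gc by simp
  obtain m1 where m1: "m1 \<ge> 1" "\<And>m. m \<ge> m1 \<Longrightarrow> \<exists>q\<ge>m. l dvd q \<and> g m < real q - real m + 1 \<and>
      eventually (\<lambda>n. 1 - \<theta> \<le> (real (n div q * m) / real n) ^ d) sequentially"
    by (rule tiling_density[OF l g0 g_lim \<theta>(1), where d = d]) (assumption, blast)
  have "eventually (\<lambda>m. c m / real (card (lattice_box (0 :: int ^ 'd) m)) < \<delta>) sequentially"
    by (rule order_tendstoD(2)[OF c_lim \<delta>])
  then obtain m2 where m2: "\<And>m. m \<ge> m2 \<Longrightarrow> c m / real m ^ CARD('d) < \<delta>"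
    by (auto simp: eventually_sequentially)
  have "mixing_scale u V \<delta> (max m1 m2)"
    unfolding mixing_scale_def
  proof (intro allI impI, elim conjE)
    fix m A\<^sub>1 A\<^sub>2 A' and a b\<^sub>1 b\<^sub>2 :: real
    assume m: "max m1 m2 \<le> m" and A: "openin T A\<^sub>1" "convex A\<^sub>1" "openin T A\<^sub>2" "convex A\<^sub>2"
      and a: "0 \<le> a" "a \<le> 1"
      and Zm: "grows u A\<^sub>1 b\<^sub>1 m" "grows u A\<^sub>2 b\<^sub>2 m"
      and A': "\<forall>\<kappa>\<^sub>1 \<kappa>\<^sub>2 x\<^sub>1 x\<^sub>2 v. 0 \<le> \<kappa>\<^sub>1 \<longrightarrow> 0 \<le> \<kappa>\<^sub>2 \<longrightarrow> \<kappa>\<^sub>1 + \<kappa>\<^sub>2 \<le> 1 \<longrightarrow> \<bar>\<kappa>\<^sub>1 - a\<bar> \<le> \<delta> \<longrightarrow> \<bar>\<kappa>\<^sub>2 - (1 - a)\<bar> \<le> \<delta> \<longrightarrow>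
        x\<^sub>1 \<in> A\<^sub>1 \<longrightarrow> x\<^sub>2 \<in> A\<^sub>2 \<longrightarrow> v \<in> V \<longrightarrow> \<kappa>\<^sub>1 *\<^sub>R x\<^sub>1 + \<kappa>\<^sub>2 *\<^sub>R x\<^sub>2 + \<delta> *\<^sub>R v \<in> A'"
    have m': "m \<ge> 1" using m m1(1) by simp
    obtain q where q: "q \<ge> m" "l dvd q" "g m < real q - real m + 1"
      and dens: "eventually (\<lambda>n. 1 - \<theta> \<le> (real (n div q * m) / real n) ^ d) sequentially"
      using m1(2)[of m] m by auto
    define Mm where "Mm = real m ^ CARD('d)"
    have Mm: "Mm > 0" using m' by (simp add: Mm_def)
    have cm: "c m \<le> \<delta> * Mm" using m2[of m] m Mm by (simp add: Mm_def field_simps)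
    have ne: "A\<^sub>1 \<noteq> {}" "A\<^sub>2 \<noteq> {}" using Zm by auto
    \<comment> \<open>The number of tiles of the first kind is rounded to an integer; this shifts
      the weight by at most one tile, that is by \<open>m ^ d / n ^ d\<close>.\<close>
    have "(\<lambda>n. Mm / real n ^ CARD('d)) \<longlonglongrightarrow> 0"
      by (intro tendsto_divide_0[OF tendsto_const] filterlim_at_top_imp_at_infinity
          filterlim_pow_at_top filterlim_real_sequentially) simp
    then have "eventually (\<lambda>n. Mm / real n ^ CARD('d) < \<delta> / 4) sequentially"
      using \<delta> by (intro order_tendstoD) auto
    with dens eventually_ge_at_top[of 1]
    show "\<forall>\<^sub>F n in sequentially.
        grows u A' (a * b\<^sub>1 + (1 - a) * b\<^sub>2 - \<delta> * (2 + \<bar>b\<^sub>1\<bar> + \<bar>b\<^sub>2\<bar>)) n"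
    proof eventually_elim
      case n: (elim n)
      define K where "K = n div q"
      define k where "k = nat \<lfloor>a * real (K ^ d)\<rfloor>"
      define N where "N = real n ^ CARD('d)"
      define r where "r = n ^ d - K ^ d * m ^ d"
      define Q where "Q = real (K ^ d)"
      have N: "N > 0" using n by (simp add: N_def)
      have qK: "q * K \<le> n" by (simp add: K_def)
      have Q0: "Q \<ge> 0" by (simp add: Q_def)
      have aQ: "a * Q \<le> Q" using a Q0 by (simp add: mult_left_le_one_le)
      have k_le: "real k \<le> a * Q" and k_ge: "a * Q - 1 \<le> real k"
      proof -
        have "0 \<le> a * Q" using a Q0 by simp
        then have "real k = of_int \<lfloor>a * Q\<rfloor>" by (simp add: k_def Q_def)
        then show "real k \<le> a * Q" "a * Q - 1 \<le> real k" by linarith+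
      qed
      have kK: "k \<le> K ^ d" using k_le aQ unfolding Q_def by linarith
      have kR: "real (K ^ d - k) = Q - real k" using kK by (simp add: Q_def of_nat_diff)
      have Km: "K ^ d * m ^ d \<le> n ^ d"
      proof -
        have "K * m \<le> n" using qK q(1) by (metis mult.commute mult_le_mono2 order_trans)
        then show ?thesis by (metis power_mono power_mult_distrib zero_le)
      qed
      have QM: "Q * Mm = (real (K * m) / real n) ^ d * N"
        using N by (simp add: Q_def Mm_def N_def d_def power_mult_distrib power_divide)
      have QM_le: "Q * Mm \<le> N"
        using Km by (simp add: Q_def Mm_def N_def d_def flip: of_nat_power of_nat_mult)
      have "(1 - \<theta>) * N \<le> (real (K * m) / real n) ^ d * N"
        using n(1) N unfolding K_def by (intro mult_right_mono) auto
      then have QM_ge: "(1 - \<theta>) * N \<le> Q * Mm" by (simp only: QM)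
      have r: "real r = N - Q * Mm"
        using Km by (simp add: r_def of_nat_diff N_def Q_def Mm_def d_def)
      have r_le: "real r \<le> \<theta> * N" using QM_ge r by (simp add: algebra_simps)
      have Mm_le: "Mm \<le> \<delta> / 4 * N" using n(3) N by (simp add: N_def field_simps)
      define \<kappa>\<^sub>1 where "\<kappa>\<^sub>1 = real k * Mm / N"
      define \<kappa>\<^sub>2 where "\<kappa>\<^sub>2 = (Q - real k) * Mm / N"
      have \<kappa>0: "0 \<le> \<kappa>\<^sub>1" "0 \<le> \<kappa>\<^sub>2" using Mm N k_le aQ by (simp_all add: \<kappa>\<^sub>1_def \<kappa>\<^sub>2_def)
      have \<kappa>N: "\<kappa>\<^sub>1 * N = real k * Mm" "\<kappa>\<^sub>2 * N = (Q - real k) * Mm"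
        using N by (simp_all add: \<kappa>\<^sub>1_def \<kappa>\<^sub>2_def)
      have sumN: "(\<kappa>\<^sub>1 + \<kappa>\<^sub>2) * N = Q * Mm" unfolding distrib_right \<kappa>N by (simp add: algebra_simps)
      have sum_le: "\<kappa>\<^sub>1 + \<kappa>\<^sub>2 \<le> 1" 
      proof -
        have "(\<kappa>\<^sub>1 + \<kappa>\<^sub>2) * N \<le> 1 * N" using sumN QM_le by simp
        then show ?thesis using N by (rule mult_right_le_imp_le)
      qed
      have sum_ge: "1 - \<theta> \<le> \<kappa>\<^sub>1 + \<kappa>\<^sub>2" 
      proof -
        have "(1 - \<theta>) * N \<le> (\<kappa>\<^sub>1 + \<kappa>\<^sub>2) * N" using sumN QM_ge by simp
        then show ?thesis using N by (rule mult_right_le_imp_le)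
      qed
      have k1_le: "\<kappa>\<^sub>1 \<le> a"
      proof -
        have "\<kappa>\<^sub>1 * N \<le> a * Q * Mm" unfolding \<kappa>N using k_le Mm by (intro mult_right_mono) auto
        also have "\<dots> \<le> a * N" using QM_le a by (simp add: mult.assoc mult_left_mono)
        finally show ?thesis using N by simp
      qed
      \<comment> \<open>\<theta> accounts for the sites outside the tiles and \<delta> / 4 for the
        rounding of k.\<close>
      have k1_ge: "a - \<theta> - \<delta> / 4 \<le> \<kappa>\<^sub>1"
      proof -
        have "(a * Q - 1) * Mm \<le> \<kappa>\<^sub>1 * N" unfolding \<kappa>N using k_ge Mm by (intro mult_right_mono) auto
        moreover have "a * ((1 - \<theta>) * N) \<le> a * (Q * Mm)" using QM_ge a by (intro mult_left_mono)
        moreover have "a * (\<theta> * N) \<le> 1 * (\<theta> * N)" using a \<theta> N by (intro mult_right_mono) auto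
        ultimately have "(a - \<theta> - \<delta> / 4) * N \<le> \<kappa>\<^sub>1 * N" using Mm_le by (simp add: algebra_simps)
        then show ?thesis using N by simp
      qed
      have near: "\<bar>\<kappa>\<^sub>1 - a\<bar> \<le> \<delta>" "\<bar>\<kappa>\<^sub>2 - (1 - a)\<bar> \<le> \<delta>"
        using k1_le k1_ge sum_le sum_ge \<theta>(2) \<delta> unfolding abs_le_iff by linarith+
      have est: "(ennreal (exp (- c m)) * Z u m A\<^sub>1) ^ k * (ennreal (exp (- c m)) * Z u m A\<^sub>2) ^ (K ^ CARD('d) - k)
          * ennreal (\<alpha> V ^ r * exp (- (t V * real r))) \<le> Z u n A'"
        unfolding r_def d_def
      proof (rule tile_estimate[OF V u uV m' q(1,2,3) qK kK[unfolded d_def] A(1,2) ne(1) A(3,4) ne(2)])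
        fix x\<^sub>1 x\<^sub>2 v assume x: "x\<^sub>1 \<in> A\<^sub>1" "x\<^sub>2 \<in> A\<^sub>2" "v \<in> V"
        \<comment> \<open>The actual coefficient of v is at most \<delta>. Shrinking v by s stays in
          \<open>V\<close>, by convexity and 0 \<in> \<open>V\<close>, and makes the coefficient
          exactly \<delta>, as \<open>mixing_scale\<close> requires.\<close>
        define s where "s = real r * \<tau> / (N * \<delta>)"
        have "s \<ge> 0" using \<tau> N \<delta> by (simp add: s_def)
        moreover have "s \<le> 1"
        proof -
          have "real r * \<tau> \<le> (\<theta> * N) * \<tau>" using r_le \<tau> by (intro mult_right_mono) auto
          also have "\<dots> = (\<theta> * \<tau>) * N" by simp
          also have "\<dots> \<le> \<delta> * N" using \<theta>(3) N by (intro mult_right_mono) auto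
          finally show ?thesis using N \<delta> by (simp add: s_def mult.commute)
        qed
        ultimately have "s *\<^sub>R v \<in> V"
          using convexD[OF base_convex[OF V] x(3) base_zero[OF V], of s "1 - s"] by simp
        then have "\<kappa>\<^sub>1 *\<^sub>R x\<^sub>1 + \<kappa>\<^sub>2 *\<^sub>R x\<^sub>2 + \<delta> *\<^sub>R (s *\<^sub>R v) \<in> A'"
          using A' \<kappa>0 sum_le near x by blast
        moreover have "\<delta> * s = real r * \<tau> / N" using \<delta> by (simp add: s_def)
        ultimately show "(real (k * m ^ CARD('d)) / real (n ^ CARD('d))) *\<^sub>R x\<^sub>1
            + (real ((K ^ CARD('d) - k) * m ^ CARD('d)) / real (n ^ CARD('d))) *\<^sub>R x\<^sub>2
            + (real (n ^ CARD('d) - K ^ CARD('d) * m ^ CARD('d)) * t V / real (n ^ CARD('d))) *\<^sub>R v \<in> A'"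
          using kR by (simp add: \<kappa>\<^sub>1_def \<kappa>\<^sub>2_def N_def Mm_def d_def r_def \<tau>_def)
      qed
      have pw: "ennreal (exp (real j * (b * Mm - c m))) \<le> (ennreal (exp (- c m)) * Z u m A) ^ j"
        if "grows u A b m" for j b A
      proof -
        have "ennreal (exp (b * Mm - c m)) = ennreal (exp (- c m)) * ennreal (exp (b * real m ^ CARD('d)))"
          by (simp add: Mm_def flip: ennreal_mult exp_add)
        also have "\<dots> \<le> ennreal (exp (- c m)) * Z u m A" using that by (rule mult_left_mono) simp
        finally have "ennreal (exp (b * Mm - c m)) ^ j \<le> (ennreal (exp (- c m)) * Z u m A) ^ j"
          by (rule power_mono) simp
        then show ?thesis by (simp add: ennreal_power exp_of_nat_mult)
      qed
      have "exp (real k * (b\<^sub>1 * Mm - c m)) * exp ((Q - real k) * (b\<^sub>2 * Mm - c m)) * exp (real r * \<beta> - \<tau> * real r)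
          = exp (b\<^sub>1 * (\<kappa>\<^sub>1 * N) + b\<^sub>2 * (\<kappa>\<^sub>2 * N) - Q * c m - real r * (\<tau> - \<beta>))"
        unfolding \<kappa>N by (simp add: algebra_simps flip: exp_add)
      \<comment> \<open>The loss consists of \<delta> for the decoupling costs \<open>c m\<close>,
        \<delta> for the sites outside the tiles, and \<delta> times the absolute value of each rate
        for the inaccuracy of its weight.\<close>
      also have "\<dots> \<ge> exp ((a * b\<^sub>1 + (1 - a) * b\<^sub>2 - \<delta> * (2 + \<bar>b\<^sub>1\<bar> + \<bar>b\<^sub>2\<bar>)) * N)"
      proof (subst exp_le_cancel_iff)
        have "Q * c m \<le> Q * (\<delta> * Mm)" using cm Q0 by (intro mult_left_mono)
        also have "\<dots> = \<delta> * (Q * Mm)" by simp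
        also have "\<dots> \<le> \<delta> * N" using QM_le \<delta> by (intro mult_left_mono) auto
        finally have e1: "Q * c m \<le> \<delta> * N" .
        have "real r * (\<tau> - \<beta>) \<le> (\<theta> * N) * (\<tau> - \<beta>)" using r_le \<tau> \<beta> by (intro mult_right_mono) auto
        also have "\<dots> = (\<theta> * (\<tau> - \<beta>)) * N" by simp
        also have "\<dots> \<le> \<delta> * N" using \<theta>(4) N by (intro mult_right_mono) auto
        finally have e2: "real r * (\<tau> - \<beta>) \<le> \<delta> * N" .
        have e3: "(x * b - \<delta> * \<bar>b\<bar>) * N \<le> b * (\<kappa> * N)" if "\<bar>\<kappa> - x\<bar> \<le> \<delta>" for x b \<kappa>
        proof -
          have "\<bar>(\<kappa> - x) * b\<bar> \<le> \<delta> * \<bar>b\<bar>" unfolding abs_mult using that by (intro mult_right_mono) auto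
          then have "x * b - \<delta> * \<bar>b\<bar> \<le> \<kappa> * b" by (simp add: algebra_simps abs_le_iff)
          then have "(x * b - \<delta> * \<bar>b\<bar>) * N \<le> (\<kappa> * b) * N" using N by (intro mult_right_mono) auto
          then show ?thesis by (simp add: mult_ac)
        qed
        show "(a * b\<^sub>1 + (1 - a) * b\<^sub>2 - \<delta> * (2 + \<bar>b\<^sub>1\<bar> + \<bar>b\<^sub>2\<bar>)) * N
            \<le> b\<^sub>1 * (\<kappa>\<^sub>1 * N) + b\<^sub>2 * (\<kappa>\<^sub>2 * N) - Q * c m - real r * (\<tau> - \<beta>)"
          using e1 e2 e3[OF near(1), of b\<^sub>1] e3[OF near(2), of b\<^sub>2] by (simp add: algebra_simps)
      qed
      finally have "ennreal (exp ((a * b\<^sub>1 + (1 - a) * b\<^sub>2 - \<delta> * (2 + \<bar>b\<^sub>1\<bar> + \<bar>b\<^sub>2\<bar>)) * N))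
          \<le> ennreal (exp (real k * (b\<^sub>1 * Mm - c m)) * exp ((Q - real k) * (b\<^sub>2 * Mm - c m))
              * exp (real r * \<beta> - \<tau> * real r))"
        by (rule ennreal_leI)
      also have "\<dots> = ennreal (exp (real k * (b\<^sub>1 * Mm - c m))) * ennreal (exp (real (K ^ d - k) * (b\<^sub>2 * Mm - c m)))
          * ennreal (\<alpha> V ^ r * exp (- (t V * real r)))"
      proof -
        have "exp (real r * \<beta> - \<tau> * real r) = \<alpha> V ^ r * exp (- (t V * real r))"
          by (simp add: \<alpha>(2) \<tau>_def flip: exp_of_nat_mult exp_add)
        then show ?thesis by (simp only: kR) (simp add: ennreal_mult \<alpha>(1) less_imp_le)
      qed
      also have "\<dots> \<le> (ennreal (exp (- c m)) * Z u m A\<^sub>1) ^ k * (ennreal (exp (- c m)) * Z u m A\<^sub>2) ^ (K ^ d - k)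
          * ennreal (\<alpha> V ^ r * exp (- (t V * real r)))"
        by (intro mult_right_mono mult_mono pw Zm) auto
      also have "\<dots> \<le> Z u n A'" using est by (simp add: d_def)
      finally show ?case by (simp add: N_def)
    qed
  qed
  then show ?thesis ..
qed

end

section \<open>Entropy of convex sets\<close>

lemma scaleR_dilate_mono:
  assumes "convex V" "0 \<in> V" "x \<in> dilate r V" "0 \<le> a" "0 \<le> r" "a * r \<le> s"
  shows "a *\<^sub>R x \<in> dilate s V"
  using assms by (intro dilate_mono[OF assms(1,2) _ assms(6) scaleR_mem_dilate]) auto

context decoupled_field
begin

lemma Z_mono: "(\<And>y. y \<in> topspace T \<Longrightarrow> y \<in> A \<Longrightarrow> y \<in> A') \<Longrightarrow> Z u n A \<le> Z u n A'"
  unfolding Z_def by (intro nn_integral_mono) (auto simp: indicator_def box_mean_in)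

lemma mean_indicator_measurable:
  assumes "openin T A"
  shows "(\<lambda>\<omega>. indicator A (box_mean (lattice_box z n) (\<eta> \<omega>)) :: ennreal) \<in> borel_measurable M"
proof -
  have "(indicator A :: 'y \<Rightarrow> ennreal) \<in> borel_measurable (borel_of T)"
    using openin_imp_sets_borel_of[OF assms] by simp
  then show ?thesis by (rule measurable_compose[OF box_mean_measurable])
qed

lemma Z_integrand_measurable:
  assumes "continuous_functional T u" "openin T A"
  shows "(\<lambda>\<omega>. ennreal (exp (u (\<Sum>z\<in>lattice_box 0 n. \<eta> \<omega> z)))
      * indicator A (box_mean (lattice_box 0 n) (\<eta> \<omega>))) \<in> borel_measurable M"
  by (intro borel_measurable_times_ennreal exp_sum_measurable mean_indicator_measurable
      measurable_field assms) simp

lemma Z_finite_cover: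
  assumes u: "continuous_functional T u" and F: "finite F" "\<And>i. i \<in> F \<Longrightarrow> openin T (C i)"
    and A: "\<And>y. y \<in> A \<Longrightarrow> \<exists>i\<in>F. y \<in> C i"
  shows "Z u n A \<le> (\<Sum>i\<in>F. Z u n (C i))"
proof -
  have "Z u n A \<le> (\<integral>\<^sup>+\<omega>. (\<Sum>i\<in>F. ennreal (exp (u (\<Sum>z\<in>lattice_box 0 n. \<eta> \<omega> z)))
      * indicator (C i) (box_mean (lattice_box 0 n) (\<eta> \<omega>))) \<partial>M)"
    unfolding Z_def
  proof (rule nn_integral_mono)
    fix \<omega> assume "\<omega> \<in> space M"
    let ?y = "box_mean (lattice_box 0 n) (\<eta> \<omega>)" and ?e = "ennreal (exp (u (\<Sum>z\<in>lattice_box 0 n. \<eta> \<omega> z)))"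
    show "?e * indicator A ?y \<le> (\<Sum>i\<in>F. ?e * indicator (C i) ?y)"
    proof (cases "?y \<in> A")
      case True
      then obtain i where i: "i \<in> F" "?y \<in> C i" using A by blast
      have "?e * indicator (C i) ?y \<le> (\<Sum>i\<in>F. ?e * indicator (C i) ?y)"
        by (rule member_le_sum[OF i(1)]) (use F in auto)
      then show ?thesis using True i by simp
    qed simp
  qed
  also have "\<dots> = (\<Sum>i\<in>F. Z u n (C i))"
    unfolding Z_def by (rule nn_integral_sum) (rule Z_integrand_measurable[OF u F(2)])
  finally show ?thesis .
qed

lemma Z_incseq:
  assumes u: "continuous_functional T u" and C: "\<And>i :: nat. openin T (C i)" "incseq C"
  shows "Z u n (\<Union>i. C i) = (SUP i. Z u n (C i))"
proof -
  let ?f = "\<lambda>i \<omega>. ennreal (exp (u (\<Sum>z\<in>lattice_box 0 n. \<eta> \<omega> z)))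
      * indicator (C i) (box_mean (lattice_box 0 n) (\<eta> \<omega>))"
  have inc: "incseq ?f"
    using C(2) by (auto simp: incseq_def le_fun_def indicator_def split: if_splits)
  have "(SUP i. Z u n (C i)) = (\<integral>\<^sup>+\<omega>. (SUP i. ?f i \<omega>) \<partial>M)"
    unfolding Z_def
    by (rule nn_integral_monotone_convergence_SUP[symmetric, OF inc]) (rule Z_integrand_measurable[OF u C(1)])
  also have "\<dots> = Z u n (\<Union>i. C i)"
    unfolding Z_def
  proof (rule nn_integral_cong)
    fix \<omega>
    let ?y = "box_mean (lattice_box 0 n) (\<eta> \<omega>)" and ?e = "ennreal (exp (u (\<Sum>z\<in>lattice_box 0 n. \<eta> \<omega> z)))"
    show "(SUP i. ?f i \<omega>) = ?e * indicator (\<Union>i. C i) ?y"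
    proof (cases "?y \<in> (\<Union>i. C i)")
      case True
      then obtain i where "?y \<in> C i" by blast
      then have "?e \<le> (SUP i. ?f i \<omega>)" by (intro SUP_upper2[of i]) auto
      moreover have "(SUP i. ?f i \<omega>) \<le> ?e" by (intro SUP_least) (auto simp: indicator_def)
      ultimately show ?thesis using True by simp
    next
      case False
      then have "?f i \<omega> = 0" for i by auto
      then show ?thesis using False by simp
    qed
  qed
  finally show ?thesis by simp
qed

lemma Z_zero_eq: "openin T A \<Longrightarrow>
    Z (\<lambda>_. 0) n A = emeasure M {\<omega>\<in>space M. box_mean (lattice_box 0 n) (\<eta> \<omega>) \<in> A}"
proof -
  assume A: "openin T A"
  have "{\<omega>\<in>space M. box_mean (lattice_box 0 n) (\<eta> \<omega>) \<in> A} \<in> sets M"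
    using measurable_sets[OF box_mean_measurable openin_imp_sets_borel_of[OF A]]
    by (simp add: vimage_def Int_def conj_commute)
  moreover have "Z (\<lambda>_. 0) n A = (\<integral>\<^sup>+\<omega>. indicator {\<omega>\<in>space M. box_mean (lattice_box 0 n) (\<eta> \<omega>) \<in> A} \<omega> \<partial>M)"
    unfolding Z_def by (intro nn_integral_cong) (auto simp: indicator_def)
  ultimately show ?thesis by simp
qed

text \<open>The lower bound on u is the one with which \<open>mixing_estimate\<close> controls the
  sites outside the tiles.\<close>

lemma base_refine_functional:
  assumes u: "continuous_functional T u" and U: "openin T U" "0 \<in> U"
  obtains V where "V \<in> B" "V \<subseteq> U" "\<And>v. v \<in> V \<Longrightarrow> - 1 \<le> u v"
proof -
  have "openin T (U \<inter> {y \<in> topspace T. - 1 < u y})" using U halfspace(1)[OF u] by blast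
  moreover have "0 \<in> U \<inter> {y \<in> topspace T. - 1 < u y}"
    using U(2) zero_in functional_scale[OF u zero_in, of 0] by simp
  ultimately obtain V where "V \<in> B" "V \<subseteq> U \<inter> {y \<in> topspace T. - 1 < u y}" by (rule base_refine)
  then show ?thesis using that[of V] by force
qed

text \<open>Mixing the whole space with itself imposes no geometric condition, so one large box of
  rate b forces rate b' on all large boxes. This is the convergence of the pressure before
  logarithms are taken.\<close>

lemma pressure_frequently_imp_eventually:
  assumes u: "continuous_functional T u" and b: "b' < b"
    and fr: "\<exists>\<^sub>F n in sequentially. grows u (topspace T) b n"
  shows "\<forall>\<^sub>F n in sequentially. grows u (topspace T) b' n"
proof -
  obtain V where V: "V \<in> B" "\<And>v. v \<in> V \<Longrightarrow> - 1 \<le> u v"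
    using base_refine_functional[OF u openin_topspace zero_in] by metis
  define \<delta> where "\<delta> = (b - b') / (2 + \<bar>b\<bar> + \<bar>b\<bar>)"
  have p: "2 + \<bar>b\<bar> + \<bar>b\<bar> > 0" by linarith
  have \<delta>: "\<delta> > 0" using b p by (simp add: \<delta>_def)
  have \<delta>b: "\<delta> * (2 + \<bar>b\<bar> + \<bar>b\<bar>) = b - b'" using p by (simp add: \<delta>_def)
  have cvx: "convex (topspace T)" by (rule subspace_imp_convex[OF subspace_topspace])
  obtain m0 where m0: "mixing_scale u V \<delta> m0" using mixing_estimate[OF V(1) u V(2) \<delta>] by blast
  obtain m where m: "m \<ge> m0" "grows u (topspace T) b m"
    using fr unfolding frequently_sequentially by blast
  have Vt: "V \<subseteq> topspace T" using openin_subset[OF base_open[OF V(1)]] .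
  have "\<forall>\<^sub>F n in sequentially.
      grows u (topspace T) (1 * b + (1 - 1) * b - \<delta> * (2 + \<bar>b\<bar> + \<bar>b\<bar>)) n"
    by (rule mixing_scaleD[OF m0 m(1) openin_topspace cvx openin_topspace cvx _ _ m(2) m(2)])
      (use Vt in \<open>auto intro!: add_in scale_in\<close>)
  then show ?thesis unfolding \<delta>b by simp
qed

text \<open>Mixing near two points. Averages of points close to the two given ones, with almost
  correct weights, stay close to the exact combination. This form conceals \<delta>, V and the
  weights, and is all that concavity needs.\<close>

lemma mixing_local:
  assumes x: "x\<^sub>1 \<in> topspace T" "x\<^sub>2 \<in> topspace T" and a: "0 \<le> a" "a \<le> 1"
    and A': "openin T A'" "a *\<^sub>R x\<^sub>1 + (1 - a) *\<^sub>R x\<^sub>2 \<in> A'" and b: "b' < a * b\<^sub>1 + (1 - a) * b\<^sub>2"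
  obtains A\<^sub>1 A\<^sub>2 b\<^sub>1' b\<^sub>2' m0 where "openin T A\<^sub>1" "x\<^sub>1 \<in> A\<^sub>1" "b\<^sub>1' < b\<^sub>1" "openin T A\<^sub>2" "x\<^sub>2 \<in> A\<^sub>2" "b\<^sub>2' < b\<^sub>2"
    "\<And>m. m \<ge> m0 \<Longrightarrow> grows (\<lambda>_. 0) A\<^sub>1 b\<^sub>1' m \<Longrightarrow>
      grows (\<lambda>_. 0) A\<^sub>2 b\<^sub>2' m \<Longrightarrow>
      \<forall>\<^sub>F n in sequentially. grows (\<lambda>_. 0) A' b' n"
proof -
  define y where "y = a *\<^sub>R x\<^sub>1 + (1 - a) *\<^sub>R x\<^sub>2"
  obtain V\<^sub>0 where V0: "openin T V\<^sub>0" "convex V\<^sub>0" "0 \<in> V\<^sub>0" "\<And>v. v \<in> V\<^sub>0 \<Longrightarrow> - v \<in> V\<^sub>0"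
      "\<And>v. v \<in> V\<^sub>0 \<Longrightarrow> y + v \<in> A'"
    using symmetric_nbhd[OF A'(1)] A'(2) unfolding y_def[symmetric] by metis
  have o8: "openin T (dilate (1/8) V\<^sub>0)" "0 \<in> dilate (1/8) V\<^sub>0"
    using V0 by (auto intro: openin_dilate zero_mem_dilate)
  have o4: "openin T (dilate (1/4) V\<^sub>0)" "0 \<in> dilate (1/4) V\<^sub>0" "convex (dilate (1/4) V\<^sub>0)"
    using V0 by (auto intro: openin_dilate zero_mem_dilate convex_dilate)
  obtain V where V: "V \<in> B" "V \<subseteq> dilate (1/8) V\<^sub>0" using base_refine[OF o8] by metis
  obtain e\<^sub>1 where e1: "e\<^sub>1 > 0" "\<And>s. \<bar>s\<bar> \<le> e\<^sub>1 \<Longrightarrow> s *\<^sub>R x\<^sub>1 \<in> dilate (1/8) V\<^sub>0"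
    using small_multiple[OF o8 x(1)] by metis
  obtain e\<^sub>2 where e2: "e\<^sub>2 > 0" "\<And>s. \<bar>s\<bar> \<le> e\<^sub>2 \<Longrightarrow> s *\<^sub>R x\<^sub>2 \<in> dilate (1/8) V\<^sub>0"
    using small_multiple[OF o8 x(2)] by metis
  \<comment> \<open>Half of the slack in the rate is given to lowering both rates, the other half to
    the loss in the mixing estimate.\<close>
  define gap where "gap = (a * b\<^sub>1 + (1 - a) * b\<^sub>2 - b') / 2"
  have gap: "gap > 0" using b by (simp add: gap_def)
  define b\<^sub>1' where "b\<^sub>1' = b\<^sub>1 - gap"
  define b\<^sub>2' where "b\<^sub>2' = b\<^sub>2 - gap"
  define p where "p = 2 + \<bar>b\<^sub>1'\<bar> + \<bar>b\<^sub>2'\<bar>"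
  have p: "p > 0" by (simp add: p_def)
  define \<delta> where "\<delta> = min (min 1 (gap / p)) (min e\<^sub>1 e\<^sub>2)"
  have \<delta>: "\<delta> > 0" "\<delta> \<le> 1" "\<delta> \<le> gap / p" "\<delta> \<le> e\<^sub>1" "\<delta> \<le> e\<^sub>2" using e1 e2 gap p by (auto simp: \<delta>_def)
  have rate: "b' \<le> a * b\<^sub>1' + (1 - a) * b\<^sub>2' - \<delta> * (2 + \<bar>b\<^sub>1'\<bar> + \<bar>b\<^sub>2'\<bar>)"
  proof -
    have "\<delta> * p \<le> gap" using \<delta>(3) p by (simp add: le_divide_eq)
    moreover have "a * b\<^sub>1' + (1 - a) * b\<^sub>2' = a * b\<^sub>1 + (1 - a) * b\<^sub>2 - gap"
      by (simp add: b\<^sub>1'_def b\<^sub>2'_def algebra_simps)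
    moreover have "2 * gap = a * b\<^sub>1 + (1 - a) * b\<^sub>2 - b'" by (simp add: gap_def)
    ultimately show ?thesis unfolding p_def[symmetric] by linarith
  qed
  define A\<^sub>1 where "A\<^sub>1 = (+) x\<^sub>1 ` dilate (1/4) V\<^sub>0"
  define A\<^sub>2 where "A\<^sub>2 = (+) x\<^sub>2 ` dilate (1/4) V\<^sub>0"
  have A1: "openin T A\<^sub>1" "convex A\<^sub>1" "x\<^sub>1 \<in> A\<^sub>1" and A2: "openin T A\<^sub>2" "convex A\<^sub>2" "x\<^sub>2 \<in> A\<^sub>2"
    unfolding A\<^sub>1_def A\<^sub>2_def using x o4
    by (auto intro: openin_translation convex_translation rev_image_eqI)
  obtain m0 where m0: "mixing_scale (\<lambda>_. 0) V \<delta> m0"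
    using mixing_estimate[OF V(1) continuous_functional_zero _ \<delta>(1)] by fastforce
  show ?thesis
  proof (rule that[OF A1(1,3) _ A2(1,3)])
    show "b\<^sub>1' < b\<^sub>1" "b\<^sub>2' < b\<^sub>2" using gap by (auto simp: b\<^sub>1'_def b\<^sub>2'_def)
    fix m assume m: "m0 \<le> m" "grows (\<lambda>_. 0) A\<^sub>1 b\<^sub>1' m"
      "grows (\<lambda>_. 0) A\<^sub>2 b\<^sub>2' m"
    have "\<forall>\<^sub>F n in sequentially.
      grows (\<lambda>_. 0) A' (a * b\<^sub>1' + (1 - a) * b\<^sub>2' - \<delta> * (2 + \<bar>b\<^sub>1'\<bar> + \<bar>b\<^sub>2'\<bar>)) n"
    proof (rule mixing_scaleD[OF m0 m(1) A1(1,2) A2(1,2) a m(2,3)])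
      fix \<kappa>\<^sub>1 \<kappa>\<^sub>2 :: real and x\<^sub>1' x\<^sub>2' v
      assume \<kappa>: "0 \<le> \<kappa>\<^sub>1" "0 \<le> \<kappa>\<^sub>2" "\<kappa>\<^sub>1 + \<kappa>\<^sub>2 \<le> 1" "\<bar>\<kappa>\<^sub>1 - a\<bar> \<le> \<delta>" "\<bar>\<kappa>\<^sub>2 - (1 - a)\<bar> \<le> \<delta>"
        and x': "x\<^sub>1' \<in> A\<^sub>1" "x\<^sub>2' \<in> A\<^sub>2" and v: "v \<in> V"
      obtain w\<^sub>1 where w1: "w\<^sub>1 \<in> dilate (1/4) V\<^sub>0" "x\<^sub>1' = x\<^sub>1 + w\<^sub>1" using x'(1) by (auto simp: A\<^sub>1_def)
      obtain w\<^sub>2 where w2: "w\<^sub>2 \<in> dilate (1/4) V\<^sub>0" "x\<^sub>2' = x\<^sub>2 + w\<^sub>2" using x'(2) by (auto simp: A\<^sub>2_def)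
      have t1: "(\<kappa>\<^sub>1 - a) *\<^sub>R x\<^sub>1 \<in> dilate (1/8) V\<^sub>0" using \<kappa>(4) \<delta>(4) by (intro e1(2)) linarith
      have t2: "(\<kappa>\<^sub>2 - (1 - a)) *\<^sub>R x\<^sub>2 \<in> dilate (1/8) V\<^sub>0" using \<kappa>(5) \<delta>(5) by (intro e2(2)) linarith
      have t3: "\<kappa>\<^sub>1 *\<^sub>R w\<^sub>1 \<in> dilate (1/4) V\<^sub>0" using \<kappa> by (intro scaleR_dilate_mono[OF V0(2,3) w1(1)]) auto
      have t4: "\<kappa>\<^sub>2 *\<^sub>R w\<^sub>2 \<in> dilate (1/4) V\<^sub>0" using \<kappa> by (intro scaleR_dilate_mono[OF V0(2,3) w2(1)]) auto
      have "v \<in> dilate (1/8) V\<^sub>0" using V(2) v by blast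
      then have t5: "\<delta> *\<^sub>R v \<in> dilate (1/8) V\<^sub>0" using \<delta> by (intro scaleR_dilate_mono[OF V0(2,3)]) auto
      \<comment> \<open>Budget 7/8: twice 1/8 for the errors in the weights, twice 1/4 for the
        neighbourhoods of the two points, and 1/8 for the sites outside the tiles.\<close>
      have "((((\<kappa>\<^sub>1 - a) *\<^sub>R x\<^sub>1 + (\<kappa>\<^sub>2 - (1 - a)) *\<^sub>R x\<^sub>2) + \<kappa>\<^sub>1 *\<^sub>R w\<^sub>1) + \<kappa>\<^sub>2 *\<^sub>R w\<^sub>2) + \<delta> *\<^sub>R v
          \<in> dilate ((((1/8 + 1/8) + 1/4) + 1/4) + 1/8) V\<^sub>0"
        by (intro dilate_add[OF V0(2)] t1 t2 t3 t4 t5) auto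
      then have "((((\<kappa>\<^sub>1 - a) *\<^sub>R x\<^sub>1 + (\<kappa>\<^sub>2 - (1 - a)) *\<^sub>R x\<^sub>2) + \<kappa>\<^sub>1 *\<^sub>R w\<^sub>1) + \<kappa>\<^sub>2 *\<^sub>R w\<^sub>2) + \<delta> *\<^sub>R v
          \<in> dilate 1 V\<^sub>0" by (rule dilate_mono[OF V0(2,3), rotated 2]) auto
      then have "y + (((((\<kappa>\<^sub>1 - a) *\<^sub>R x\<^sub>1 + (\<kappa>\<^sub>2 - (1 - a)) *\<^sub>R x\<^sub>2) + \<kappa>\<^sub>1 *\<^sub>R w\<^sub>1) + \<kappa>\<^sub>2 *\<^sub>R w\<^sub>2) + \<delta> *\<^sub>R v) \<in> A'"
        using V0(5) by simp
      also have "y + (((((\<kappa>\<^sub>1 - a) *\<^sub>R x\<^sub>1 + (\<kappa>\<^sub>2 - (1 - a)) *\<^sub>R x\<^sub>2) + \<kappa>\<^sub>1 *\<^sub>R w\<^sub>1) + \<kappa>\<^sub>2 *\<^sub>R w\<^sub>2) + \<delta> *\<^sub>R v)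
          = \<kappa>\<^sub>1 *\<^sub>R x\<^sub>1' + \<kappa>\<^sub>2 *\<^sub>R x\<^sub>2' + \<delta> *\<^sub>R v"
        by (simp add: y_def w1(2) w2(2) algebra_simps)
      finally show "\<kappa>\<^sub>1 *\<^sub>R x\<^sub>1' + \<kappa>\<^sub>2 *\<^sub>R x\<^sub>2' + \<delta> *\<^sub>R v \<in> A'" .
    qed
    then show "\<forall>\<^sub>F n in sequentially. grows (\<lambda>_. 0) A' b' n"
    proof eventually_elim
      case (elim n)
      have "ennreal (exp (b' * real n ^ CARD('d)))
          \<le> ennreal (exp ((a * b\<^sub>1' + (1 - a) * b\<^sub>2' - \<delta> * (2 + \<bar>b\<^sub>1'\<bar> + \<bar>b\<^sub>2'\<bar>)) * real n ^ CARD('d)))"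
        using rate by (intro ennreal_leI) (simp add: mult_right_mono)
      then show ?case using elim by (rule order_trans)
    qed
  qed
qed

text \<open>That is, \<open>b \<le> s(\<eta>; z)\<close>.\<close>

definition below_entropy :: "'y \<Rightarrow> real \<Rightarrow> bool" where
  "below_entropy z b \<longleftrightarrow> z \<in> topspace T \<and> (\<forall>A b'. openin T A \<longrightarrow> z \<in> A \<longrightarrow> b' < b \<longrightarrow>
     (\<forall>\<^sub>F n in sequentially. grows (\<lambda>_. 0) A b' n))"

text \<open>A point mixed with itself: one sufficiently large good box suffices. So the entropy
  could be defined with limsup in place of liminf, and the concentration argument has to track
  frequent events only.\<close>

lemma below_entropy_frequentlyI:
  assumes z: "z \<in> topspace T"
    and fr: "\<And>A b'. openin T A \<Longrightarrow> z \<in> A \<Longrightarrow> b' < b \<Longrightarrow>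
      \<exists>\<^sub>F n in sequentially. grows (\<lambda>_. 0) A b' n"
  shows "below_entropy z b"
  unfolding below_entropy_def
proof (intro conjI allI impI z)
  fix A b' assume A: "openin T A" "z \<in> A" and b: "b' < b"
  have zA: "1 *\<^sub>R z + (1 - 1) *\<^sub>R z \<in> A" and b1: "b' < 1 * b + (1 - 1) * b" using A b by auto
  obtain A\<^sub>1 A\<^sub>2 b\<^sub>1' b\<^sub>2' m0 where *: "openin T A\<^sub>1" "z \<in> A\<^sub>1" "b\<^sub>1' < b" "openin T A\<^sub>2" "z \<in> A\<^sub>2" "b\<^sub>2' < b"
    "\<And>m. m \<ge> m0 \<Longrightarrow> grows (\<lambda>_. 0) A\<^sub>1 b\<^sub>1' m \<Longrightarrow>
      grows (\<lambda>_. 0) A\<^sub>2 b\<^sub>2' m \<Longrightarrow>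
      \<forall>\<^sub>F n in sequentially. grows (\<lambda>_. 0) A b' n"
    by (rule mixing_local[OF z z _ _ A(1) zA b1]) (simp, simp, blast)
  \<comment> \<open>The two neighbourhoods and rates need not agree; their intersection and the
    larger rate serve both at the same m.\<close>
  have "\<exists>\<^sub>F n in sequentially. grows (\<lambda>_. 0) (A\<^sub>1 \<inter> A\<^sub>2) (max b\<^sub>1' b\<^sub>2') n"
    by (rule fr) (use * in auto)
  then obtain m where m: "m \<ge> m0" "grows (\<lambda>_. 0) (A\<^sub>1 \<inter> A\<^sub>2) (max b\<^sub>1' b\<^sub>2') m"
    unfolding frequently_sequentially by blast
  have le: "grows (\<lambda>_. 0) C b m" if "b \<le> max b\<^sub>1' b\<^sub>2'" "A\<^sub>1 \<inter> A\<^sub>2 \<subseteq> C" for b C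
  proof -
    have "ennreal (exp (b * real m ^ CARD('d))) \<le> ennreal (exp (max b\<^sub>1' b\<^sub>2' * real m ^ CARD('d)))"
      using that(1) by (intro ennreal_leI) (simp add: mult_right_mono)
    also have "\<dots> \<le> Z (\<lambda>_. 0) m (A\<^sub>1 \<inter> A\<^sub>2)" by (rule m(2))
    also have "\<dots> \<le> Z (\<lambda>_. 0) m C" using that(2) by (intro Z_mono) auto
    finally show ?thesis .
  qed
  show "\<forall>\<^sub>F n in sequentially. grows (\<lambda>_. 0) A b' n"
    by (rule *(7)[OF m(1)]) (auto intro: le)
qed

text \<open>Concavity of the entropy, expressed as convexity of its hypograph, which stays
  meaningful where the entropy is -\<infinity>.\<close>

lemma below_entropy_convex:
  assumes h: "below_entropy x\<^sub>1 b\<^sub>1" "below_entropy x\<^sub>2 b\<^sub>2" and a: "0 \<le> a" "a \<le> 1"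
  shows "below_entropy (a *\<^sub>R x\<^sub>1 + (1 - a) *\<^sub>R x\<^sub>2) (a * b\<^sub>1 + (1 - a) * b\<^sub>2)"
proof -
  have x: "x\<^sub>1 \<in> topspace T" "x\<^sub>2 \<in> topspace T" using h by (auto simp: below_entropy_def)
  show ?thesis
    unfolding below_entropy_def
  proof (intro conjI allI impI)
    show "a *\<^sub>R x\<^sub>1 + (1 - a) *\<^sub>R x\<^sub>2 \<in> topspace T" using x by (intro add_in scale_in)
    fix A b' assume A: "openin T A" "a *\<^sub>R x\<^sub>1 + (1 - a) *\<^sub>R x\<^sub>2 \<in> A" and b: "b' < a * b\<^sub>1 + (1 - a) * b\<^sub>2"
    obtain A\<^sub>1 A\<^sub>2 b\<^sub>1' b\<^sub>2' m0 where *: "openin T A\<^sub>1" "x\<^sub>1 \<in> A\<^sub>1" "b\<^sub>1' < b\<^sub>1" "openin T A\<^sub>2" "x\<^sub>2 \<in> A\<^sub>2" "b\<^sub>2' < b\<^sub>2"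
      "\<And>m. m \<ge> m0 \<Longrightarrow> grows (\<lambda>_. 0) A\<^sub>1 b\<^sub>1' m \<Longrightarrow>
        grows (\<lambda>_. 0) A\<^sub>2 b\<^sub>2' m \<Longrightarrow>
        \<forall>\<^sub>F n in sequentially. grows (\<lambda>_. 0) A b' n"
      by (rule mixing_local[OF x a A b]) blast
    have "\<forall>\<^sub>F m in sequentially. grows (\<lambda>_. 0) A\<^sub>1 b\<^sub>1' m"
      "\<forall>\<^sub>F m in sequentially. grows (\<lambda>_. 0) A\<^sub>2 b\<^sub>2' m"
      using h * unfolding below_entropy_def by auto
    with eventually_ge_at_top[of m0]
    have "\<forall>\<^sub>F m in sequentially. m \<ge> m0 \<and> grows (\<lambda>_. 0) A\<^sub>1 b\<^sub>1' m
        \<and> grows (\<lambda>_. 0) A\<^sub>2 b\<^sub>2' m"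
      by eventually_elim auto
    then obtain m where "m \<ge> m0" "grows (\<lambda>_. 0) A\<^sub>1 b\<^sub>1' m"
      "grows (\<lambda>_. 0) A\<^sub>2 b\<^sub>2' m"
      unfolding eventually_sequentially by blast
    then show "\<forall>\<^sub>F n in sequentially. grows (\<lambda>_. 0) A b' n"
      by (rule *(7))
  qed
qed

end

section \<open>Concentration of the pressure at a point\<close>

text \<open>The zonotopes serve as finite-dimensional compact convex sets that increase to a dense set.\<close>

primrec zonotope :: "(nat \<Rightarrow> 'y::real_vector) \<Rightarrow> nat \<Rightarrow> 'y set" where
  "zonotope e 0 = {0}"
| "zonotope e (Suc r) = (\<lambda>(a, k). a *\<^sub>R e r + k) ` ({0..1} \<times> zonotope e r)"

lemma zonotope_zero: "0 \<in> zonotope e r"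
  by (induction r) (auto intro!: image_eqI[of _ _ "(0, 0)"])

lemma zonotope_mem: "i < r \<Longrightarrow> e i \<in> zonotope e r"
proof (induction r)
  case (Suc r)
  show ?case
  proof (cases "i = r")
    case True
    then show ?thesis using zonotope_zero[of e r] by (auto intro!: image_eqI[of _ _ "(1, 0)"])
  next
    case False
    then have "e i \<in> zonotope e r" using Suc by simp
    then show ?thesis by (auto intro!: image_eqI[of _ _ "(0, e i)"])
  qed
qed simp

lemma zonotope_mono: "r \<le> r' \<Longrightarrow> zonotope e r \<subseteq> zonotope e r'"
proof (induction r' rule: dec_induct)
  case (step r')
  have "x \<in> zonotope e (Suc r')" if "x \<in> zonotope e r'" for x
    using that by (auto intro!: image_eqI[of _ _ "(0, x)"])
  then show ?case using step by blast
qed simp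

lemma zonotope_convex: "convex (zonotope e r)"
proof (induction r)
  case (Suc r)
  have "zonotope e (Suc r) = (\<Union>x\<in>(\<lambda>a. a *\<^sub>R e r) ` {0..1}. \<Union>y\<in>zonotope e r. {x + y})"
    by (auto simp: image_iff)
  moreover have "convex ((\<lambda>a. a *\<^sub>R e r) ` {0..1})"
    by (intro convex_linear_image) (auto intro!: linearI simp: scaleR_add_left)
  ultimately show ?case using convex_sums[OF _ Suc] by metis
qed simp

lemma (in frechet_topology) zonotope_compact:
  assumes "\<And>i. e i \<in> topspace T" shows "compactin T (zonotope e r)"
proof (induction r)
  case 0
  then show ?case by (simp add: zero_in)
next
  case (Suc r)
  have "continuous_map (prod_topology euclideanreal T) T (\<lambda>p. fst p *\<^sub>R e r + snd p)"
    using assms by (intro add_continuous scale_continuous continuous_map_fst continuous_map_snd) auto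
  moreover have "compactin (prod_topology euclideanreal T) ({0..1} \<times> zonotope e r)"
    using Suc by (simp add: compactin_Times)
  ultimately have "compactin T ((\<lambda>p. fst p *\<^sub>R e r + snd p) ` ({0..1} \<times> zonotope e r))"
    by (rule image_compactin[rotated])
  then show ?case by (simp add: case_prod_unfold)
qed

lemma eventually_exp_power_dominates:
  assumes "b' < b" "d > 0"
  shows "\<forall>\<^sub>F n in sequentially. C * exp (b' * real n ^ d) < exp (b * real n ^ d)"
proof -
  have "filterlim (\<lambda>n. (b - b') * real n ^ d) at_top sequentially"
    using assms by (intro filterlim_tendsto_pos_mult_at_top[OF tendsto_const]
        filterlim_pow_at_top filterlim_real_sequentially) auto
  then have "filterlim (\<lambda>n. exp ((b - b') * real n ^ d)) at_top sequentially"
    by (rule filterlim_compose[OF exp_at_top])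
  then have "\<forall>\<^sub>F n in sequentially. C < exp ((b - b') * real n ^ d)"
    unfolding filterlim_at_top_dense by blast
  then show ?thesis
  proof eventually_elim
    case (elim n)
    have "C * exp (b' * real n ^ d) < exp ((b - b') * real n ^ d) * exp (b' * real n ^ d)"
      using elim by (rule mult_strict_right_mono) simp
    also have "\<dots> = exp (b * real n ^ d)" by (simp add: algebra_simps flip: exp_add)
    finally show ?case .
  qed
qed

context decoupled_field
begin

lemma dense_sequence:
  obtains e :: "nat \<Rightarrow> 'y" where "\<And>i. e i \<in> topspace T"
    "\<And>y W. y \<in> topspace T \<Longrightarrow> openin T W \<Longrightarrow> 0 \<in> W \<Longrightarrow> (\<And>w. w \<in> W \<Longrightarrow> - w \<in> W) \<Longrightarrow> \<exists>i. y \<in> (+) (e i) ` W"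
proof -
  obtain D where D: "countable D" "D \<subseteq> topspace T" "T closure_of D = topspace T"
    using separable unfolding separable_space_def by metis
  have meet: "\<exists>x\<in>D. x \<in> U" if "openin T U" "y \<in> U" for U y
  proof -
    have "y \<in> T closure_of D" using openin_subset[OF that(1)] that(2) D(3) by auto
    then show ?thesis using that unfolding in_closure_of by auto
  qed
  have ne: "D \<noteq> {}" using meet[OF openin_topspace zero_in] by auto
  define e where "e = from_nat_into D"
  have range: "range e = D" unfolding e_def using ne D(1) by (rule range_from_nat_into)
  show ?thesis
  proof (rule that[of e])
    show "e i \<in> topspace T" for i using range D(2) by auto
    fix y W assume y: "y \<in> topspace T" and W: "openin T W" "0 \<in> W" "\<And>w. w \<in> W \<Longrightarrow> - w \<in> W"
    have "y \<in> (+) y ` W" using W(2) by (intro image_eqI[of _ _ 0]) auto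
    then obtain x where x: "x \<in> D" "x \<in> (+) y ` W" using meet[OF openin_translation[OF W(1) y]] by blast
    then obtain w where w: "x = y + w" "w \<in> W" by blast
    obtain i where "x = e i" using x(1) range by blast
    note i = this w
    then have "y = e i + - w" by (simp add: algebra_simps)
    then show "\<exists>i. y \<in> (+) (e i) ` W" using W(3)[OF i(3)] by blast
  qed
qed

text \<open>
  The box size \<open>m\<close> is fixed before the zonotope \<open>K\<close>, and the number of translates of \<open>W\<close> that cover
  a neighbourhood of \<open>K\<close> does not depend on \<open>n\<close>. So choosing the best translate costs nothing on the
  exponential scale.
\<close>

lemma concentration_step:
  assumes u: "continuous_functional T u" and z: "z \<in> topspace T"
    and U: "openin T U" "convex U" "0 \<in> U"
    and W: "openin T W" "convex W" "0 \<in> W" "\<And>w. w \<in> W \<Longrightarrow> - w \<in> W"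
    and b: "b' < b"
    and fr: "\<exists>\<^sub>F n in sequentially. grows u ((+) z ` U) b n"
  shows "\<exists>z'\<in>topspace T. (\<exists>y. y - z \<in> dilate 2 U \<and> y - z' \<in> W) \<and>
    (\<exists>\<^sub>F n in sequentially. grows u ((+) z' ` W) b' n)"
proof -
  \<comment> \<open>W is spent in thirds: one for the distance of the tile means to the zonotope,
    one for the sites outside the tiles, and one for covering the zonotope by finitely many
    translates.\<close>
  define W3 where "W3 = dilate (1/3) W"
  have W3: "openin T W3" "convex W3" "0 \<in> W3" "\<And>w. w \<in> W3 \<Longrightarrow> - w \<in> W3"
    unfolding W3_def using W dilate_uminus[of W _ "1/3"]
    by (auto intro: openin_dilate convex_dilate zero_mem_dilate)
  have W23: "openin T (dilate (2/3) W)" "0 \<in> dilate (2/3) W"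
    using W by (auto intro: openin_dilate zero_mem_dilate)
  define U2 where "U2 = dilate (1/2) U"
  have U2: "openin T U2" "0 \<in> U2" unfolding U2_def using U by (auto intro: openin_dilate zero_mem_dilate)
  have VO: "openin T (U2 \<inter> W3)" "0 \<in> U2 \<inter> W3" using U2 W3 by auto
  obtain V where V: "V \<in> B" "V \<subseteq> U2 \<inter> W3" "\<And>v. v \<in> V \<Longrightarrow> - 1 \<le> u v"
    using base_refine_functional[OF u VO] by metis
  obtain s where s: "s > 0" "\<And>a. \<bar>a\<bar> \<le> s \<Longrightarrow> a *\<^sub>R z \<in> U2" using small_multiple[OF U2 z] by metis
  define b\<^sub>1 where "b\<^sub>1 = b' + 2 * (b - b') / 3"
  define b\<^sub>2 where "b\<^sub>2 = b' + (b - b') / 3"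
  \<comment> \<open>The rate descends from b in three stages: to the first intermediate value by
    restricting to a zonotope, to the second by mixing, and to b' by choosing one translate among
    finitely many.\<close>
  have bb: "b\<^sub>1 < b" "b' < b\<^sub>2" "b\<^sub>1 - b\<^sub>2 > 0" using b by (auto simp: b\<^sub>1_def b\<^sub>2_def field_simps)
  define p where "p = 2 + \<bar>b\<^sub>1\<bar> + \<bar>b\<^sub>1\<bar>"
  have p: "p > 0" unfolding p_def by linarith
  define \<delta> where "\<delta> = min (min 1 ((b\<^sub>1 - b\<^sub>2) / p)) (s / 2)"
  have \<delta>: "\<delta> > 0" "\<delta> \<le> 1" "\<delta> \<le> (b\<^sub>1 - b\<^sub>2) / p" "2 * \<delta> \<le> s"
  proof -
    show "\<delta> > 0" using s(1) bb(3) p by (simp add: \<delta>_def)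
    show "\<delta> \<le> 1" "\<delta> \<le> (b\<^sub>1 - b\<^sub>2) / p" unfolding \<delta>_def by (auto intro: min.coboundedI1)
    have "\<delta> \<le> s / 2" unfolding \<delta>_def by (rule min.cobounded2)
    then show "2 * \<delta> \<le> s" by simp
  qed
  have \<delta>p: "\<delta> * p \<le> b\<^sub>1 - b\<^sub>2" using \<delta>(3) p by (simp add: le_divide_eq)
  obtain m0 where m0: "mixing_scale u V \<delta> m0" using mixing_estimate[OF V(1) u V(3) \<delta>(1)] by blast
  obtain m where m: "m \<ge> max 1 m0" "grows u ((+) z ` U) b m"
    using fr unfolding frequently_sequentially by blast
  obtain e :: "nat \<Rightarrow> 'y" where e: "\<And>i. e i \<in> topspace T"
    and cover: "\<And>y W. y \<in> topspace T \<Longrightarrow> openin T W \<Longrightarrow> 0 \<in> W \<Longrightarrow> (\<And>w. w \<in> W \<Longrightarrow> - w \<in> W) \<Longrightarrow> \<exists>i. y \<in> (+) (e i) ` W"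
    using dense_sequence by metis
  have zono: "x \<in> topspace T" if "x \<in> zonotope e r" for x r
    using compactin_subset_topspace[OF zonotope_compact[of e r, OF e]] that by blast
  \<comment> \<open>Convex, as an intersection of a translate of \<open>U\<close> with a sum of
    convex sets, and increasing to the whole of \<open>z + U\<close> because the zonotopes contain a
    dense sequence.\<close>
  define C where "C = (\<lambda>r. (+) z ` U \<inter> (\<Union>k\<in>zonotope e r. (+) k ` W3))"
  have C: "openin T (C r)" for r
    unfolding C_def using zono by (intro openin_Int openin_translation U(1) z openin_Union) (auto intro: openin_translation W3(1))
  have Cc: "convex (C r)" for r
  proof -
    have "(\<Union>k\<in>zonotope e r. (+) k ` W3) = (\<Union>x\<in>zonotope e r. \<Union>y\<in>W3. {x + y})" by auto
    then have "convex (\<Union>k\<in>zonotope e r. (+) k ` W3)"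
      using convex_sums[OF zonotope_convex W3(2)] by metis
    then show ?thesis unfolding C_def by (intro convex_Int convex_translation U(2))
  qed
  have inc: "incseq C"
    unfolding incseq_def C_def using zonotope_mono by blast
  have "(+) z ` U = (\<Union>r. C r)"
  proof (intro equalityI subsetI)
    fix y assume y: "y \<in> (+) z ` U"
    then have yt: "y \<in> topspace T" using openin_subset[OF openin_translation[OF U(1) z]] by blast
    obtain i where "y \<in> (+) (e i) ` W3" using cover[OF yt W3(1,3,4)] by blast
    then have "y \<in> C (Suc i)" unfolding C_def using y zonotope_mem[of i "Suc i" e] by blast
    then show "y \<in> (\<Union>r. C r)" by blast
  qed (auto simp: C_def)
  then have "Z u m ((+) z ` U) = (SUP r. Z u m (C r))" using Z_incseq[OF u C inc] by simp
  moreover have "ennreal (exp (b\<^sub>1 * real m ^ CARD('d))) < ennreal (exp (b * real m ^ CARD('d)))"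
    using bb(1) m(1) by (intro ennreal_lessI) auto
  ultimately have "ennreal (exp (b\<^sub>1 * real m ^ CARD('d))) < (SUP r. Z u m (C r))" using m(2) by simp
  then obtain r where r: "grows u (C r) b\<^sub>1 m"
    unfolding less_SUP_iff by (auto intro: less_imp_le)
  define K where "K = zonotope e r"
  define A' where "A' = {y \<in> topspace T. y - z \<in> dilate 2 U} \<inter> (\<Union>k\<in>K. (+) k ` dilate (2/3) W)"
  \<comment> \<open>\<open>C r\<close> is mixed with itself at a = 1. What matters is not the gain
    in n but that the means stay near the zonotope fixed at size m.\<close>
  have ev: "\<forall>\<^sub>F n in sequentially. grows u A' (1 * b\<^sub>1 + (1 - 1) * b\<^sub>1 - \<delta> * (2 + \<bar>b\<^sub>1\<bar> + \<bar>b\<^sub>1\<bar>)) n"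
  proof (rule mixing_scaleD[OF m0 _ C[of r] Cc[of r] C[of r] Cc[of r] _ _ r r])
    fix \<kappa>\<^sub>1 \<kappa>\<^sub>2 :: real and x\<^sub>1 x\<^sub>2 v
    assume \<kappa>: "0 \<le> \<kappa>\<^sub>1" "0 \<le> \<kappa>\<^sub>2" "\<kappa>\<^sub>1 + \<kappa>\<^sub>2 \<le> 1" "\<bar>\<kappa>\<^sub>1 - 1\<bar> \<le> \<delta>" "\<bar>\<kappa>\<^sub>2 - (1 - 1)\<bar> \<le> \<delta>"
      and x: "x\<^sub>1 \<in> C r" "x\<^sub>2 \<in> C r" and v: "v \<in> V"
    obtain u\<^sub>1 where u1: "u\<^sub>1 \<in> U" "x\<^sub>1 = z + u\<^sub>1" using x(1) by (auto simp: C_def)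
    obtain u\<^sub>2 where u2: "u\<^sub>2 \<in> U" "x\<^sub>2 = z + u\<^sub>2" using x(2) by (auto simp: C_def)
    obtain k\<^sub>1 w\<^sub>1 where k1: "k\<^sub>1 \<in> K" "w\<^sub>1 \<in> W3" "x\<^sub>1 = k\<^sub>1 + w\<^sub>1" using x(1) by (auto simp: C_def K_def)
    obtain k\<^sub>2 w\<^sub>2 where k2: "k\<^sub>2 \<in> K" "w\<^sub>2 \<in> W3" "x\<^sub>2 = k\<^sub>2 + w\<^sub>2" using x(2) by (auto simp: C_def K_def)
    let ?y = "\<kappa>\<^sub>1 *\<^sub>R x\<^sub>1 + \<kappa>\<^sub>2 *\<^sub>R x\<^sub>2 + \<delta> *\<^sub>R v"
    \<comment> \<open>The weights miss 1 by at most 2 \<delta>, so z itself is displaced by an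
      element of \<open>U / 2\<close>. With at most 1 from the two points of \<open>U\<close> and
      1/2 from \<delta> v, this is the origin of the factor 2 in \<open>dilate 2 U\<close>.\<close>
    have t0: "(\<kappa>\<^sub>1 + \<kappa>\<^sub>2 - 1) *\<^sub>R z \<in> dilate (1/2) U"
      using s(2)[of "\<kappa>\<^sub>1 + \<kappa>\<^sub>2 - 1"] \<kappa> \<delta>(4) unfolding U2_def by linarith
    have t1: "\<kappa>\<^sub>1 *\<^sub>R u\<^sub>1 \<in> dilate \<kappa>\<^sub>1 U" "\<kappa>\<^sub>2 *\<^sub>R u\<^sub>2 \<in> dilate \<kappa>\<^sub>2 U" using u1 u2 by (auto simp: mem_dilate)
    have "v \<in> dilate (1/2) U" using v V(2) by (auto simp: U2_def)
    then have t2: "\<delta> *\<^sub>R v \<in> dilate (1/2) U" using \<delta> by (intro scaleR_dilate_mono[OF U(2,3)]) auto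
    have "(((\<kappa>\<^sub>1 + \<kappa>\<^sub>2 - 1) *\<^sub>R z + \<kappa>\<^sub>1 *\<^sub>R u\<^sub>1) + \<kappa>\<^sub>2 *\<^sub>R u\<^sub>2) + \<delta> *\<^sub>R v \<in> dilate (((1/2 + \<kappa>\<^sub>1) + \<kappa>\<^sub>2) + 1/2) U"
      using \<kappa> by (intro dilate_add[OF U(2)] t0 t1 t2) auto
    then have "(((\<kappa>\<^sub>1 + \<kappa>\<^sub>2 - 1) *\<^sub>R z + \<kappa>\<^sub>1 *\<^sub>R u\<^sub>1) + \<kappa>\<^sub>2 *\<^sub>R u\<^sub>2) + \<delta> *\<^sub>R v \<in> dilate 2 U"
      by (rule dilate_mono[OF U(2,3), rotated 2]) (use \<kappa> in auto)
    moreover have "(((\<kappa>\<^sub>1 + \<kappa>\<^sub>2 - 1) *\<^sub>R z + \<kappa>\<^sub>1 *\<^sub>R u\<^sub>1) + \<kappa>\<^sub>2 *\<^sub>R u\<^sub>2) + \<delta> *\<^sub>R v = ?y - z"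
      by (simp add: u1(2) u2(2) algebra_simps)
    ultimately have in1: "?y - z \<in> dilate 2 U" by simp
    have "\<kappa>\<^sub>1 *\<^sub>R w\<^sub>1 \<in> dilate (\<kappa>\<^sub>1 * (1/3)) W" "\<kappa>\<^sub>2 *\<^sub>R w\<^sub>2 \<in> dilate (\<kappa>\<^sub>2 * (1/3)) W"
      using k1(2) k2(2) unfolding W3_def by (rule_tac [!] scaleR_mem_dilate)
    moreover have "\<delta> *\<^sub>R v \<in> dilate (1/3) W"
      using v V(2) \<delta> unfolding W3_def by (intro scaleR_dilate_mono[OF W(2,3), of _ "1/3"]) auto
    ultimately have "(\<kappa>\<^sub>1 *\<^sub>R w\<^sub>1 + \<kappa>\<^sub>2 *\<^sub>R w\<^sub>2) + \<delta> *\<^sub>R v \<in> dilate ((\<kappa>\<^sub>1 * (1/3) + \<kappa>\<^sub>2 * (1/3)) + 1/3) W"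
      using \<kappa> by (intro dilate_add[OF W(2)]) auto
    then have w: "(\<kappa>\<^sub>1 *\<^sub>R w\<^sub>1 + \<kappa>\<^sub>2 *\<^sub>R w\<^sub>2) + \<delta> *\<^sub>R v \<in> dilate (2/3) W"
      by (rule dilate_mono[OF W(2,3), rotated 2]) (use \<kappa> in auto)
    \<comment> \<open>The weights may add up to less than 1, so convexity alone is not enough; the
      zonotope also contains 0.\<close>
    have k: "\<kappa>\<^sub>1 *\<^sub>R k\<^sub>1 + \<kappa>\<^sub>2 *\<^sub>R k\<^sub>2 \<in> K"
    proof -
      have K: "convex K" "0 \<in> K" unfolding K_def by (rule zonotope_convex, rule zonotope_zero)
      have "\<kappa>\<^sub>1 *\<^sub>R k\<^sub>1 + \<kappa>\<^sub>2 *\<^sub>R k\<^sub>2 \<in> dilate (\<kappa>\<^sub>1 + \<kappa>\<^sub>2) K"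
        using \<kappa> k1 k2 by (intro dilate_add[OF K(1)]) (auto simp: mem_dilate)
      then have "\<kappa>\<^sub>1 *\<^sub>R k\<^sub>1 + \<kappa>\<^sub>2 *\<^sub>R k\<^sub>2 \<in> dilate 1 K"
        by (rule dilate_mono[OF K, rotated 2]) (use \<kappa> in auto)
      then show ?thesis by simp
    qed
    have y_eq: "?y = (\<kappa>\<^sub>1 *\<^sub>R k\<^sub>1 + \<kappa>\<^sub>2 *\<^sub>R k\<^sub>2) + ((\<kappa>\<^sub>1 *\<^sub>R w\<^sub>1 + \<kappa>\<^sub>2 *\<^sub>R w\<^sub>2) + \<delta> *\<^sub>R v)"
      by (simp add: k1(3) k2(3) algebra_simps)
    have "?y \<in> topspace T"
      using openin_subset[OF C[of r]] x openin_subset[OF base_open[OF V(1)]] v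
      by (intro add_in scale_in) auto
    moreover have "?y \<in> (\<Union>k\<in>K. (+) k ` dilate (2/3) W)" using k w unfolding y_eq by blast
    ultimately show "?y \<in> A'" unfolding A'_def using in1 by blast
  qed (use m in auto)
  have Kc: "compactin T K" unfolding K_def by (rule zonotope_compact[OF e])
  have Kt: "K \<subseteq> topspace T" by (rule compactin_subset_topspace[OF Kc])
  obtain F where F: "finite F" "F \<subseteq> K" "K \<subseteq> (\<Union>f\<in>F. (+) f ` W3)"
  proof -
    have "\<exists>\<F>. finite \<F> \<and> \<F> \<subseteq> (\<lambda>k. (+) k ` W3) ` K \<and> K \<subseteq> \<Union>\<F>"
    proof (rule compactinD[OF Kc])
      show "openin T X" if "X \<in> (\<lambda>k. (+) k ` W3) ` K" for X
        using that Kt by (auto intro: openin_translation W3(1))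
      show "K \<subseteq> \<Union> ((\<lambda>k. (+) k ` W3) ` K)"
      proof
        fix k assume k: "k \<in> K"
        have "k \<in> (+) k ` W3" using W3(3) by (intro image_eqI[of _ _ 0]) auto
        then show "k \<in> \<Union> ((\<lambda>k. (+) k ` W3) ` K)" using k by blast
      qed
    qed
    then obtain \<F> where "finite \<F>" "\<F> \<subseteq> (\<lambda>k. (+) k ` W3) ` K" "K \<subseteq> \<Union>\<F>" by blast
    then show ?thesis using that finite_subset_image[of \<F> "\<lambda>k. (+) k ` W3" K] by metis
  qed
  define G where "G = (\<lambda>f. {y \<in> topspace T. y - z \<in> dilate 2 U} \<inter> (+) f ` W)"
  have "openin T {y \<in> topspace T. 1 *\<^sub>R y + - z \<in> dilate 2 U}"
    by (rule openin_affine_preimage) (auto intro: openin_dilate U(1) neg_in z)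
  then have G: "openin T (G f)" if "f \<in> F" for f
    unfolding G_def using that F(2) Kt by (intro openin_Int openin_translation W(1)) auto
  have coverG: "\<exists>f\<in>F. y \<in> G f" if y: "y \<in> A'" for y
  proof -
    obtain k w where kw: "k \<in> K" "w \<in> dilate (2/3) W" "y = k + w" using y by (auto simp: A'_def)
    obtain f w' where f: "f \<in> F" "w' \<in> W3" "k = f + w'" using F(3) kw(1) by blast
    have "w' + w \<in> dilate (1/3 + 2/3) W"
      using f(2) kw(2) unfolding W3_def by (intro dilate_add[OF W(2)]) auto
    then have "w' + w \<in> W" by simp
    then have "y \<in> (+) f ` W" using kw(3) f(3) by (intro image_eqI[of _ _ "w' + w"]) (auto simp: add.assoc)
    then show ?thesis using f(1) y unfolding G_def A'_def by blast
  qed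
  \<comment> \<open>Pigeonhole: if all pieces had rate below b', their sum would be at most
    \<open>card F * exp (b' * n ^ d)\<close>, which a larger rate eventually exceeds. Finiteness of
    \<open>F\<close> then yields one piece that is good infinitely often.\<close>
  have "\<forall>\<^sub>F n in sequentially. \<exists>f\<in>F. grows u (G f) b' n"
    using ev eventually_exp_power_dominates[OF bb(2) zero_less_card_finite[where ?'a = 'd], of "real (card F)"]
  proof eventually_elim
    case n: (elim n)
    show ?case
    proof (rule ccontr)
      assume "\<not> ?thesis"
      then have small: "Z u n (G f) \<le> ennreal (exp (b' * real n ^ CARD('d)))" if "f \<in> F" for f
        using that by (meson linear)
      have "b\<^sub>2 \<le> 1 * b\<^sub>1 + (1 - 1) * b\<^sub>1 - \<delta> * (2 + \<bar>b\<^sub>1\<bar> + \<bar>b\<^sub>1\<bar>)"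
        using \<delta>p unfolding p_def by simp
      then have "ennreal (exp (b\<^sub>2 * real n ^ CARD('d)))
          \<le> ennreal (exp ((1 * b\<^sub>1 + (1 - 1) * b\<^sub>1 - \<delta> * (2 + \<bar>b\<^sub>1\<bar> + \<bar>b\<^sub>1\<bar>)) * real n ^ CARD('d)))"
        by (intro ennreal_leI) (simp only: exp_le_cancel_iff mult_right_mono zero_le_power of_nat_0_le_iff)
      also have "\<dots> \<le> Z u n A'" by (rule n(1))
      also have "\<dots> \<le> (\<Sum>f\<in>F. Z u n (G f))" by (rule Z_finite_cover[OF u F(1) G coverG])
      also have "\<dots> \<le> (\<Sum>f\<in>F. ennreal (exp (b' * real n ^ CARD('d))))" by (intro sum_mono small)
      also have "\<dots> = ennreal (real (card F) * exp (b' * real n ^ CARD('d)))"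
        by (simp add: ennreal_mult ennreal_of_nat_eq_real_of_nat)
      also have "\<dots> < ennreal (exp (b\<^sub>2 * real n ^ CARD('d)))" using n(2) by (intro ennreal_lessI) auto
      finally show False by simp
    qed
  qed
  then have "\<exists>\<^sub>F n in sequentially. \<exists>f\<in>F. grows u (G f) b' n"
    by (intro eventually_frequently) simp_all
  then obtain f where f: "f \<in> F" "\<exists>\<^sub>F n in sequentially. grows u (G f) b' n"
    using F(1) by (auto simp: frequently_bex_finite_distrib)
  show ?thesis
  proof (intro bexI conjI)
    show "f \<in> topspace T" using f(1) F(2) Kt by blast
    \<comment> \<open>An empty piece would have zero moment, so \<open>G f\<close> contains a point,
      and this point links the old neighbourhood to the new one.\<close>
    have "\<exists>\<^sub>F n in sequentially. G f \<noteq> {}"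
      using f(2) by (rule frequently_elim1) auto
    then obtain y where "y \<in> G f" by (auto dest: frequently_ex)
    then show "\<exists>y. y - z \<in> dilate 2 U \<and> y - f \<in> W" unfolding G_def by (intro exI[of _ y]) auto
    show "\<exists>\<^sub>F n in sequentially. grows u ((+) f ` W) b' n"
      using f(2)
    proof (rule frequently_elim1)
      fix n assume "grows u (G f) b' n"
      also have "\<dots> \<le> Z u n ((+) f ` W)" by (rule Z_mono) (auto simp: G_def)
      finally show "grows u ((+) f ` W) b' n" .
    qed
  qed
qed

text \<open>\<open>concentration_step\<close> is iterated along shrinking neighbourhoods, losing a
  summable amount of rate. Close to the limit x the functional is nearly constant, so the tilt by
  \<open>exp u\<close> can be removed at rate \<open>u x\<close>, and a lower bound on the entropy
  at x remains.\<close>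

lemma concentration_point:
  assumes u: "continuous_functional T u" and b: "b' < b"
    and fr: "\<exists>\<^sub>F n in sequentially. grows u (topspace T) b n"
  obtains x where "below_entropy x (b' - u x)"
proof -
  obtain W :: "nat \<Rightarrow> 'y set" where
    W: "\<And>k. openin T (W k)" "\<And>k. convex (W k)" "\<And>k. 0 \<in> W k" "\<And>k v. v \<in> W k \<Longrightarrow> - v \<in> W k"
    and complete: "\<forall>z. (\<forall>k. z k \<in> topspace T) \<longrightarrow>
       (\<forall>k. \<exists>y. y - z k \<in> dilate 2 (W k) \<and> y - z (Suc k) \<in> W (Suc k)) \<longrightarrow>
       (\<exists>x\<in>topspace T. \<forall>U. openin T U \<and> x \<in> U \<longrightarrow> (\<exists>k0. \<forall>k\<ge>k0. (+) (z k) ` W k \<subseteq> U))"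
    by (rule shrinking_nbhds, rule that, assumption+)
  \<comment> \<open>Strictly decreasing and always above b', so that each step may lose a little
    rate and the final rate is still b'.\<close>
  define \<beta> where "\<beta> = (\<lambda>k :: nat. b' + (b - b') * (1/2) ^ Suc k)"
  have \<beta>: "\<beta> (Suc k) < \<beta> k" "b' < \<beta> k" "\<beta> 0 < b" for k
    using b by (auto simp: \<beta>_def field_simps)
  define P where "P = (\<lambda>k z. z \<in> topspace T \<and>
    (\<exists>\<^sub>F n in sequentially. grows u ((+) z ` W k) (\<beta> k) n))"
  \<comment> \<open>The iteration starts from the whole space, seen as a neighbourhood of 0.\<close>
  have "(+) 0 ` topspace T = topspace T" by simp
  then have fr0: "\<exists>\<^sub>F n in sequentially. grows u ((+) 0 ` topspace T) b n"
    using fr by simp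
  obtain z\<^sub>0 where z0: "P 0 z\<^sub>0"
    using concentration_step[OF u zero_in openin_topspace subspace_imp_convex[OF subspace_topspace] zero_in
        W(1,2,3,4) \<beta>(3) fr0, of 0] unfolding P_def by fast
  define Q where "Q = (\<lambda>k z z'. \<exists>y. y - z \<in> dilate 2 (W k) \<and> y - z' \<in> W (Suc k))"
  have step: "\<exists>z'. P (Suc k) z' \<and> Q k z z'" if "P k z" for k z
  proof -
    have "z \<in> topspace T"
      "\<exists>\<^sub>F n in sequentially. grows u ((+) z ` W k) (\<beta> k) n"
      using that by (auto simp: P_def)
    from concentration_step[OF u this(1) W(1,2,3) W(1,2,3,4) \<beta>(1) this(2), of "Suc k"]
    show ?thesis unfolding P_def Q_def by fast
  qed
  obtain z where z: "\<And>k. P k (z k)" "\<And>k. Q k (z k) (z (Suc k))"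
    using dependent_nat_choice[of P Q, OF exI[of "P 0", OF z0] step] by metis
  have zt: "z k \<in> topspace T" for k using z(1) by (simp add: P_def)
  obtain x where x: "x \<in> topspace T"
    and lim: "\<And>U. openin T U \<and> x \<in> U \<Longrightarrow> (\<exists>k0. \<forall>k\<ge>k0. (+) (z k) ` W k \<subseteq> U)"
    using complete zt z(2) unfolding Q_def by metis
  have "below_entropy x (b' - u x)"
  proof (rule below_entropy_frequentlyI[OF x])
    fix A c assume A: "openin T A" "x \<in> A" and c: "c < b' - u x"
    define \<epsilon> where "\<epsilon> = b' - u x - c"
    have \<epsilon>: "\<epsilon> > 0" using c by (simp add: \<epsilon>_def)
    \<comment> \<open>On \<open>A2\<close> the exponential factor is at most
      \<open>exp ((u x + \<epsilon>) * N)\<close>. Dividing by it leaves a rate of at least b' - u x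
      - \<epsilon>, which is c. Only the upper bound on u matters.\<close>
    define A2 where "A2 = A \<inter> {y \<in> topspace T. u y \<in> {..< u x + \<epsilon>}}"
    have "openin T {y \<in> topspace T. u y \<in> {..< u x + \<epsilon>}}"
      using u unfolding continuous_functional_def by (intro openin_continuous_map_preimage) auto
    then have A2: "openin T A2" "x \<in> A2" unfolding A2_def using A x \<epsilon> by auto
    obtain k where k: "(+) (z k) ` W k \<subseteq> A2" using lim[of A2] A2 by (meson order_refl)
    have "\<exists>\<^sub>F n in sequentially. grows u ((+) (z k) ` W k) (\<beta> k) n"
      using z(1) by (simp add: P_def)
    then show "\<exists>\<^sub>F n in sequentially. grows (\<lambda>_. 0) A c n"
    proof (rule frequently_rev_mp, intro eventually_mono[OF eventually_ge_at_top[of 1]] impI)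
      fix n :: nat assume n: "1 \<le> n" and le: "grows u ((+) (z k) ` W k) (\<beta> k) n"
      define N where "N = real n ^ CARD('d)"
      have N: "N > 0" using n by (simp add: N_def)
      have "Z u n ((+) (z k) ` W k) \<le> Z u n A2" using k by (intro Z_mono) auto
      also have "\<dots> \<le> (\<integral>\<^sup>+\<omega>. ennreal (exp ((u x + \<epsilon>) * N)) * (ennreal (exp 0) *
          indicator A (box_mean (lattice_box 0 n) (\<eta> \<omega>))) \<partial>M)"
        unfolding Z_def
      proof (rule nn_integral_mono)
        fix \<omega> assume w: "\<omega> \<in> space M"
        let ?y = "box_mean (lattice_box 0 n) (\<eta> \<omega>)" and ?S = "\<Sum>z\<in>lattice_box 0 n. \<eta> \<omega> z"
        have "?S = N *\<^sub>R ?y" using n by (simp add: box_mean_def N_def)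
        then have uS: "u ?S = N * u ?y" using functional_scale[OF u box_mean_in[OF w]] by simp
        show "ennreal (exp (u ?S)) * indicator A2 ?y
            \<le> ennreal (exp ((u x + \<epsilon>) * N)) * (ennreal (exp 0) * indicator A ?y)"
        proof (cases "?y \<in> A2")
          case True
          then have "u ?y \<le> u x + \<epsilon>" "?y \<in> A" by (auto simp: A2_def)
          then have "u ?S \<le> (u x + \<epsilon>) * N" using uS N by (simp add: mult.commute)
          then show ?thesis using True \<open>?y \<in> A\<close> by (simp add: ennreal_leI)
        qed simp
      qed
      also have "\<dots> = ennreal (exp ((u x + \<epsilon>) * N)) * Z (\<lambda>_. 0) n A"
        unfolding Z_def
        by (rule nn_integral_cmult) (use mean_indicator_measurable[OF A(1)] in simp)
      finally have le2: "ennreal (exp (\<beta> k * N)) \<le> ennreal (exp ((u x + \<epsilon>) * N)) * Z (\<lambda>_. 0) n A"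
        using le by (simp add: N_def)
      have "c * N + (u x + \<epsilon>) * N \<le> \<beta> k * N"
        using \<beta>(2)[of k] N unfolding \<epsilon>_def by (simp add: algebra_simps)
      then have "ennreal (exp (c * N)) * ennreal (exp ((u x + \<epsilon>) * N)) \<le> ennreal (exp (\<beta> k * N))"
        by (simp add: ennreal_leI flip: ennreal_mult exp_add)
      also note le2
      finally have "ennreal (exp ((u x + \<epsilon>) * N)) * ennreal (exp (c * N)) \<le> ennreal (exp ((u x + \<epsilon>) * N)) * Z (\<lambda>_. 0) n A"
        by (simp add: mult.commute)
      then show "grows (\<lambda>_. 0) A c n"
        by (subst (asm) ennreal_mult_le_mult_iff) (auto simp: N_def)
    qed
  qed
  then show ?thesis by (rule that)
qed


section \<open>Separation\<close>

lemma below_entropy_nonpos: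
  assumes "below_entropy z b" shows "b \<le> 0"
proof (rule ccontr)
  assume "\<not> b \<le> 0"
  then have "b / 2 < b" "0 < b / 2" by auto
  then have "\<forall>\<^sub>F n in sequentially. grows (\<lambda>_. 0) (topspace T) (b / 2) n"
    using assms unfolding below_entropy_def by blast
  with eventually_ge_at_top[of 1]
  have "\<forall>\<^sub>F n :: nat in sequentially. False"
  proof eventually_elim
    case n: (elim n)
    have "Z (\<lambda>_. 0) n (topspace T) \<le> 1" by (simp add: Z_zero_eq measure_le_1 emeasure_le_1)
    with n(2) have "ennreal (exp (b / 2 * real n ^ CARD('d))) \<le> 1" by (rule order_trans)
    then have "ennreal (exp (b / 2 * real n ^ CARD('d))) \<le> ennreal 1" by (simp only: ennreal_1)
    then have "exp (b / 2 * real n ^ CARD('d)) \<le> 1" by (subst (asm) ennreal_le_iff) auto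
    moreover have "0 < b / 2 * real n ^ CARD('d)" using n(1) \<open>0 < b / 2\<close> by simp
    ultimately show False by simp
  qed
  then show False by simp
qed

text \<open>The cone theorem is applied to the cone over the hypograph seen from
  \<open>(y, a)\<close>: the constraint \<open>u (z - y) \<le> a - b\<close> is the claim. Concavity
  closes the cone under addition; the failure of rate a on \<open>A\<close> and the bound
  \<open>b \<le> 0\<close> supply compatibility with the gauge.\<close>

lemma separating_functional:
  assumes A: "openin T A" "y \<in> A"
    and na: "\<not> (\<forall>\<^sub>F n in sequentially. grows (\<lambda>_. 0) A a n)"
  obtains u where "continuous_functional T u" "\<And>z b. below_entropy z b \<Longrightarrow> u z + b \<le> u y + a"
proof -
  have y: "y \<in> topspace T" using A openin_subset by blast
  obtain V where V: "openin T V" "convex V" "0 \<in> V" "\<And>v. v \<in> V \<Longrightarrow> - v \<in> V" "\<And>v. v \<in> V \<Longrightarrow> y + v \<in> A"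
    using symmetric_nbhd[OF A] by metis
  have b_le: "b \<le> a" if "below_entropy z b" "z \<in> A" for z b
    using that na A unfolding below_entropy_def by (meson not_le)
  \<comment> \<open>Since b \<le> 0, a - b \<ge> - k holds everywhere; so k is the slope permitted
    to u on \<open>V\<close>.\<close>
  define k where "k = max 0 (- a)"
  \<comment> \<open>The vertex is adjoined by hand: t > 0 excludes it, and the hypograph may be
    empty.\<close>
  define H where "H = insert (0, 0) {(t *\<^sub>R (z - y), t * (a - b)) | t z b. 0 < t \<and> below_entropy z b}"
  have zt: "z \<in> topspace T" if "below_entropy z b" for z b using that by (simp add: below_entropy_def)
  have H_cases: thesis if "(z, c) \<in> H" "z = 0 \<Longrightarrow> c = 0 \<Longrightarrow> thesis"
    "\<And>t x b. 0 < t \<Longrightarrow> below_entropy x b \<Longrightarrow> z = t *\<^sub>R (x - y) \<Longrightarrow> c = t * (a - b) \<Longrightarrow> thesis" for z c thesis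
    using that unfolding H_def by blast
  show ?thesis
  proof (rule Hahn_Banach_cone[OF subspace_topspace V(2,3,4) absorbing[OF V(1,3)], of k H])
    show "k \<ge> 0" by (simp add: k_def)
    show "(0, 0) \<in> H" by (simp add: H_def)
    show "z \<in> topspace T" if "(z, c) \<in> H" for z c
      using that by (elim H_cases) (auto intro: zero_in scale_in diff_in zt y)
    show "(t *\<^sub>R z, t * c) \<in> H" if H: "(z, c) \<in> H" and t: "t > 0" for z c t
      using H
    proof (rule H_cases)
      fix s x b assume *: "0 < s" "below_entropy x b" "z = s *\<^sub>R (x - y)" "c = s * (a - b)"
      then have "t *\<^sub>R z = (t * s) *\<^sub>R (x - y)" "t * c = (t * s) * (a - b)" "0 < t * s" using t by auto
      then show ?thesis unfolding H_def using *(2) by blast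
    qed (simp add: H_def)
    show "(z + z', c + c') \<in> H" if h: "(z, c) \<in> H" "(z', c') \<in> H" for z c z' c'
      using h(1)
    proof (rule H_cases)
      assume "z = 0" "c = 0" then show ?thesis using h(2) by simp
    next
      fix s x b assume 1: "0 < s" "below_entropy x b" "z = s *\<^sub>R (x - y)" "c = s * (a - b)"
      show ?thesis using h(2)
      proof (rule H_cases)
        assume "z' = 0" "c' = 0" then show ?thesis using h(1) by simp
      next
        fix s' x' b' assume 2: "0 < s'" "below_entropy x' b'" "z' = s' *\<^sub>R (x' - y)" "c' = s' * (a - b')"
        \<comment> \<open>Two rays of the cone add up to the ray through the convex combination of
          their base points, with weights proportional to s and s'.\<close>
        define q where "q = s / (s + s')"
        have q: "0 \<le> q" "q \<le> 1" "(s + s') * q = s" "(s + s') * (1 - q) = s'"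
          using 1(1) 2(1) by (auto simp: q_def field_simps)
        have "below_entropy (q *\<^sub>R x + (1 - q) *\<^sub>R x') (q * b + (1 - q) * b')"
          by (rule below_entropy_convex[OF 1(2) 2(2) q(1,2)])
        moreover have "z + z' = (s + s') *\<^sub>R ((q *\<^sub>R x + (1 - q) *\<^sub>R x') - y)"
        proof -
          have "(s + s') *\<^sub>R ((q *\<^sub>R x + (1 - q) *\<^sub>R x') - y)
              = ((s + s') * q) *\<^sub>R x + ((s + s') * (1 - q)) *\<^sub>R x' - (s + s') *\<^sub>R y"
            by (simp add: scaleR_add_right scaleR_diff_right)
          then show ?thesis unfolding q by (simp add: 1 2 algebra_simps)
        qed
        moreover have "c + c' = (s + s') * (a - (q * b + (1 - q) * b'))"
        proof -
          have "(s + s') * (a - (q * b + (1 - q) * b')) = (s + s') * a - ((s + s') * q) * b - ((s + s') * (1 - q)) * b'"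
            by (simp add: algebra_simps)
          then show ?thesis unfolding q by (simp add: 1 2 algebra_simps)
        qed
        moreover have "0 < s + s'" using 1 2 by simp
        ultimately show ?thesis unfolding H_def by blast
      qed
    qed
    show "- (k * r) \<le> c" if H: "(z, c) \<in> H" and r: "0 \<le> r" "z \<in> dilate r V" for z c r
      using H
    proof (rule H_cases)
      assume "c = 0" then show ?thesis using r by (simp add: k_def)
    next
      fix t x b assume *: "0 < t" "below_entropy x b" "z = t *\<^sub>R (x - y)" "c = t * (a - b)"
      show ?thesis
      \<comment> \<open>If r \<le> t, the base point x lies in \<open>y + V\<close>, hence in
        \<open>A\<close>, where the entropy is at most a. Otherwise x may be far away, and the bound
        - k on a - b, multiplied by t < r, is enough.\<close>
      proof (cases "r \<le> t")
        case True
        have "x - y \<in> dilate (inverse t * r) V"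
          using scaleR_mem_dilate[OF r(2), of "inverse t"] * by simp
        then have "x - y \<in> dilate 1 V"
          by (rule dilate_mono[OF V(2,3), rotated 2]) (use * r True in \<open>auto simp: field_simps\<close>)
        then have "x \<in> A" using V(5)[of "x - y"] by simp
        then have "0 \<le> t * (a - b)" using b_le[OF *(2)] *(1) by simp
        moreover have "0 \<le> k * r" using r by (simp add: k_def)
        ultimately show ?thesis using *(4) by linarith
      next
        case False
        have "- k \<le> a - b" using below_entropy_nonpos[OF *(2)] unfolding k_def by linarith
        then have "t * (- k) \<le> t * (a - b)" using *(1) by (intro mult_left_mono) auto
        moreover have "t * k \<le> r * k" using False by (intro mult_right_mono) (auto simp: k_def)
        ultimately show ?thesis using *(4) by (simp add: mult.commute)
      qed
    qed
    fix u assume u: "linear_between (topspace T) UNIV u" "\<And>v. v \<in> V \<Longrightarrow> v \<in> topspace T \<Longrightarrow> \<bar>u v\<bar> \<le> k"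
      "\<And>z c. (z, c) \<in> H \<Longrightarrow> u z \<le> c"
    have uc: "continuous_functional T u"
      unfolding continuous_functional_def
      using u(1,2) openin_subset[OF V(1)] by (blast intro: continuous_linear_functionalI[OF u(1) V(1,3)])
    show ?thesis
    proof (rule that[OF uc])
      fix z b assume h: "below_entropy z b"
      have "(1 *\<^sub>R (z - y), 1 * (a - b)) \<in> H" unfolding H_def using h zero_less_one by blast
      then have "u (z - y) \<le> a - b" using u(3) by fastforce
      then show "u z + b \<le> u y + a" by (simp add: functional_diff[OF uc zt[OF h] y])
    qed
  qed
qed

end

section \<open>Rates on the logarithmic scale\<close>

text \<open>The dictionary between \<open>grows\<close> and rates. Because b is real, it remains
  correct for q = 0 and q = \<infinity>.\<close>

lemma le_elog_divide_iff:
  assumes "N > 0"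
  shows "ereal b \<le> elog q / ereal N \<longleftrightarrow> ennreal (exp (b * N)) \<le> q"
proof (cases q)
  case (real r)
  show ?thesis
  proof (cases "r = 0")
    case True
    then show ?thesis using real assms by (simp add: elog_def ennreal_eq_0_iff)
  next
    case False
    then have r: "r > 0" using real by simp
    have "b \<le> ln r / N \<longleftrightarrow> exp (b * N) \<le> r"
      using assms r by (simp add: le_divide_eq ln_ge_iff)
    then show ?thesis using real r assms by (simp add: elog_def ennreal_le_iff)
  qed
next
  case top
  then show ?thesis using assms by (simp add: elog_def)
qed

lemma elog_divide_le:
  assumes "N > 0" "q \<le> ennreal (exp (b * N))" shows "elog q / ereal N \<le> ereal b"
proof (cases q)
  case (real r)
  show ?thesis
  proof (cases "r = 0")
    case True
    then show ?thesis using real assms by (simp add: elog_def)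
  next
    case False
    then have r: "r > 0" using real by simp
    have "r \<le> exp (b * N)" using assms(2) real by simp
    then have "ln r \<le> b * N" using r by (metis exp_gt_zero ln_exp ln_le_cancel_iff)
    then show ?thesis using real r assms by (simp add: elog_def divide_le_eq)
  qed
next
  case top
  then show ?thesis using assms(2) by (simp add: top_unique)
qed

text \<open>If liminf were smaller than limsup, two reals between them would contradict the
  hypothesis. The limit may be infinite.\<close>

lemma convergent_erealI:
  fixes p :: "nat \<Rightarrow> ereal"
  assumes "\<And>b b'. \<exists>\<^sub>F n in sequentially. ereal b \<le> p n \<Longrightarrow> b' < b \<Longrightarrow> \<forall>\<^sub>F n in sequentially. ereal b' \<le> p n"
  shows "convergent p"
proof -
  have "limsup p \<le> liminf p"
  proof (rule ccontr)
    assume "\<not> limsup p \<le> liminf p"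
    then have "liminf p < limsup p" by simp
    then obtain b' where b': "liminf p < ereal b'" "ereal b' < limsup p" using ereal_dense2 by blast
    obtain b where b: "ereal b' < ereal b" "ereal b < limsup p" using ereal_dense2[OF b'(2)] by blast
    have "\<exists>\<^sub>F n in sequentially. ereal b \<le> p n"
    proof (rule ccontr)
      assume "\<not> ?thesis"
      then have "\<forall>\<^sub>F n in sequentially. p n \<le> ereal b"
        unfolding not_frequently by (auto elim: eventually_mono)
      then have "limsup p \<le> ereal b" by (rule Limsup_bounded)
      then show False using b(2) by simp
    qed
    then have "\<forall>\<^sub>F n in sequentially. ereal b' \<le> p n" using b(1) by (intro assms) auto
    then have "ereal b' \<le> liminf p" by (rule Liminf_bounded)
    then show False using b'(1) by simp
  qed
  then show ?thesis
    unfolding convergent_ereal using Liminf_le_Limsup[of sequentially p] by simp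
qed

context decoupled_field
begin

text \<open>The exponential Markov inequality: on A the sum has u-value at least s times the
  volume.\<close>

lemma chernoff_bound:
  assumes u: "continuous_functional T u" and A: "openin T A" "\<And>y. y \<in> A \<Longrightarrow> s \<le> u y" and n: "n \<ge> 1"
  shows "ennreal (exp (s * real n ^ CARD('d))) * Z (\<lambda>_. 0) n A \<le> Z u n (topspace T)"
proof -
  define N where "N = real n ^ CARD('d)"
  have "ennreal (exp (s * N)) * Z (\<lambda>_. 0) n A = (\<integral>\<^sup>+\<omega>. ennreal (exp (s * N)) * (ennreal (exp 0) *
          indicator A (box_mean (lattice_box 0 n) (\<eta> \<omega>))) \<partial>M)"
    unfolding Z_def
    by (rule nn_integral_cmult[symmetric]) (use mean_indicator_measurable[OF A(1)] in simp)
  also have "\<dots> \<le> Z u n (topspace T)"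
    unfolding Z_def
  proof (rule nn_integral_mono)
    fix \<omega> assume w: "\<omega> \<in> space M"
    let ?y = "box_mean (lattice_box 0 n) (\<eta> \<omega>)" and ?S = "\<Sum>z\<in>lattice_box 0 n. \<eta> \<omega> z"
    have "?S = N *\<^sub>R ?y" using n by (simp add: box_mean_def N_def)
    then have uS: "u ?S = N * u ?y" using functional_scale[OF u box_mean_in[OF w]] by simp
    show "ennreal (exp (s * N)) * (ennreal (exp 0) * indicator A ?y)
        \<le> ennreal (exp (u ?S)) * indicator (topspace T) ?y"
    proof (cases "?y \<in> A")
      case True
      then have "s * N \<le> u ?S" using A(2) n by (simp add: uS N_def mult.commute)
      then show ?thesis using True box_mean_in[OF w] by (simp add: ennreal_leI)
    qed simp
  qed
  finally show ?thesis by (simp add: N_def)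
qed

end


section \<open>Projective limits\<close>

context projective_system
begin

lemma frechet_topology_T: "i \<in> J \<Longrightarrow> frechet_topology (T i)"
  using frechet by (simp add: frechet_topology_def)

lemma f_in: "i \<in> J \<Longrightarrow> f i x \<in> topspace (T i)"
  using f_linear unfolding linear_between_def by blast

lemma f_add: "i \<in> J \<Longrightarrow> f i (x + y) = f i x + f i y"
  and f_scale: "i \<in> J \<Longrightarrow> f i (a *\<^sub>R x) = a *\<^sub>R f i x"
  using f_linear unfolding linear_between_def by blast+

lemma f_zero: "i \<in> J \<Longrightarrow> f i 0 = 0"
  using f_scale[of i 0 0] by simp

lemma f_minus: "i \<in> J \<Longrightarrow> f i (- x) = - f i x"
  using f_scale[of i "-1" x] by simp

lemma f_diff: "i \<in> J \<Longrightarrow> f i (x - y) = f i x - f i y"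
  using f_add[of i x "- y"] by (simp add: f_minus)

lemma f_sum: "i \<in> J \<Longrightarrow> finite S \<Longrightarrow> f i (\<Sum>z\<in>S. \<xi> z) = (\<Sum>z\<in>S. f i (\<xi> z))"
  using linear_between_sum[OF f_linear subspace_UNIV] by simp

lemma proj_base_vimage:
  assumes i: "i \<in> J"
  shows "(+) x ` (f i -` D) = f i -` ((+) (f i x) ` D)"
proof (intro equalityI subsetI)
  fix y assume "y \<in> f i -` ((+) (f i x) ` D)"
  then obtain d where d: "d \<in> D" "f i y = f i x + d" by auto
  then have "f i (y - x) \<in> D" by (simp add: f_diff[OF i])
  then show "y \<in> (+) x ` (f i -` D)" by (intro image_eqI[of _ _ "y - x"]) auto
qed (auto simp: f_add[OF i])

lemma proj_baseI:
  assumes "i \<in> J" "t > 0" "C \<in> B i"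
  shows "f i -` ((+) (f i x) ` dilate t C) \<in> proj_base J B f"
proof -
  have "f i -` dilate t C \<in> proj_zero_base J B f" 
    unfolding proj_zero_base_def using assms
    by (intro CollectI exI[of _ i] exI[of _ t] exI[of _ C]) simp
  then have "(+) x ` (f i -` dilate t C) \<in> proj_base J B f"
    unfolding proj_base_def by (intro CollectI exI[of _ x] exI[of _ "f i -` dilate t C"]) simp
  then show ?thesis by (simp only: proj_base_vimage[OF assms(1)])
qed

lemma proj_baseE:
  assumes "A \<in> proj_base J B f"
  obtains i x t C where "i \<in> J" "t > 0" "C \<in> B i" "A = f i -` ((+) (f i x) ` dilate t C)"
proof -
  obtain x U where U: "A = (+) x ` U" "U \<in> proj_zero_base J B f"
    using assms unfolding proj_base_def by fast
  obtain i t C where "i \<in> J" "t > 0" "C \<in> B i" "U = f i -` dilate t C"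
    using U(2) unfolding proj_zero_base_def by fast
  then show ?thesis using that[of i t C x] U(1) by (simp only: proj_base_vimage)
qed

lemma open_base_set:
  assumes "i \<in> J" "t > 0" "C \<in> B i"
  shows "openin (T i) ((+) (f i x) ` dilate t C)"
proof -
  interpret frechet_topology "T i" by (rule frechet_topology_T[OF assms(1)])
  have "openin (T i) C" using zero_base[OF assms(1)] assms(3) by (auto simp: convex_zero_base_def)
  then show ?thesis using assms(2) by (intro openin_translation openin_dilate f_in assms) auto
qed

lemma base_nbhd:
  assumes i: "i \<in> J" and U: "openin (T i) U" "f i x \<in> U"
  obtains C where "C \<in> B i" "(+) (f i x) ` dilate 1 C \<subseteq> U" "f i x \<in> (+) (f i x) ` dilate 1 C"
proof -
  interpret frechet_topology "T i" by (rule frechet_topology_T[OF i])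
  have "openin (T i) {y \<in> topspace (T i). 1 *\<^sub>R y + f i x \<in> U}"
    by (rule openin_affine_preimage[OF U(1) f_in[OF i]])
  moreover have "0 \<in> {y \<in> topspace (T i). 1 *\<^sub>R y + f i x \<in> U}" using U(2) zero_in by simp
  ultimately obtain C where C: "C \<in> B i" "C \<subseteq> {y \<in> topspace (T i). 1 *\<^sub>R y + f i x \<in> U}"
    using zero_base[OF i] unfolding convex_zero_base_def by meson
  have "0 \<in> C" using zero_base[OF i] C(1) by (auto simp: convex_zero_base_def)
  then have "f i x \<in> (+) (f i x) ` dilate 1 C" by (intro image_eqI[of _ _ 0]) auto
  moreover have "(+) (f i x) ` dilate 1 C \<subseteq> U" using C(2) by (auto simp: add.commute)
  ultimately show ?thesis using that C(1) by blast
qed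

lemma f_measurable:
  assumes i: "i \<in> J" shows "f i \<in> measurable (proj_sigma J B f) (borel_of (T i))"
proof (rule borel_of_measurableI)
  interpret frechet_topology "T i" by (rule frechet_topology_T[OF i])
  have space: "space (proj_sigma J B f) = UNIV" by (simp add: proj_sigma_def space_measure_of_conv)
  have sets: "A \<in> sets (proj_sigma J B f)" if "A \<in> proj_base J B f" for A
    unfolding proj_sigma_def using that by (intro in_measure_of) auto
  show "f i x \<in> topspace (T i)" for x by (rule f_in[OF i])
  fix U assume U: "openin (T i) U"
  define \<U> where "\<U> = {(+) (f i x) ` dilate 1 C | x C. C \<in> B i \<and> (+) (f i x) ` dilate 1 C \<subseteq> U}"
  have "Lindelof_space (subtopology (T i) (U \<inter> range (f i)))"
    by (intro second_countable_imp_Lindelof_space second_countable_subtopology second_countable separable i)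
  moreover have sub: "U \<inter> range (f i) \<subseteq> topspace (T i)" using openin_subset[OF U] by blast
  moreover have "openin (T i) O'" if "O' \<in> \<U>" for O'
    using that open_base_set[OF i zero_less_one] unfolding \<U>_def by blast
  moreover have "U \<inter> range (f i) \<subseteq> \<Union>\<U>"
  proof
    fix y assume "y \<in> U \<inter> range (f i)"
    then obtain x where x: "y = f i x" "f i x \<in> U" by auto
    obtain C where "C \<in> B i" "(+) (f i x) ` dilate 1 C \<subseteq> U" "f i x \<in> (+) (f i x) ` dilate 1 C"
      using base_nbhd[OF i U x(2)] by metis
    then show "y \<in> \<Union>\<U>" unfolding \<U>_def x(1) by blast
  qed
  ultimately obtain \<V> where V: "countable \<V>" "\<V> \<subseteq> \<U>" "U \<inter> range (f i) \<subseteq> \<Union>\<V>"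
    unfolding Lindelof_space_subtopology_subset[OF sub] by meson
  have "{x \<in> space (proj_sigma J B f). f i x \<in> U} = (\<Union>A\<in>\<V>. f i -` A)"
  proof (intro equalityI subsetI)
    fix x assume "x \<in> {x \<in> space (proj_sigma J B f). f i x \<in> U}"
    then have "f i x \<in> \<Union>\<V>" using V(3) by blast
    then show "x \<in> (\<Union>A\<in>\<V>. f i -` A)" by blast
  next
    fix x assume "x \<in> (\<Union>A\<in>\<V>. f i -` A)"
    then obtain A where "A \<in> \<V>" "f i x \<in> A" by blast
    then have "f i x \<in> U" using V(2) unfolding \<U>_def by blast
    then show "x \<in> {x \<in> space (proj_sigma J B f). f i x \<in> U}" by (simp add: space)
  qed
  also have "\<dots> \<in> sets (proj_sigma J B f)"
  proof (rule sets.countable_UN''[OF V(1)])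
    fix A assume "A \<in> \<V>"
    then obtain x C where "C \<in> B i" "A = (+) (f i x) ` dilate 1 C" using V(2) unfolding \<U>_def by blast
    then show "f i -` A \<in> sets (proj_sigma J B f)" using proj_baseI[OF i zero_less_one] sets by blast
  qed
  finally show "{x \<in> space (proj_sigma J B f). f i x \<in> U} \<in> sets (proj_sigma J B f)" .
qed

lemma topspace_proj_topology [simp]: "topspace (proj_topology J B f) = UNIV"
proof -
  obtain i where i: "i \<in> J" using nonempty by blast
  have "x \<in> \<Union>(proj_base J B f)" for x
  proof -
    obtain C where "C \<in> B i" "f i x \<in> (+) (f i x) ` dilate 1 C"
      using base_nbhd[OF i openin_topspace f_in[OF i]] by metis
    then show ?thesis using proj_baseI[OF i zero_less_one, of C x] by blast
  qed
  then show ?thesis unfolding proj_topology_def by auto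
qed

lemma f_continuous:
  assumes i: "i \<in> J" shows "continuous_map (proj_topology J B f) (T i) (f i)"
  unfolding continuous_map_def
proof (intro conjI allI impI)
  show "f i \<in> topspace (proj_topology J B f) \<rightarrow> topspace (T i)" using f_in[OF i] by simp
  fix U assume U: "openin (T i) U"
  show "openin (proj_topology J B f) {x \<in> topspace (proj_topology J B f). f i x \<in> U}"
  proof (subst openin_subopen, intro ballI)
    fix x assume x: "x \<in> {x \<in> topspace (proj_topology J B f). f i x \<in> U}"
    then have "f i x \<in> U" by simp
    then obtain C where C: "C \<in> B i" "(+) (f i x) ` dilate 1 C \<subseteq> U" "f i x \<in> (+) (f i x) ` dilate 1 C"
      using base_nbhd[OF i U] by metis
    show "\<exists>A. openin (proj_topology J B f) A \<and> x \<in> A \<and> A \<subseteq> {x \<in> topspace (proj_topology J B f). f i x \<in> U}"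
    proof (intro exI conjI)
      show "openin (proj_topology J B f) (f i -` ((+) (f i x) ` dilate 1 C))"
        unfolding proj_topology_def
        by (rule topology_generated_by_Basis) (rule proj_baseI[OF i zero_less_one C(1)])
    qed (use C in auto)
  qed
qed

lemma functional_in_dual:
  assumes i: "i \<in> J" and u: "continuous_functional (T i) u"
  shows "(\<lambda>x. u (f i x)) \<in> topological_dual (proj_topology J B f)"
proof -
  interpret frechet_topology "T i" by (rule frechet_topology_T[OF i])
  have "linear (\<lambda>x. u (f i x))"
    by (rule linearI) (simp_all add: f_add[OF i] f_scale[OF i] functional_add[OF u] functional_scale[OF u] f_in[OF i])
  moreover have "continuous_map (proj_topology J B f) euclideanreal (u \<circ> f i)"
    using u unfolding continuous_functional_def by (intro continuous_map_compose[OF f_continuous[OF i]]) simp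
  ultimately show ?thesis by (simp add: topological_dual_def o_def)
qed

text \<open>Directedness of \<open>J\<close> makes the single maps \<open>f i\<close> suffice to describe neighbourhoods.\<close>

lemma open_cylinder:
  assumes "generate_topology_on (proj_base J B f) S" "x \<in> S"
  shows "\<exists>i\<in>J. \<exists>V. openin (T i) V \<and> f i x \<in> V \<and> f i -` V \<subseteq> S"
  using assms
proof (induction arbitrary: x rule: generate_topology_on.induct)
  case Empty
  then show ?case by simp
next
  case (Int a b)
  obtain i V where i: "i \<in> J" "openin (T i) V" "f i x \<in> V" "f i -` V \<subseteq> a" using Int by blast
  obtain j W where j: "j \<in> J" "openin (T j) W" "f j x \<in> W" "f j -` W \<subseteq> b" using Int by blast
  obtain k where k: "k \<in> J" "le i k" "le j k" using directed[OF i(1) j(1)] by blast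
  define U where "U = {y \<in> topspace (T k). h i k y \<in> V} \<inter> {y \<in> topspace (T k). h j k y \<in> W}"
  have "openin (T k) U"
    unfolding U_def using h_continuous i j k
    by (intro openin_Int openin_continuous_map_preimage) auto
  moreover have "f k y \<in> U \<longleftrightarrow> f i y \<in> V \<and> f j y \<in> W" for y
    using f_comp[OF i(1) k(1,2), of y] f_comp[OF j(1) k(1,3), of y] f_in[OF k(1), of y] by (simp add: U_def)
  ultimately show ?case using i j k(1) by (intro bexI[of _ k] exI[of _ U]) auto
next
  case (UN K)
  then obtain k where k: "k \<in> K" "x \<in> k" by blast
  then obtain i V where "i \<in> J" "openin (T i) V" "f i x \<in> V" "f i -` V \<subseteq> k" using UN.IH by meson
  then show ?case using k(1) by blast
next
  case (Basis s)
  obtain i x0 t C where s: "i \<in> J" "t > 0" "C \<in> B i" "s = f i -` ((+) (f i x0) ` dilate t C)"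
    by (rule proj_baseE[OF Basis(1)], rule that)
  then show ?case using open_base_set[OF s(1-3), of x0] Basis(2) by auto
qed

text \<open>Continuity at 0 bounds u on the preimage of some neighbourhood in a single Y_i. Then |u|
  is dominated by a gauge of \<open>f i x\<close>, so u descends to the range of \<open>f i\<close>,
  and Hahn-Banach extends it to Y_i.\<close>

lemma dual_factor:
  assumes u: "u \<in> topological_dual (proj_topology J B f)"
  obtains i v where "i \<in> J" "continuous_functional (T i) v" "\<And>x. u x = v (f i x)"
proof -
  have lin: "linear u" and cont: "continuous_map (proj_topology J B f) euclideanreal u"
    using u by (auto simp: topological_dual_def)
  have "openin (proj_topology J B f) {x \<in> topspace (proj_topology J B f). u x \<in> {-1<..<1}}"
    using cont by (rule openin_continuous_map_preimage) simp
  then have "generate_topology_on (proj_base J B f) {x. u x \<in> {-1<..<1}}"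
    unfolding topspace_proj_topology by (simp add: proj_topology_def openin_topology_generated_by_iff)
  moreover have "0 \<in> {x. u x \<in> {-1<..<1}}" using linear_0[OF lin] by simp
  ultimately obtain i V\<^sub>0 where i: "i \<in> J" and V0: "openin (T i) V\<^sub>0" "f i 0 \<in> V\<^sub>0"
    "f i -` V\<^sub>0 \<subseteq> {x. u x \<in> {-1<..<1}}" using open_cylinder by meson
  interpret frechet_topology "T i" by (rule frechet_topology_T[OF i])
  obtain V where V: "openin (T i) V" "convex V" "0 \<in> V" "\<And>v. v \<in> V \<Longrightarrow> - v \<in> V"
    "\<And>v. v \<in> V \<Longrightarrow> f i 0 + v \<in> V\<^sub>0" using symmetric_nbhd[OF V0(1,2)] by metis
  have V1: "\<bar>u x\<bar> \<le> 1" if "f i x \<in> V" for x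
    using V(5)[OF that] V0(3) by (auto simp: f_zero[OF i] abs_le_iff)
  \<comment> \<open>Dividing by s > r instead of r includes r = 0, the case which shows that u
    vanishes on the kernel of \<open>f i\<close>.\<close>
  have bound: "\<bar>u x\<bar> \<le> r" if x: "f i x \<in> dilate r V" and r: "0 \<le> r" for x r
  proof (rule dense_ge)
    fix s assume s: "r < s"
    have "inverse s *\<^sub>R f i x \<in> dilate 1 V"
      using s r by (intro scaleR_dilate_mono[OF V(2,3) x]) (auto simp: field_simps)
    then have "\<bar>u (inverse s *\<^sub>R x)\<bar> \<le> 1" by (intro V1) (simp add: f_scale[OF i])
    then have "inverse s * \<bar>u x\<bar> \<le> 1" using s r by (simp add: linear_cmul[OF lin] abs_mult)
    then show "\<bar>u x\<bar> \<le> s" using s r by (simp add: field_simps)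
  qed
  \<comment> \<open>The constraints form a linear space, being the graph of the functional on the
    range. Each inequality therefore holds for x and - x and becomes an equality.\<close>
  define H where "H = range (\<lambda>x. (f i x, u x))"
  show ?thesis
  proof (rule Hahn_Banach_cone[OF subspace_topspace V(2,3,4) absorbing[OF V(1,3)], of 1 H])
    show "(0::real) \<le> 1" by (rule zero_le_one)
    show "(0, 0) \<in> H" unfolding H_def by (rule range_eqI[of _ _ 0]) (simp add: f_zero[OF i] linear_0[OF lin])
    show "z \<in> topspace (T i)" if "(z, c) \<in> H" for z c using that f_in[OF i] by (auto simp: H_def)
    show "(z + z', c + c') \<in> H" if h: "(z, c) \<in> H" "(z', c') \<in> H" for z c z' c'
    proof -
      obtain x y where "z = f i x" "c = u x" "z' = f i y" "c' = u y" using h by (auto simp: H_def)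
      then have "(z + z', c + c') = (f i (x + y), u (x + y))" by (simp add: f_add[OF i] linear_add[OF lin])
      then show ?thesis by (simp add: H_def)
    qed
    show "(t *\<^sub>R z, t * c) \<in> H" if h: "(z, c) \<in> H" for z c t
    proof -
      obtain x where "z = f i x" "c = u x" using h by (auto simp: H_def)
      then have "(t *\<^sub>R z, t * c) = (f i (t *\<^sub>R x), u (t *\<^sub>R x))" by (simp add: f_scale[OF i] linear_cmul[OF lin])
      then show ?thesis by (simp add: H_def)
    qed
    show "- (1 * r) \<le> c" if "(z, c) \<in> H" "0 \<le> r" "z \<in> dilate r V" for z c r
      using that bound by (force simp: H_def abs_le_iff)
    fix v assume v: "linear_between (topspace (T i)) UNIV v" "\<And>y. y \<in> V \<Longrightarrow> y \<in> topspace (T i) \<Longrightarrow> \<bar>v y\<bar> \<le> 1"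
      "\<And>z c. (z, c) \<in> H \<Longrightarrow> v z \<le> c"
    have vc: "continuous_functional (T i) v"
      unfolding continuous_functional_def
      using v(1,2) openin_subset[OF V(1)] by (blast intro: continuous_linear_functionalI[OF v(1) V(1,3)])
    have le: "v (f i x) \<le> u x" for x by (rule v(3)) (simp add: H_def)
    have "u x = v (f i x)" for x
    proof -
      have "v (f i (- x)) = - v (f i x)"
        using functional_scale[OF vc f_in[OF i], of "-1" x] by (simp add: f_minus[OF i])
      then show ?thesis using le[of x] le[of "- x"] linear_neg[OF lin, of x] by simp
    qed
    then show ?thesis by (rule that[OF i vc])
  qed
qed

end

section \<open>The variational formula\<close>

context projective_system
begin

lemma decoupled_field_exists:
  fixes M :: "'w measure" and \<sigma> :: "'w \<Rightarrow> int ^ 'd \<Rightarrow> 'x"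
  assumes i: "i \<in> J" and M: "prob_space M"
    and \<sigma>: "\<sigma> \<in> measurable M (PiM UNIV (\<lambda>_. proj_sigma J B f))" and l: "l \<ge> 1"
    and "cadi M (T i) (\<lambda>\<omega> z. f i (\<sigma> \<omega> z))" and "cl M (T i) (B i) (\<lambda>\<omega> z. f i (\<sigma> \<omega> z))"
    and "translation_invariant l M (borel_of (T i)) (\<lambda>\<omega> z. f i (\<sigma> \<omega> z))"
  shows "\<exists>g c t \<alpha>. decoupled_field (T i) M (B i) (\<lambda>\<omega> z. f i (\<sigma> \<omega> z)) l g c t \<alpha>"
proof -
  have meas: "(\<lambda>\<omega>. f i (\<sigma> \<omega> z)) \<in> measurable M (borel_of (T i))" for z
  proof -
    have "(\<lambda>\<omega>. \<sigma> \<omega> z) \<in> measurable M (proj_sigma J B f)"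
      by (rule measurable_compose[OF \<sigma> measurable_component_singleton]) simp
    then show ?thesis by (rule measurable_compose[OF _ f_measurable[OF i]])
  qed
  obtain g c where "\<forall>n\<ge>1. 0 \<le> g n \<and> 0 \<le> c n" "(\<lambda>n. g n / real n) \<longlonglongrightarrow> 0"
    "(\<lambda>n. c n / real (card (lattice_box (0 :: int ^ 'd) n))) \<longlonglongrightarrow> 0"
    "\<forall>z. \<forall>n\<ge>1. \<forall>S. finite S \<longrightarrow>
      (\<forall>C \<in> convex_open_power (T i) (lattice_box z n). \<forall>D \<in> convex_open_power (T i) S.
         lattice_dist S (lattice_box z n) > ereal (g n) \<longrightarrow>
         measure M {\<omega>\<in>space M. restrict (\<lambda>z. f i (\<sigma> \<omega> z)) (lattice_box z n) \<in> C
             \<and> restrict (\<lambda>z. f i (\<sigma> \<omega> z)) S \<in> D}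
           \<ge> exp (- c n)
             * measure M {\<omega>\<in>space M. restrict (\<lambda>z. f i (\<sigma> \<omega> z)) (lattice_box z n) \<in> C}
             * measure M {\<omega>\<in>space M. restrict (\<lambda>z. f i (\<sigma> \<omega> z)) S \<in> D})"
    using assms(5) unfolding cadi_def by (elim exE conjE) (rule that)
  moreover obtain t \<alpha> where "\<forall>V\<in>B i. 0 < t V \<and> 0 < \<alpha> V \<and> \<alpha> V \<le> 1"
    "\<forall>V\<in>B i. \<forall>z S. finite S \<and> z \<notin> S \<longrightarrow>
      (\<forall>D \<in> convex_open_power (T i) S.
         measure M {\<omega>\<in>space M. f i (\<sigma> \<omega> z) \<in> dilate (t V) V \<and> restrict (\<lambda>z. f i (\<sigma> \<omega> z)) S \<in> D}
           \<ge> \<alpha> V * measure M {\<omega>\<in>space M. restrict (\<lambda>z. f i (\<sigma> \<omega> z)) S \<in> D})"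
    using assms(6) unfolding cl_def by (elim exE conjE) (rule that)
  ultimately have "decoupled_field_axioms (T i) M (B i) (\<lambda>\<omega> z. f i (\<sigma> \<omega> z)) l g c t \<alpha>"
    using separable[OF i] zero_base[OF i] meas l assms(7)
    by (intro decoupled_field_axioms.intro) simp_all
  then have "decoupled_field (T i) M (B i) (\<lambda>\<omega> z. f i (\<sigma> \<omega> z)) l g c t \<alpha>"
    using frechet_topology_T[OF i] M by (intro decoupled_field.intro)
  then show ?thesis by blast
qed

lemma box_mean_f: "i \<in> J \<Longrightarrow> finite L \<Longrightarrow> box_mean L (\<lambda>z. f i (\<xi> z)) = f i (box_mean L \<xi>)"
  by (simp add: box_mean_def f_scale f_sum)

end

text \<open>\<open>pressure\<close> is defined by \<open>lim\<close>, which is a value even without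
  convergence; the first conjunct certifies that it is a genuine limit.\<close>

theorem mainTheorem1:
  fixes J :: "'i set" and le :: "'i \<Rightarrow> 'i \<Rightarrow> bool"
    and T :: "'i \<Rightarrow> 'y::real_vector topology" and B :: "'i \<Rightarrow> 'y set set"
    and f :: "'i \<Rightarrow> 'x::real_vector \<Rightarrow> 'y" and h :: "'i \<Rightarrow> 'i \<Rightarrow> 'y \<Rightarrow> 'y"
    and M :: "'w measure" and \<sigma> :: "'w \<Rightarrow> int ^ 'd \<Rightarrow> 'x"
    and l :: nat and x :: 'x
  assumes "projective_system J le T B f h"
    and "prob_space M"
    and "\<sigma> \<in> measurable M (PiM UNIV (\<lambda>_. proj_sigma J B f))"
    and "l \<ge> 1"
    and "\<And>i. i \<in> J \<Longrightarrow> cadi M (T i) (\<lambda>\<omega> z. f i (\<sigma> \<omega> z))"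
    and "\<And>i. i \<in> J \<Longrightarrow> cl M (T i) (B i) (\<lambda>\<omega> z. f i (\<sigma> \<omega> z))"
    and "\<And>i. i \<in> J \<Longrightarrow> translation_invariant l M (borel_of (T i)) (\<lambda>\<omega> z. f i (\<sigma> \<omega> z))"
  shows "(\<forall>u \<in> topological_dual (proj_topology J B f).
            convergent (\<lambda>n. box_pressure M \<sigma> (lattice_box 0 n) u)) \<and>
         field_entropy M (proj_base J B f) \<sigma> x
           = - fenchel_legendre (topological_dual (proj_topology J B f)) (pressure M \<sigma>) x"
proof -
  interpret projective_system J le T B f h by (rule assms(1))
  let ?p = "\<lambda>u n. box_pressure M \<sigma> (lattice_box 0 n) u"
  let ?dual = "topological_dual (proj_topology J B f)"
  let ?s = "field_entropy M (proj_base J B f) \<sigma> x"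
  \<comment> \<open>At n = 0 the box is empty and the normalisation would divide by 0, so all
    comparisons start at n = 1.\<close>
  have N: "real (card (lattice_box (0 :: int ^ 'd) n)) > 0" if "n \<ge> 1" for n
    using that by simp
  have field: "\<exists>g c t \<alpha>. decoupled_field (T i) M (B i) (\<lambda>\<omega> z. f i (\<sigma> \<omega> z)) l g c t \<alpha>" if "i \<in> J" for i
    using decoupled_field_exists[OF that assms(2-4)] assms(5-7) that by blast
  have pressure_Z: "ereal b \<le> ?p u n \<longleftrightarrow> ennreal (exp (b * real n ^ CARD('d)))
        \<le> decoupled_field.Z M (\<lambda>\<omega> z. f i (\<sigma> \<omega> z)) v n (topspace (T i))"
    if D: "decoupled_field (T i) M (B i) (\<lambda>\<omega> z. f i (\<sigma> \<omega> z)) l g c t \<alpha>" and i: "i \<in> J"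
      and v: "\<And>x. u x = v (f i x)" and n: "n \<ge> 1" for i g c t \<alpha> u v n b
  proof -
    interpret D: decoupled_field "T i" M "B i" "\<lambda>\<omega> z. f i (\<sigma> \<omega> z)" l g c t \<alpha> by (rule D)
    have "D.Z v n (topspace (T i)) = (\<integral>\<^sup>+\<omega>. ennreal (exp (u (\<Sum>z\<in>lattice_box 0 n. \<sigma> \<omega> z))) \<partial>M)"
      unfolding D.Z_def by (intro nn_integral_cong) (simp add: D.box_mean_in v f_sum[OF i])
    then show ?thesis
      unfolding box_pressure_def le_elog_divide_iff[OF N[OF n]] by simp
  qed
  have entropy_Z: "emeasure M {\<omega>\<in>space M. box_mean (lattice_box 0 n) (\<sigma> \<omega>) \<in> f i -` A}
      = decoupled_field.Z M (\<lambda>\<omega> z. f i (\<sigma> \<omega> z)) (\<lambda>_. 0) n A"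
    if D: "decoupled_field (T i) M (B i) (\<lambda>\<omega> z. f i (\<sigma> \<omega> z)) l g c t \<alpha>" and i: "i \<in> J"
      and A: "openin (T i) A" for i g c t \<alpha> n A
  proof -
    interpret D: decoupled_field "T i" M "B i" "\<lambda>\<omega> z. f i (\<sigma> \<omega> z)" l g c t \<alpha> by (rule D)
    show ?thesis unfolding D.Z_zero_eq[OF A] by (simp add: box_mean_f[OF i])
  qed
  have conv: "convergent (?p u)" if u: "u \<in> ?dual" for u
  proof -
    obtain i v where i: "i \<in> J" and v: "continuous_functional (T i) v" "\<And>x. u x = v (f i x)"
      using dual_factor[OF u] by metis
    obtain g c t \<alpha> where D: "decoupled_field (T i) M (B i) (\<lambda>\<omega> z. f i (\<sigma> \<omega> z)) l g c t \<alpha>"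
      using field[OF i] by metis
    interpret D: decoupled_field "T i" M "B i" "\<lambda>\<omega> z. f i (\<sigma> \<omega> z)" l g c t \<alpha> by (rule D)
    show ?thesis
    proof (rule convergent_erealI)
      fix b b' :: real assume fr: "\<exists>\<^sub>F n in sequentially. ereal b \<le> ?p u n" and b: "b' < b"
      have "\<exists>\<^sub>F n in sequentially. ennreal (exp (b * real n ^ CARD('d))) \<le> D.Z v n (topspace (T i))"
        by (rule frequently_rev_mp[OF fr], rule eventually_mono[OF eventually_ge_at_top[of 1]])
          (simp add: pressure_Z[OF D i, where u = u and v = v, OF v(2)])
      then have "\<forall>\<^sub>F n in sequentially. ennreal (exp (b' * real n ^ CARD('d))) \<le> D.Z v n (topspace (T i))"
        by (rule D.pressure_frequently_imp_eventually[OF v(1) b])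
      with eventually_ge_at_top[of 1] show "\<forall>\<^sub>F n in sequentially. ereal b' \<le> ?p u n"
        by eventually_elim (simp add: pressure_Z[OF D i, where u = u and v = v, OF v(2)])
    qed
  qed
  then have lim: "?p u \<longlonglongrightarrow> pressure M \<sigma> u" if "u \<in> ?dual" for u
    using that unfolding pressure_def by (simp add: convergent_LIMSEQ_iff)
  \<comment> \<open>The Chernoff half, with a real b in place of the difference of pressure and
    \<open>u x\<close>.\<close>
  have upper: "?s \<le> ereal b" if u: "u \<in> ?dual" and b: "pressure M \<sigma> u < ereal (b + u x)" for u b
  proof -
    obtain i v where i: "i \<in> J" and v: "continuous_functional (T i) v" "\<And>x. u x = v (f i x)"
      using dual_factor[OF u] by metis
    obtain g c t \<alpha> where D: "decoupled_field (T i) M (B i) (\<lambda>\<omega> z. f i (\<sigma> \<omega> z)) l g c t \<alpha>"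
      using field[OF i] by metis
    interpret D: decoupled_field "T i" M "B i" "\<lambda>\<omega> z. f i (\<sigma> \<omega> z)" l g c t \<alpha> by (rule D)
    obtain b\<^sub>0 where b0: "pressure M \<sigma> u < ereal b\<^sub>0" "b\<^sub>0 < b + u x"
      using ereal_dense2[OF b] by auto
    \<comment> \<open>The slack left between the pressure and \<open>b + u x\<close> pays for the
      oscillation of v: on \<open>f i x + \<epsilon> V\<close> the functional is at least
      \<open>u x - \<epsilon>\<close>.\<close>
    define \<epsilon> where "\<epsilon> = b + u x - b\<^sub>0"
    have \<epsilon>: "\<epsilon> > 0" using b0 by (simp add: \<epsilon>_def)
    obtain V where V: "V \<in> B i" "\<And>y. y \<in> V \<Longrightarrow> - 1 \<le> v y"
      using D.base_refine_functional[OF v(1) openin_topspace D.zero_in] by metis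
    define A where "A = (+) (f i x) ` dilate \<epsilon> V"
    have A: "openin (T i) A" unfolding A_def by (rule open_base_set[OF i \<epsilon> V(1)])
    have inA: "x \<in> f i -` A"
      using zero_mem_dilate[OF D.base_zero[OF V(1)]] unfolding A_def by (force intro: image_eqI[of _ _ 0])
    have low: "u x - \<epsilon> \<le> v y" if y: "y \<in> A" for y
    proof -
      obtain w where w: "w \<in> V" "y = f i x + \<epsilon> *\<^sub>R w" using y by (auto simp: A_def mem_dilate)
      have wt: "w \<in> topspace (T i)" using openin_subset[OF D.base_open[OF V(1)]] w(1) by blast
      have "v y = u x + \<epsilon> * v w"
        by (simp add: w(2) v(2) D.functional_add[OF v(1)] D.functional_scale[OF v(1)] f_in[OF i] D.scale_in wt)
      moreover have "\<epsilon> * (- 1) \<le> \<epsilon> * v w" using V(2)[OF w(1)] \<epsilon> by (intro mult_left_mono) auto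
      ultimately show ?thesis by simp
    qed
    have "\<forall>\<^sub>F n in sequentially. ?p u n < ereal b\<^sub>0" by (rule order_tendstoD(2)[OF lim[OF u] b0(1)])
    with eventually_ge_at_top[of 1]
    have "\<forall>\<^sub>F n in sequentially. elog (emeasure M {\<omega>\<in>space M. box_mean (lattice_box 0 n) (\<sigma> \<omega>) \<in> f i -` A})
        / ereal (real (card (lattice_box (0 :: int ^ 'd) n))) \<le> ereal b"
    proof eventually_elim
      case n: (elim n)
      let ?N = "real n ^ CARD('d)"
      have "ennreal (exp ((u x - \<epsilon>) * ?N)) * D.Z (\<lambda>_. 0) n A \<le> D.Z v n (topspace (T i))"
        by (rule D.chernoff_bound[OF v(1) A low n(1)])
      also have "\<dots> \<le> ennreal (exp (b\<^sub>0 * ?N))"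
        using n(2) pressure_Z[OF D i, where u = u and v = v and n = n and b = b\<^sub>0, OF v(2) n(1)] by (meson not_le linear)
      also have "b\<^sub>0 * ?N = (u x - \<epsilon>) * ?N + b * ?N" by (simp add: \<epsilon>_def algebra_simps)
      also have "ennreal (exp \<dots>) = ennreal (exp ((u x - \<epsilon>) * ?N)) * ennreal (exp (b * ?N))"
        by (simp add: exp_add ennreal_mult)
      finally have "D.Z (\<lambda>_. 0) n A \<le> ennreal (exp (b * ?N))"
        by (subst (asm) ennreal_mult_le_mult_iff) auto
      then show ?case
        unfolding entropy_Z[OF D i A] using N[OF n(1)] by (intro elog_divide_le) simp_all
    qed
    then have "limsup (\<lambda>n. elog (emeasure M {\<omega>\<in>space M. box_mean (lattice_box 0 n) (\<sigma> \<omega>) \<in> f i -` A})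
        / ereal (real (card (lattice_box (0 :: int ^ 'd) n)))) \<le> ereal b" by (rule Limsup_bounded)
    then have le: "liminf (\<lambda>n. elog (emeasure M {\<omega>\<in>space M. box_mean (lattice_box 0 n) (\<sigma> \<omega>) \<in> f i -` A})
        / ereal (real (card (lattice_box (0 :: int ^ 'd) n)))) \<le> ereal b"
      by (rule order_trans[OF Liminf_le_Limsup, rotated]) simp
    have "f i -` A \<in> proj_base J B f" unfolding A_def by (rule proj_baseI[OF i \<epsilon> V(1)])
    then have "?s \<le> liminf (\<lambda>n. elog (emeasure M {\<omega>\<in>space M. box_mean (lattice_box 0 n) (\<sigma> \<omega>) \<in> f i -` A})
        / ereal (real (card (lattice_box (0 :: int ^ 'd) n))))"
      unfolding field_entropy_def using inA by (intro INF_lower) simp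
    then show ?thesis using le by (rule order_trans)
  qed
  \<comment> \<open>The duality half: each real a above the entropy has a functional that witnesses
    it.\<close>
  have lower: "\<exists>u\<in>?dual. pressure M \<sigma> u \<le> ereal (a + u x)" if a: "?s < ereal a" for a
  proof -
    obtain A' where A': "A' \<in> proj_base J B f" "x \<in> A'"
      "liminf (\<lambda>n. elog (emeasure M {\<omega>\<in>space M. box_mean (lattice_box 0 n) (\<sigma> \<omega>) \<in> A'})
        / ereal (real (card (lattice_box (0 :: int ^ 'd) n)))) < ereal a"
      using a unfolding field_entropy_def INF_less_iff by blast
    obtain i x\<^sub>0 r C where i: "i \<in> J" and C: "r > 0" "C \<in> B i" "A' = f i -` ((+) (f i x\<^sub>0) ` dilate r C)"
      by (rule proj_baseE[OF A'(1)], rule that)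
    define A where "A = (+) (f i x\<^sub>0) ` dilate r C"
    have A: "openin (T i) A" "f i x \<in> A"
      unfolding A_def using open_base_set[OF i C(1,2)] A'(2) C(3) by auto
    obtain g c t \<alpha> where D: "decoupled_field (T i) M (B i) (\<lambda>\<omega> z. f i (\<sigma> \<omega> z)) l g c t \<alpha>"
      using field[OF i] by metis
    interpret D: decoupled_field "T i" M "B i" "\<lambda>\<omega> z. f i (\<sigma> \<omega> z)" l g c t \<alpha> by (rule D)
    \<comment> \<open>A liminf below a means that rate a fails infinitely often on the neighbourhood
      A, which is the hypothesis of \<open>separating_functional\<close>.\<close>
    have na: "\<not> (\<forall>\<^sub>F n in sequentially. ennreal (exp (a * real n ^ CARD('d))) \<le> D.Z (\<lambda>_. 0) n A)"
    proof
      assume "\<forall>\<^sub>F n in sequentially. ennreal (exp (a * real n ^ CARD('d))) \<le> D.Z (\<lambda>_. 0) n A"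
      with eventually_ge_at_top[of 1]
      have "\<forall>\<^sub>F n in sequentially. ereal a \<le> elog (emeasure M {\<omega>\<in>space M. box_mean (lattice_box 0 n) (\<sigma> \<omega>) \<in> A'})
        / ereal (real (card (lattice_box (0 :: int ^ 'd) n)))"
      proof eventually_elim
        case n: (elim n)
        then show ?case
          unfolding C(3) A_def[symmetric] entropy_Z[OF D i A(1)] le_elog_divide_iff[OF N[OF n(1)]] by simp
      qed
      from Liminf_bounded[OF this] A'(3) show False by simp
    qed
    obtain v where v: "continuous_functional (T i) v"
      and sep: "\<And>z b. D.below_entropy z b \<Longrightarrow> v z + b \<le> v (f i x) + a"
      by (rule D.separating_functional[OF A na], rule that)
    define u where "u = (\<lambda>x. v (f i x))"
    have u: "u \<in> ?dual" unfolding u_def by (rule functional_in_dual[OF i v])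
    have "pressure M \<sigma> u \<le> ereal (a + u x)"
    proof (rule ccontr)
      assume "\<not> ?thesis"
      then have "ereal (a + u x) < pressure M \<sigma> u" by simp
      then obtain b where b: "a + u x < b" "ereal b < pressure M \<sigma> u" using ereal_dense2 by fastforce
      obtain b' where b': "a + u x < b'" "b' < b" using dense[OF b(1)] by blast
      have "\<forall>\<^sub>F n in sequentially. ereal b < ?p u n" by (rule order_tendstoD(1)[OF lim[OF u] b(2)])
      with eventually_ge_at_top[of 1]
      have "\<forall>\<^sub>F n in sequentially. ennreal (exp (b * real n ^ CARD('d))) \<le> D.Z v n (topspace (T i))"
      proof eventually_elim
        case n: (elim n)
        have "ereal b \<le> ?p u n" using n(2) by simp
        then show ?case using pressure_Z[OF D i, where u = u and v = v and n = n and b = b, OF _ n(1)] by (simp add: u_def)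
      qed
      then have "\<exists>\<^sub>F n in sequentially. ennreal (exp (b * real n ^ CARD('d))) \<le> D.Z v n (topspace (T i))"
        by (intro eventually_frequently) simp_all
      \<comment> \<open>At the concentration point the functional cancels: separation bounds
        \<open>v z + (b' - v z)\<close>, which is b', by a + u x, against the choice of b'.\<close>
      then obtain z where "D.below_entropy z (b' - v z)" using D.concentration_point[OF v b'(2)] by metis
      then have "b' \<le> a + u x" using sep by (fastforce simp: u_def)
      then show False using b'(1) by simp
    qed
    then show ?thesis using u by blast
  qed
  have "?s = - fenchel_legendre ?dual (pressure M \<sigma>) x"
  proof (rule antisym)
    \<comment> \<open>A real threshold placed between the two sides lets \<open>upper\<close> and
      \<open>lower\<close>, which speak of real bounds, cover infinite values too.\<close>
    have "ereal (u x) - pressure M \<sigma> u \<le> - ?s" if u: "u \<in> ?dual" for u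
    proof (rule ccontr)
      assume "\<not> ?thesis"
      then have "- ?s < ereal (u x) - pressure M \<sigma> u" by simp
      then obtain b where b: "- ?s < ereal b" "ereal b < ereal (u x) - pressure M \<sigma> u" using ereal_dense2 by blast
      have "pressure M \<sigma> u < ereal (- b + u x)"
        using b(2) by (cases "pressure M \<sigma> u") auto
      then have "?s \<le> ereal (- b)" by (rule upper[OF u])
      then have "ereal b \<le> - ?s" by (metis ereal_minus_le_minus ereal_uminus_uminus uminus_ereal.simps(1))
      then show False using b(1) by simp
    qed
    then have "fenchel_legendre ?dual (pressure M \<sigma>) x \<le> - ?s"
      unfolding fenchel_legendre_def by (rule SUP_least)
    then show "?s \<le> - fenchel_legendre ?dual (pressure M \<sigma>) x"
      by (metis ereal_minus_le_minus ereal_uminus_uminus)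
    show "- fenchel_legendre ?dual (pressure M \<sigma>) x \<le> ?s"
    proof (rule ccontr)
      assume "\<not> ?thesis"
      then obtain a where a: "?s < ereal a" "ereal a < - fenchel_legendre ?dual (pressure M \<sigma>) x"
        using ereal_dense2 by (meson not_le)
      obtain u where u: "u \<in> ?dual" "pressure M \<sigma> u \<le> ereal (a + u x)" using lower[OF a(1)] by blast
      have "ereal (- a) \<le> ereal (u x) - pressure M \<sigma> u"
        using u(2) by (cases "pressure M \<sigma> u") auto
      also have "\<dots> \<le> fenchel_legendre ?dual (pressure M \<sigma>) x"
        unfolding fenchel_legendre_def using u(1) by (rule SUP_upper)
      finally have "- fenchel_legendre ?dual (pressure M \<sigma>) x \<le> ereal a"
        by (metis ereal_minus_le_minus ereal_uminus_uminus uminus_ereal.simps(1))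
      then show False using a(2) by simp
    qed
  qed
  then show ?thesis using conv by blast
qed


end
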